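(* Let $A\subset\mathbb{R}^2$ and $a\in A$ be given. Then $\operatorname{reach}(A,a)>0$ if and only if one of the following statements holds: (1) $a$ is an interior point of $A$; (2) $a$ is an isolated point of $A$; (3) $A$ is of type $T^i$ at $a$ for some $i\in\{1,2,3\}$.
   Context: For nonempty $A\subset\mathbb{R}^d$, $\operatorname{Unp}A$ is the set of all $z\in\mathbb{R}^d$ for which there is exactly one $a\in A$ with $|z-a|=\operatorname{dist}(z,A)$. For $a\in A$, $\operatorname{reach}(A,a):=\sup\{r\ge 0: B(a,r)\subset\operatorname{Unp}A\}$, where $B(a,r)$ is the open ball and $B(a,0):=\emptyset$. A real function $u$ on an open interval $C\subset\mathbb{R}$ is semiconcave if it is continuous and there is $c\ge 0$ such that $x\mapsto u(x)-\frac c2|x|^2$ is concave on $C$; $v$ is semiconvex if $-v$ is semiconcave. For a real function $f$ with domain $\operatorname{Dom}(f)\subset \mathbb{R}$, $\operatorname{hypo}f:=\{(x,t)\in\operatorname{Dom}(f)\times\mathbb{R}: f(x)\ge t\}$ and $\operatorname{epi}f:=\{(x,t)\in\operatorname{Dom}(f)\times\mathbb{R}: f(x)\le t\}$. Let $M\subset\mathbb{R}^2$ and $r>0$. - $M$ is a $\tilde T^1_r$-set if there is a Lipschitz semiconcave function $\varphi$ on $(-r,r)$ such that $\varphi(0)=0$ and $M=B(0,r)\cap\operatorname{hypo}\varphi$. - $M$ is a $\tilde T^2_r$-set if there are Lipschitz functions $\psi\le\varphi$ on $(-r,r)$ such that $\varphi$ is semiconcave, $\psi$ is semiconvex, $\varphi(0)=\psi(0)=0$,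 $\varphi'(0)=\psi'(0)=0$ and $M=B(0,r)\cap\operatorname{hypo}\varphi\cap\operatorname{epi}\psi$. - $M$ is a $\tilde T^3_r$-set if there are Lipschitz functions $\psi\le\varphi$ on $[0,r)$ such that $\varphi$ is semiconcave on $(0,r)$, $\psi$ is semiconvex on $(0,r)$, $\varphi(0)=\psi(0)=0$, the right derivatives satisfy $\varphi'_+(0)=\psi'_+(0)=0$, and $M=B(0,r)\cap\operatorname{hypo}\varphi\cap\operatorname{epi}\psi$. - $M$ is of type $T^i$ ($i=1,2,3$) at $x\in M$ if there exists an isometry $G:\mathbb{R}^2\to\mathbb{R}^2$ such that $G(x)=0$ and $G(M\cap B(x,r))$ is a $\tilde T^i_r$-set for some $r>0$. *)

theory Defs
  imports "HOL-Analysis.Analysis"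
begin

definition Unp :: "'a::euclidean_space set \<Rightarrow> 'a set" where
  "Unp A = {z. \<exists>!a. a \<in> A \<and> dist z a = infdist z A}"

text \<open>The supremum is taken in the extended reals, as it may be infinite (e.g. for closed convex
  sets). The radius \<open>r = 0\<close> is always admissible, since \<open>ball a 0 = {}\<close>.\<close>

definition reach_at :: "'a::euclidean_space set \<Rightarrow> 'a \<Rightarrow> ereal" where
  "reach_at A a = Sup {ereal r | r. 0 \<le> r \<and> ball a r \<subseteq> Unp A}"

definition semiconcave_on :: "real set \<Rightarrow> (real \<Rightarrow> real) \<Rightarrow> bool" where
  "semiconcave_on C u \<longleftrightarrow>
     continuous_on C u \<and> (\<exists>c\<ge>0. concave_on C (\<lambda>x. u x - c / 2 * \<bar>x\<bar>\<^sup>2))"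

definition semiconvex_on :: "real set \<Rightarrow> (real \<Rightarrow> real) \<Rightarrow> bool" where
  "semiconvex_on C v \<longleftrightarrow> semiconcave_on C (\<lambda>x. - v x)"

text \<open>A partial function with domain \<open>D\<close> is represented by a total function together with \<open>D\<close>;
  its values outside \<open>D\<close> play no role. The plane is \<open>real \<times> real\<close>, whose product metric is the
  Euclidean one.\<close>

definition hypo :: "real set \<Rightarrow> (real \<Rightarrow> real) \<Rightarrow> (real \<times> real) set" where
  "hypo D f = {(x, t). x \<in> D \<and> f x \<ge> t}"

definition epi :: "real set \<Rightarrow> (real \<Rightarrow> real) \<Rightarrow> (real \<times> real) set" where
  "epi D f = {(x, t). x \<in> D \<and> f x \<le> t}"

definition T1_set :: "real \<Rightarrow> (real \<times> real) set \<Rightarrow> bool" where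
  "T1_set r M \<longleftrightarrow>
     (\<exists>\<phi>. (\<exists>L. L-lipschitz_on {-r<..<r} \<phi>) \<and> semiconcave_on {-r<..<r} \<phi> \<and> \<phi> 0 = 0 \<and>
          M = ball 0 r \<inter> hypo {-r<..<r} \<phi>)"

definition T2_set :: "real \<Rightarrow> (real \<times> real) set \<Rightarrow> bool" where
  "T2_set r M \<longleftrightarrow>
     (\<exists>\<phi> \<psi>. (\<exists>L. L-lipschitz_on {-r<..<r} \<phi>) \<and> (\<exists>L. L-lipschitz_on {-r<..<r} \<psi>) \<and>
          (\<forall>x\<in>{-r<..<r}. \<psi> x \<le> \<phi> x) \<and>
          semiconcave_on {-r<..<r} \<phi> \<and> semiconvex_on {-r<..<r} \<psi> \<and>
          \<phi> 0 = 0 \<and> \<psi> 0 = 0 \<and>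
          (\<phi> has_real_derivative 0) (at 0) \<and> (\<psi> has_real_derivative 0) (at 0) \<and>
          M = ball 0 r \<inter> hypo {-r<..<r} \<phi> \<inter> epi {-r<..<r} \<psi>)"

definition T3_set :: "real \<Rightarrow> (real \<times> real) set \<Rightarrow> bool" where
  "T3_set r M \<longleftrightarrow>
     (\<exists>\<phi> \<psi>. (\<exists>L. L-lipschitz_on {0..<r} \<phi>) \<and> (\<exists>L. L-lipschitz_on {0..<r} \<psi>) \<and>
          (\<forall>x\<in>{0..<r}. \<psi> x \<le> \<phi> x) \<and>
          semiconcave_on {0<..<r} \<phi> \<and> semiconvex_on {0<..<r} \<psi> \<and>
          \<phi> 0 = 0 \<and> \<psi> 0 = 0 \<and>
          (\<phi> has_real_derivative 0) (at_right 0) \<and> (\<psi> has_real_derivative 0) (at_right 0) \<and>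
          M = ball 0 r \<inter> hypo {0..<r} \<phi> \<inter> epi {0..<r} \<psi>)"

definition T_set :: "nat \<Rightarrow> real \<Rightarrow> (real \<times> real) set \<Rightarrow> bool" where
  "T_set i r M \<longleftrightarrow> i = 1 \<and> T1_set r M \<or> i = 2 \<and> T2_set r M \<or> i = 3 \<and> T3_set r M"

definition isometry :: "('a::metric_space \<Rightarrow> 'b::metric_space) \<Rightarrow> bool" where
  "isometry G \<longleftrightarrow> (\<forall>x y. dist (G x) (G y) = dist x y)"

definition of_type_T :: "nat \<Rightarrow> (real \<times> real) set \<Rightarrow> real \<times> real \<Rightarrow> bool" where
  "of_type_T i M x \<longleftrightarrow>
     x \<in> M \<and>
     (\<exists>G :: real \<times> real \<Rightarrow> real \<times> real. isometry G \<and> G x = 0 \<and>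
        (\<exists>r>0. T_set i r (G ` (M \<inter> ball x r))))"

end

theory Submission
  imports Defs
begin

text \<open>If all points near \<open>a\<close> have a unique nearest point in \<open>A\<close>, then \<open>A\<close> lies outside balls of a
  uniform radius \<open>\<rho>\<close> touching \<open>A\<close> at the feet of the points near \<open>a\<close>: a foot stays the nearest point
  when one moves away from it, by Brouwer's fixed point theorem. The limits of the unit directions
  \<open>(y - a) / \<bar>y - a\<bar>\<close> with \<open>y \<in> A\<close> then decide the type. Two linearly independent ones force all
  normals near \<open>a\<close> into an open half-plane, so \<open>A\<close> is a hypograph (type 1); otherwise there are only
  one or two opposite ones, the normals are nearly vertical, and \<open>A\<close> is a strip between two graphs
  over a half-line (type 3) or a line (type 2). Touching balls of radius \<open>\<rho>\<close> support the graphs by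
  parabolas, which is semiconcavity.

  Conversely, a set of one of the types has, for points \<open>x\<close>, \<open>y\<close> near \<open>a\<close>, a point within
  \<open>K t \<bar>x - y\<bar>\<^sup>2\<close> of \<open>x + t (y - x)\<close>. Letting \<open>t\<close> tend to 0, two points of \<open>A\<close> nearest to the same
  \<open>z\<close> satisfy \<open>\<bar>x - y\<bar>\<^sup>2 \<le> 2 K dist z x \<bar>x - y\<bar>\<^sup>2\<close>, so they agree if \<open>z\<close> is close to \<open>a\<close>.\<close>

section \<open>Nearest points\<close>

text \<open>A proximal inequality with a fixed radius survives limits. Normals are first known only
  at feet of outside points; the uniform radius carries them to every boundary point where one is
  wanted. As \<open>A\<close> need not be closed, local closedness must itself be extracted from the
  distances being attained. The distance function is never differentiated. Since the touching ball
  misses \<open>A\<close>, moving \<open>z\<close> towards its centre raises the distance to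
  \<open>A\<close>. This yields a maximum principle: a segment lies in \<open>A\<close> if no foot
  direction met along it is orthogonal to it and the ends behave. It takes the place of convexity
  when fibres and graphs are built. A tangent direction bounds normals from one side only. With a
  single direction the missing bound comes from testing the proximal inequality at the base point,
  which works because \<open>A\<close> stays quadratically close to its tangent directions. In the
  converse the defect has to be linear in \<open>t\<close>, the order seen by the first variation,
  and quadratic in the distance of \<open>x\<close> and \<open>y\<close>, so that it can be absorbed
  near \<open>a\<close>.\<close>

lemma reach_at_pos_iff: "reach_at A a > 0 \<longleftrightarrow> (\<exists>r>0. ball a r \<subseteq> Unp A)"
proof
  assume "reach_at A a > 0"
  then obtain r where "ball a r \<subseteq> Unp A" "0 < ereal r"
    unfolding reach_at_def less_Sup_iff by blast
  then show "\<exists>r>0. ball a r \<subseteq> Unp A" by auto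
next
  assume "\<exists>r>0. ball a r \<subseteq> Unp A"
  then obtain r where r: "r > 0" "ball a r \<subseteq> Unp A" by blast
  then have "ereal r \<le> reach_at A a"
    unfolding reach_at_def by (intro Sup_upper) (auto intro!: exI[of _ r])
  moreover have "0 < ereal r" using r(1) by simp
  ultimately show "reach_at A a > 0" by (rule less_le_trans[rotated])
qed

definition nearest :: "'a::euclidean_space set \<Rightarrow> 'a \<Rightarrow> 'a" where
  "nearest A z = (THE x. x \<in> A \<and> dist z x = infdist z A)"

lemma nearest_Unp:
  assumes "z \<in> Unp A"
  shows "nearest A z \<in> A" "dist z (nearest A z) = infdist z A"
proof -
  have "\<exists>!x. x \<in> A \<and> dist z x = infdist z A"
    using assms by (simp add: Unp_def)
  from theI'[OF this] show "nearest A z \<in> A" "dist z (nearest A z) = infdist z A"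
    by (auto simp: nearest_def)
qed

lemma nearest_unique:
  assumes "z \<in> Unp A" "x \<in> A" "dist z x = infdist z A"
  shows "nearest A z = x"
  using assms nearest_Unp[OF assms(1)] unfolding Unp_def by blast

lemma infdist_geI:
  assumes "A \<noteq> {}" "\<And>y. y \<in> A \<Longrightarrow> d \<le> dist z y"
  shows "d \<le> infdist z A"
  using assms by (simp add: infdist_notempty cINF_greatest)

lemma infdist_le_norm:
  fixes A :: "'a::real_normed_vector set"
  assumes "0 \<in> A"
  shows "infdist z A \<le> norm z"
  using infdist_le[OF assms, of z] by simp

text \<open>Uniqueness includes existence: the distance is attained, so a point at distance zero is
  its own nearest point. This is the local closedness of \<open>A\<close>.\<close>

lemma Unp_ball_closed:
  assumes "ball 0 R \<subseteq> Unp A" "z \<in> ball 0 R" "z \<in> closure A"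
  shows "z \<in> A"
proof -
  have "z \<in> Unp A" using assms by blast
  then obtain x where "x \<in> A" "dist z x = infdist z A" by (auto simp: Unp_def)
  moreover have "infdist z A = 0"
    using assms(3) \<open>x \<in> A\<close> in_closure_iff_infdist_zero by blast
  ultimately show ?thesis by simp
qed

text \<open>Closed graph theorem with compact codomain. The radius is halved because a nearest point
  is at most twice as far from 0 as \<open>z\<close>, which keeps it in the ball where
  \<open>A\<close> is closed.\<close>

lemma continuous_on_nearest:
  fixes A :: "'a::euclidean_space set"
  assumes "0 \<in> A" "ball 0 R \<subseteq> Unp A"
  shows "continuous_on (ball 0 (R/2)) (nearest A)"
proof -
  let ?S = "ball (0::'a) (R/2)" and ?T = "cball (0::'a) R"
  have S: "z \<in> Unp A" if "z \<in> ?S" for z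
  proof -
    have "norm z < R" using that norm_ge_zero[of z] unfolding mem_ball_0 by linarith
    then show ?thesis using assms(2) by auto
  qed
  have bd: "norm p < R" if "z \<in> ?S" "dist z p = infdist z A" for z p
  proof -
    have "norm p \<le> norm z + dist z p"
      by (metis dist_0_norm dist_triangle)
    then show ?thesis using that infdist_le_norm[OF assms(1), of z] by simp
  qed
  have im: "nearest A \<in> ?S \<rightarrow> ?T"
    using bd nearest_Unp(2) S by fastforce
  \<comment> \<open>\<open>closure A\<close> makes \<open>?C\<close> closed; for nearest points,
    which stay in the ball of radius \<open>R\<close>, it can be replaced by
    \<open>A\<close>.\<close>
  let ?C = "{w. dist (fst w) (snd w) = infdist (fst w) A} \<inter> (UNIV \<times> closure A)"
  have "closed {w::'a\<times>'a. dist (fst w) (snd w) = infdist (fst w) A}"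
    by (intro closed_Collect_eq continuous_intros)
  then have "closed ?C" by (intro closed_Int closed_Times) auto
  moreover have "(\<lambda>z. (z, nearest A z)) ` ?S = (?S \<times> ?T) \<inter> ?C"
  proof (intro equalityI subsetI)
    fix w assume "w \<in> (\<lambda>z. (z, nearest A z)) ` ?S"
    then show "w \<in> (?S \<times> ?T) \<inter> ?C"
      using bd nearest_Unp S closure_subset by (fastforce simp: less_imp_le)
  next
    fix w assume w: "w \<in> (?S \<times> ?T) \<inter> ?C"
    obtain z p where zp: "w = (z, p)" by (cases w)
    have "z \<in> ?S" "p \<in> closure A" "dist z p = infdist z A"
      using w by (auto simp: zp)
    moreover from this have "p \<in> A"
      using Unp_ball_closed[OF assms(2)] bd by simp
    ultimately have "p = nearest A z"
      using nearest_unique S by metis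
    then show "w \<in> (\<lambda>z. (z, nearest A z)) ` ?S"
      using \<open>z \<in> ?S\<close> zp by blast
  qed
  ultimately have "closedin (top_of_set (?S \<times> ?T)) ((\<lambda>z. (z, nearest A z)) ` ?S)"
    by (simp add: closedin_closed_Int)
  then show ?thesis
    using continuous_closed_graph_eq[OF compact_cball im] by simp
qed

text \<open>Brouwer's theorem produces a point \<open>w\<close> on the far side of \<open>z\<close> whose nearest point
  sees \<open>z\<close> on the way; then \<open>z\<close> and \<open>w\<close> share their nearest point. This replaces the flow of the
  gradient of the distance function in Federer's argument.\<close>

lemma nearest_extends:
  fixes A :: "'a::euclidean_space set"
  assumes "0 \<in> A" "ball 0 R \<subseteq> Unp A" and z: "z \<in> ball 0 (R/2)" "z \<notin> A"
  obtains \<epsilon> where "\<epsilon> > 0"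
    "infdist (z + \<epsilon> *\<^sub>R ((z - nearest A z) /\<^sub>R infdist z A)) A = infdist z A + \<epsilon>"
proof -
  obtain \<epsilon> where e: "\<epsilon> > 0" "cball z \<epsilon> \<subseteq> ball 0 (R/2)"
    using z(1) open_contains_cball[of "ball 0 (R/2)"] by blast
  have sub: "ball 0 (R/2) \<subseteq> Unp A"
  proof
    fix y :: 'a assume "y \<in> ball 0 (R/2)"
    then have "norm y < R" using norm_ge_zero[of y] unfolding mem_ball_0 by linarith
    then show "y \<in> Unp A" using assms(2) by auto
  qed
  define F where "F w = z + \<epsilon> *\<^sub>R ((z - nearest A w) /\<^sub>R norm (z - nearest A w))" for w
  have ne: "norm (z - nearest A w) \<noteq> 0" if "w \<in> cball z \<epsilon>" for w
  proof -
    have "w \<in> Unp A" using that e(2) sub by blast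
    from nearest_Unp(1)[OF this] show ?thesis using z(2) by auto
  qed
  have c: "continuous_on (cball z \<epsilon>) (nearest A)"
    using continuous_on_nearest[OF assms(1,2)] e(2) continuous_on_subset by blast
  have "continuous_on (cball z \<epsilon>) F"
    unfolding F_def using ne by (intro continuous_intros c) auto
  moreover have "F \<in> cball z \<epsilon> \<rightarrow> cball z \<epsilon>"
    using e(1) ne by (auto simp: F_def dist_norm)
  ultimately obtain w where w: "w \<in> cball z \<epsilon>" "F w = w"
    using brouwer_ball[OF e(1)] by blast
  define p where "p = nearest A w"
  define m where "m = norm (z - p)"
  have m: "m > 0" using ne[OF w(1)] by (simp add: m_def p_def)
  have p: "p \<in> A" "dist w p = infdist w A"
    using nearest_Unp[of w A] w(1) e sub unfolding p_def by blast+
  have weq: "w = z + \<epsilon> *\<^sub>R ((z - p) /\<^sub>R m)"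
    using w(2) by (simp add: F_def p_def m_def)
  have "w - p = (1 + \<epsilon> / m) *\<^sub>R (z - p)"
    by (simp add: weq algebra_simps divide_inverse)
  then have "dist w p = \<bar>1 + \<epsilon> / m\<bar> * m"
    by (simp add: dist_norm m_def)
  also have "\<dots> = m + \<epsilon>"
    using m e(1) by (simp add: abs_of_pos add_pos_pos field_simps)
  finally have wp: "infdist w A = m + \<epsilon>" using p(2) by simp
  have "dist w z = \<epsilon>"
    using e(1) m by (simp add: weq dist_norm flip: m_def)
  \<comment> \<open>The distance to \<open>A\<close> is 1-Lipschitz and equals
    \<open>m + \<epsilon>\<close> at \<open>w\<close>, which is only \<epsilon> away from
    \<open>z\<close>.\<close>
  then have "m \<le> infdist z A"
    using infdist_triangle[of w A z] wp by (simp add: dist_commute)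
  moreover have "infdist z A \<le> m" using infdist_le[OF p(1), of z] by (simp add: m_def dist_norm)
  ultimately have mz: "infdist z A = m" by simp
  have "nearest A z = p"
    using nearest_unique[of z A p] p(1) mz sub z(1) by (auto simp: m_def dist_norm)
  then show thesis
    using that[OF e(1)] wp weq mz by simp
qed

text \<open>For \<rho> \<ge> 0 this says that the open ball of radius \<rho> around
  \<open>x + \<rho> *\<^sub>R v\<close> misses \<open>A\<close>. The expanded form passes to limits
  in \<open>x\<close> and \<open>v\<close> and can be averaged over several test points.\<close>

definition prox_normal :: "'a::euclidean_space set \<Rightarrow> real \<Rightarrow> 'a \<Rightarrow> 'a \<Rightarrow> bool" where
  "prox_normal A \<rho> x v \<longleftrightarrow> norm v = 1 \<and> (\<forall>y\<in>A. 2 * \<rho> * ((y - x) \<bullet> v) \<le> (norm (y - x))\<^sup>2)"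

text \<open>Positive distance makes \<open>foot\<close> false for \<open>z\<close> in
  \<open>A\<close>, so conditions on feet at the ends of a segment hold vacuously when the ends
  belong to \<open>A\<close>.\<close>

definition foot :: "'a::euclidean_space set \<Rightarrow> real \<Rightarrow> 'a \<Rightarrow> 'a \<Rightarrow> 'a \<Rightarrow> bool" where
  "foot A \<rho> z x v \<longleftrightarrow> x \<in> A \<and> infdist z A > 0 \<and> z = x + infdist z A *\<^sub>R v \<and> prox_normal A \<rho> x v"

lemma prox_normal_iff_dist:
  assumes "norm v = 1" "\<rho> \<ge> 0"
  shows "2 * \<rho> * ((y - x) \<bullet> v) \<le> (norm (y - x))\<^sup>2 \<longleftrightarrow> \<rho> \<le> dist (x + \<rho> *\<^sub>R v) y"
proof -
  have "(dist (x + \<rho> *\<^sub>R v) y)\<^sup>2 = (norm ((y - x) - \<rho> *\<^sub>R v))\<^sup>2"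
    by (simp add: dist_norm norm_minus_commute algebra_simps)
  also have "\<dots> = (norm (y - x))\<^sup>2 - 2 * \<rho> * ((y - x) \<bullet> v) + \<rho>\<^sup>2"
  proof -
    have "v \<bullet> v = 1" using assms(1) by (simp flip: power2_norm_eq_inner)
    then show ?thesis
      unfolding power2_norm_eq_inner inner_diff
      by (simp add: inner_commute power2_eq_square algebra_simps)
  qed
  finally have "2 * \<rho> * ((y - x) \<bullet> v) \<le> (norm (y - x))\<^sup>2 \<longleftrightarrow> \<rho>\<^sup>2 \<le> (dist (x + \<rho> *\<^sub>R v) y)\<^sup>2"
    by linarith
  then show ?thesis using assms(2) by (simp add: abs_le_square_iff[symmetric])
qed

text \<open>Follow the ray from the nearest point \<open>x\<close> through \<open>z\<close> as long
  as \<open>x\<close> remains nearest. If this stopped before length \<open>R/4\<close>,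
  \<open>nearest_extends\<close> would prolong it. The constants fit: \<open>z\<close> within
  \<open>R/8\<close> puts \<open>x\<close> within \<open>R/4\<close>, so the ray stays within
  \<open>R/2\<close>, where \<open>nearest_extends\<close> applies.\<close>

lemma foot_exists_Unp:
  fixes A :: "'a::euclidean_space set"
  assumes "0 \<in> A" "ball 0 R \<subseteq> Unp A" and z: "z \<in> ball 0 (R/8)" "z \<notin> A"
  shows "\<exists>x v. foot A (R/8) z x v"
proof -
  have nz: "norm z < R/8" and R: "R > 0" using z(1) norm_ge_zero[of z] unfolding mem_ball_0 by linarith+
  have sub: "y \<in> Unp A" if "norm y < R" for y using that assms(2) by auto
  define d where "d = infdist z A"
  define x where "x = nearest A z"
  have zU: "z \<in> Unp A" using sub nz R by simp
  have x: "x \<in> A" "dist z x = d" using nearest_Unp[OF zU] by (auto simp: x_def d_def)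
  have d: "d > 0" using x z(2) by (metis dist_pos_lt)
  have dle: "d \<le> norm z" using infdist_le_norm[OF assms(1)] by (simp add: d_def)
  define v where "v = (z - x) /\<^sub>R d"
  have v: "norm v = 1" using x(2) d by (simp add: v_def dist_norm)
  have zeq: "z = x + d *\<^sub>R v" using d by (simp add: v_def)
  have nx: "norm x < R/4"
  proof -
    have "norm x \<le> norm z + dist z x" by (metis dist_0_norm dist_triangle)
    then show ?thesis using x(2) dle nz by simp
  qed
  define f where "f t = infdist (x + t *\<^sub>R v) A - t" for t
  have contf: "continuous_on UNIV f" unfolding f_def by (intro continuous_intros)
  \<comment> \<open>The lengths at which \<open>x\<close> is still a nearest point; compactness
    provides a longest one.\<close>
  define S where "S = {t \<in> {d..R/4}. f t = 0}"
  have "S = {d..R/4} \<inter> {t. f t = 0}" by (auto simp: S_def)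
  moreover have "closed {t. f t = 0}"
    by (rule closed_Collect_eq[OF contf continuous_on_const])
  ultimately have "compact S" by (simp add: compact_Int_closed)
  have "f d = 0" using zeq d_def by (simp add: f_def)
  then have dS: "d \<in> S" using dle nz R by (simp add: S_def)
  then obtain \<tau> where tS: "\<tau> \<in> S" and tmax: "\<And>t. t \<in> S \<Longrightarrow> t \<le> \<tau>"
    using compact_attains_sup[OF \<open>compact S\<close>] by blast
  have \<tau>: "d \<le> \<tau>" "\<tau> \<le> R/4" "infdist (x + \<tau> *\<^sub>R v) A = \<tau>" using tS by (auto simp: S_def f_def)
  \<comment> \<open>If \<open>x\<close> realises the distance at some point of the ray, it does so
    at all earlier points, again by the Lipschitz property.\<close>
  have down: "infdist (x + t *\<^sub>R v) A = t" if "0 \<le> t" "t \<le> s" "infdist (x + s *\<^sub>R v) A = s" for s t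
  proof -
    have eq: "dist (x + s *\<^sub>R v) (x + t *\<^sub>R v) = s - t"
    proof -
      have "x + s *\<^sub>R v - (x + t *\<^sub>R v) = (s - t) *\<^sub>R v" by (simp add: algebra_simps)
      then show ?thesis using v that by (simp add: dist_norm)
    qed
    then have "t \<le> infdist (x + t *\<^sub>R v) A"
      using infdist_triangle[of "x + s *\<^sub>R v" A "x + t *\<^sub>R v"] that(3) unfolding eq by linarith
    moreover have "infdist (x + t *\<^sub>R v) A \<le> t"
      using infdist_le[OF x(1), of "x + t *\<^sub>R v"] v that by (simp add: dist_norm)
    ultimately show ?thesis by simp
  qed
  have "\<tau> = R/4"
  proof (rule ccontr)
    assume "\<tau> \<noteq> R/4"
    then have lt: "\<tau> < R/4" using \<tau> by simp
    define y where "y = x + \<tau> *\<^sub>R v"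
    have "norm y \<le> norm x + \<tau>" using norm_triangle_ineq[of x "\<tau> *\<^sub>R v"] v \<tau> d by (simp add: y_def)
    then have ny: "norm y < R/2" using nx lt by simp
    have iy: "infdist y A = \<tau>" using \<tau> by (simp add: y_def)
    have "y \<notin> A" using iy \<tau> d by auto
    have yU: "y \<in> Unp A" using sub ny R by simp
    have "nearest A y = x"
      using nearest_unique[OF yU x(1)] v \<tau> d iy by (simp add: y_def dist_norm)
    moreover obtain \<epsilon> where e: "\<epsilon> > 0"
        "infdist (y + \<epsilon> *\<^sub>R ((y - nearest A y) /\<^sub>R infdist y A)) A = infdist y A + \<epsilon>"
      using nearest_extends[OF assms(1,2) _ \<open>y \<notin> A\<close>] ny by auto
    moreover have "(y - x) /\<^sub>R \<tau> = v" using \<tau> d by (simp add: y_def)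
    moreover have "y + \<epsilon> *\<^sub>R v = x + (\<tau> + \<epsilon>) *\<^sub>R v" by (simp add: y_def scaleR_add_left)
    ultimately have "infdist (x + (\<tau> + \<epsilon>) *\<^sub>R v) A = \<tau> + \<epsilon>"
      using iy by metis
    \<comment> \<open>The extension may overshoot \<open>R/4\<close>; cutting it back keeps
      \<open>q\<close> in \<open>S\<close> while still exceeding \<tau>.\<close>
    moreover define q where "q = min (\<tau> + \<epsilon>) (R/4)"
    have q: "q \<le> R/4" "q \<le> \<tau> + \<epsilon>" "\<tau> < q" using e(1) lt by (auto simp: q_def min_def)
    ultimately have "infdist (x + q *\<^sub>R v) A = q"
      using down[of q "\<tau> + \<epsilon>"] \<tau> d by simp
    then have "q \<in> S" using \<tau> q by (simp add: S_def f_def)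
    then show False using tmax q by force
  qed
  then have far: "infdist (x + (R/8) *\<^sub>R v) A = R/8"
    using down[of "R/8" \<tau>] \<tau>(3) R by simp
  have "prox_normal A (R/8) x v"
    unfolding prox_normal_def
  proof (intro conjI ballI v)
    fix y assume "y \<in> A"
    then have "R/8 \<le> dist (x + (R/8) *\<^sub>R v) y" using far infdist_le by metis
    then show "2 * (R/8) * ((y - x) \<bullet> v) \<le> (norm (y - x))\<^sup>2"
      using prox_normal_iff_dist[OF v, of "R/8"] R by simp
  qed
  then show ?thesis using x(1) d zeq unfolding foot_def d_def by blast
qed

section \<open>Proximal normals and tangent directions\<close>

text \<open>The unit sphere is compact and \<rho> does not vary, so a subsequence of directions
  converges and the inequality passes to the limit. The closed set \<open>K\<close> carries side
  conditions on the direction along.\<close>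

lemma prox_normal_limit:
  fixes A :: "'a::euclidean_space set"
  assumes "closed K" "\<And>\<epsilon>. \<epsilon> > 0 \<Longrightarrow> \<exists>x v. dist x x0 < \<epsilon> \<and> v \<in> K \<and> prox_normal A \<rho> x v"
  shows "\<exists>v\<in>K. prox_normal A \<rho> x0 v"
proof -
  have "\<exists>x v. dist x x0 < inverse (real (Suc n)) \<and> v \<in> K \<and> prox_normal A \<rho> x v" for n
    using assms(2)[of "inverse (real (Suc n))"] by simp
  then obtain X V where XV: "\<And>n. dist (X n) x0 < inverse (real (Suc n))" "\<And>n. V n \<in> K"
      "\<And>n. prox_normal A \<rho> (X n) (V n)"
    by metis
  have "(\<lambda>n. dist (X n) x0) \<longlonglongrightarrow> 0"
    by (rule tendsto_sandwich[OF _ _ tendsto_const LIMSEQ_inverse_real_of_nat])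
      (use XV(1) in \<open>auto simp del: of_nat_Suc intro!: always_eventually less_imp_le\<close>)
  then have "X \<longlonglongrightarrow> x0" using tendsto_dist_iff by blast
  have "compact (K \<inter> sphere 0 1)" using assms(1) by (simp add: closed_Int_compact)
  moreover have "V n \<in> K \<inter> sphere 0 1" for n
    using XV(2,3) by (simp add: prox_normal_def)
  ultimately obtain v r where v: "v \<in> K \<inter> sphere 0 1" "strict_mono (r::nat\<Rightarrow>nat)" "(V \<circ> r) \<longlonglongrightarrow> v"
    by (meson compact_imp_seq_compact seq_compactE)
  have "(X \<circ> r) \<longlonglongrightarrow> x0" using \<open>X \<longlonglongrightarrow> x0\<close> v(2) LIMSEQ_subseq_LIMSEQ by blast
  have "2 * \<rho> * ((y - x0) \<bullet> v) \<le> (norm (y - x0))\<^sup>2" if "y \<in> A" for y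
  proof (rule tendsto_le[OF sequentially_bot])
    show "(\<lambda>n. (norm (y - (X \<circ> r) n))\<^sup>2) \<longlonglongrightarrow> (norm (y - x0))\<^sup>2"
      by (intro tendsto_intros \<open>(X \<circ> r) \<longlonglongrightarrow> x0\<close>)
    show "(\<lambda>n. 2 * \<rho> * ((y - (X \<circ> r) n) \<bullet> (V \<circ> r) n)) \<longlonglongrightarrow> 2 * \<rho> * ((y - x0) \<bullet> v)"
      by (intro tendsto_intros \<open>(X \<circ> r) \<longlonglongrightarrow> x0\<close> v(3))
    show "\<forall>\<^sub>F n in sequentially. 2 * \<rho> * ((y - (X \<circ> r) n) \<bullet> (V \<circ> r) n) \<le> (norm (y - (X \<circ> r) n))\<^sup>2"
      using XV(3) that by (simp add: prox_normal_def)
  qed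
  then show ?thesis using v(1) by (auto simp: prox_normal_def)
qed

text \<open>The unit vectors of the Bouligand tangent cone at 0. One \<epsilon> bounds both the size
  of \<open>y\<close> and its angular error, and the latter is stated without dividing by
  \<open>norm y\<close>.\<close>

definition tangent_dirs :: "'a::euclidean_space set \<Rightarrow> 'a set" where
  "tangent_dirs A = {u. norm u = 1 \<and>
     (\<forall>\<epsilon>>0. \<exists>y\<in>A. y \<noteq> 0 \<and> norm y < \<epsilon> \<and> norm (y - norm y *\<^sub>R u) \<le> \<epsilon> * norm y)}"

text \<open>Compactness of the sphere. The subsequence is handed out because
  \<open>tangent_near\<close> has to refine it further.\<close>

lemma tangent_dirs_accumulate:
  fixes A :: "'a::euclidean_space set"
  assumes "\<And>n::nat. Y n \<in> A" "\<And>n. Y n \<noteq> 0" "Y \<longlonglongrightarrow> 0"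
  obtains u r where "u \<in> tangent_dirs A" "strict_mono (r::nat\<Rightarrow>nat)"
    "(\<lambda>n. Y (r n) /\<^sub>R norm (Y (r n))) \<longlonglongrightarrow> u"
proof -
  have "Y n /\<^sub>R norm (Y n) \<in> sphere 0 1" for n using assms(2) by simp
  then obtain u r where u: "u \<in> sphere 0 1" "strict_mono (r::nat\<Rightarrow>nat)"
      "((\<lambda>n. Y n /\<^sub>R norm (Y n)) \<circ> r) \<longlonglongrightarrow> u"
    using seq_compactE[OF compact_imp_seq_compact[OF compact_sphere[of 0 1]],
        of "\<lambda>n. Y n /\<^sub>R norm (Y n)"] by metis
  have lim: "(\<lambda>n. Y (r n) /\<^sub>R norm (Y (r n))) \<longlonglongrightarrow> u" using u(3) by (simp add: o_def)
  have Y0: "(\<lambda>n. Y (r n)) \<longlonglongrightarrow> 0" using LIMSEQ_subseq_LIMSEQ[OF assms(3) u(2)] by (simp add: o_def)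
  have "\<exists>y\<in>A. y \<noteq> 0 \<and> norm y < \<epsilon> \<and> norm (y - norm y *\<^sub>R u) \<le> \<epsilon> * norm y" if "\<epsilon> > 0" for \<epsilon>
  proof -
    have "\<forall>\<^sub>F n in sequentially. dist (Y (r n) /\<^sub>R norm (Y (r n))) u < \<epsilon> \<and> dist (Y (r n)) 0 < \<epsilon>"
      using tendstoD[OF lim that] tendstoD[OF Y0 that] by (rule eventually_conj)
    then obtain n where n: "dist (Y (r n) /\<^sub>R norm (Y (r n))) u < \<epsilon>" "dist (Y (r n)) 0 < \<epsilon>"
      using eventually_happens'[OF sequentially_bot] by blast
    let ?y = "Y (r n)"
    have "?y - norm ?y *\<^sub>R u = norm ?y *\<^sub>R (?y /\<^sub>R norm ?y - u)"
      using assms(2)[of "r n"] by (simp add: scaleR_diff_right)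
    then have "norm (?y - norm ?y *\<^sub>R u) = norm ?y * dist (?y /\<^sub>R norm ?y) u"
      by (simp add: dist_norm)
    also have "\<dots> \<le> norm ?y * \<epsilon>" using n(1) by (intro mult_left_mono) auto
    finally have "norm (?y - norm ?y *\<^sub>R u) \<le> \<epsilon> * norm ?y" by (simp only: mult.commute)
    moreover have "norm ?y < \<epsilon>" using n(2) by simp
    ultimately show ?thesis using assms(1,2) by blast
  qed
  then have "u \<in> tangent_dirs A" using u(1) by (simp add: tangent_dirs_def)
  then show thesis using that u(2) lim by blast
qed

lemma tangent_dirs_nonempty:
  fixes A :: "'a::euclidean_space set"
  assumes "0 \<in> A" "\<not> 0 isolated_in A"
  shows "tangent_dirs A \<noteq> {}"
proof -
  have "0 islimpt A" using assms by (simp add: isolated_in_islimpt_iff)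
  then obtain Y where "\<And>n::nat. Y n \<in> A - {0}" "Y \<longlonglongrightarrow> 0"
    unfolding islimpt_sequential by auto
  then show ?thesis using tangent_dirs_accumulate[of Y A] by blast
qed

text \<open>One point \<open>y\<close> of \<open>A\<close> close to the direction \<open>u\<close>
  is fixed first and then tested in the proximal inequality of every \<open>x\<close> much nearer to
  0 than \<open>y\<close>. The right side is of order \<open>norm y\<close> squared, so dividing by
  \<open>norm y\<close> leaves a small bound, uniform in \<open>x\<close> and
  \<open>v\<close>.\<close>

lemma tangent_normal_bound:
  fixes A :: "'a::euclidean_space set"
  assumes "u \<in> tangent_dirs A" "\<rho> > 0" "\<epsilon> > 0"
  obtains s where "s > 0" "\<And>x v. norm x < s \<Longrightarrow> prox_normal A \<rho> x v \<Longrightarrow> v \<bullet> u \<le> \<epsilon>"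
proof -
  \<comment> \<open>Three errors add up to \<open>2 * \<eta> + 2 * \<eta> / \<rho>\<close>: the
    proximal inequality costs \<open>2 * \<eta> / \<rho>\<close>, the offset \<open>x\<close> and
    the deviation of \<open>y\<close> from \<open>u\<close> cost \<eta> each.\<close>
  define \<eta> where "\<eta> = min 1 (\<epsilon> / (2 + 2 / \<rho>))"
  have pos: "2 + 2 / \<rho> > 0" using assms(2) by (simp add: add_pos_pos)
  have \<eta>: "\<eta> > 0" "\<eta> \<le> 1" using assms pos by (auto simp: \<eta>_def)
  have "\<eta> \<le> \<epsilon> / (2 + 2 / \<rho>)" by (simp add: \<eta>_def)
  then have \<eta>\<epsilon>: "2 * \<eta> + 2 * \<eta> / \<rho> \<le> \<epsilon>"
    using pos by (simp add: le_divide_eq algebra_simps)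
  obtain y where y: "y \<in> A" "y \<noteq> 0" "norm y < \<eta>" "norm (y - norm y *\<^sub>R u) \<le> \<eta> * norm y"
    using assms(1) \<eta>(1) unfolding tangent_dirs_def by blast
  show thesis
  proof (rule that[of "\<eta> * norm y"])
    show "\<eta> * norm y > 0" using \<eta> y by simp
    fix x v assume x: "norm x < \<eta> * norm y" and v: "prox_normal A \<rho> x v"
    have nv: "norm v = 1" using v by (simp add: prox_normal_def)
    have "\<eta> * norm y \<le> 1 * norm y" using \<eta> by (intro mult_right_mono) auto
    then have "norm (y - x) \<le> 2 * norm y"
      using x norm_triangle_ineq4[of y x] by linarith
    then have "(norm (y - x))\<^sup>2 \<le> (2 * norm y)\<^sup>2" by (intro power_mono) auto
    then have "2 * \<rho> * ((y - x) \<bullet> v) \<le> 4 * (norm y)\<^sup>2"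
      using v y(1) unfolding prox_normal_def power_mult_distrib by fastforce
    then have "(y - x) \<bullet> v \<le> 2 * (norm y)\<^sup>2 / \<rho>"
      using assms(2) by (simp add: field_simps)
    also have "\<dots> \<le> 2 * (\<eta> * norm y) / \<rho>"
      using y assms(2) by (intro divide_right_mono mult_left_mono) (auto simp: power2_eq_square)
    finally have 1: "(y - x) \<bullet> v \<le> 2 * \<eta> / \<rho> * norm y" by simp
    have 2: "x \<bullet> v \<le> \<eta> * norm y"
      using norm_cauchy_schwarz[of x v] nv x by simp
    have 3: "(norm y *\<^sub>R u - y) \<bullet> v \<le> \<eta> * norm y"
      using norm_cauchy_schwarz[of "norm y *\<^sub>R u - y" v] nv y(4) by (simp add: norm_minus_commute)
    have "norm y * (v \<bullet> u) = (norm y *\<^sub>R u - y) \<bullet> v + (y - x) \<bullet> v + x \<bullet> v"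
      by (simp add: inner_diff_left inner_commute[of v u])
    also have "\<dots> \<le> norm y * (2 * \<eta> + 2 * \<eta> / \<rho>)"
      using 1 2 3 by (simp add: algebra_simps)
    also have "\<dots> \<le> norm y * \<epsilon>" using \<eta>\<epsilon> by (intro mult_left_mono) auto
    finally show "v \<bullet> u \<le> \<epsilon>" using y(2) by simp
  qed
qed

text \<open>All that the geometric part uses of unique nearest points, with the base point moved to
  0. The same \<rho> is the size of the neighbourhood and the radius of the touching balls.\<close>

locale prox_regular =
  fixes A :: "'a::euclidean_space set" and \<rho> :: real
  assumes zero_mem: "0 \<in> A" and rho_pos: "\<rho> > 0"
    and foot_exists: "\<And>z. norm z < \<rho> \<Longrightarrow> z \<notin> A \<Longrightarrow> \<exists>x v. foot A \<rho> z x v"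
begin

lemma foot_dist:
  assumes "foot A \<rho> z x v"
  shows "dist z x = infdist z A"
proof -
  have "z - x = infdist z A *\<^sub>R v" "norm v = 1" "infdist z A > 0"
    using assms by (auto simp: foot_def prox_normal_def algebra_simps)
  then show ?thesis by (simp add: dist_norm)
qed

lemma foot_norm:
  assumes "foot A \<rho> z x v"
  shows "norm x \<le> 2 * norm z"
proof -
  have "norm x \<le> norm z + dist z x" by (metis dist_0_norm dist_triangle)
  then show ?thesis using foot_dist[OF assms] infdist_le_norm[OF zero_mem, of z] by simp
qed

lemma mem_iff_infdist_zero:
  assumes "norm z < \<rho>"
  shows "z \<in> A \<longleftrightarrow> infdist z A = 0"
  using foot_exists[OF assms] by (fastforce simp: foot_def)

lemma mem_limit:
  assumes "norm z < \<rho>" "\<And>n::nat. X n \<in> A" "X \<longlonglongrightarrow> z"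
  shows "z \<in> A"
proof -
  have "z \<in> closure A" using assms(2,3) closure_sequential by blast
  then have "infdist z A = 0" using in_closure_iff_infdist_zero zero_mem by blast
  then show ?thesis using mem_iff_infdist_zero[OF assms(1)] by simp
qed

text \<open>A foot is at least as close to \<open>z\<close> as \<open>x0\<close> is, so feet of
  points tending to \<open>x0\<close> also tend to \<open>x0\<close>; only the outside points have
  to be exhibited.\<close>

lemma prox_normal_limit_feet:
  assumes "closed K" "x0 \<in> A"
    and "\<And>\<epsilon>. \<epsilon> > 0 \<Longrightarrow> \<exists>z x v. dist z x0 < \<epsilon> \<and> foot A \<rho> z x v \<and> v \<in> K"
  shows "\<exists>v\<in>K. prox_normal A \<rho> x0 v"
proof (rule prox_normal_limit[OF assms(1)])
  fix \<epsilon> :: real assume "\<epsilon> > 0"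
  then obtain z x v where z: "dist z x0 < \<epsilon>/2" "foot A \<rho> z x v" "v \<in> K"
    using assms(3)[of "\<epsilon>/2"] by auto
  have "dist x x0 \<le> dist z x + dist z x0" by (simp add: dist_triangle3)
  also have "\<dots> \<le> 2 * dist z x0"
    using foot_dist[OF z(2)] infdist_le[OF assms(2), of z] by simp
  finally have "dist x x0 < \<epsilon>" using z(1) by simp
  then show "\<exists>x v. dist x x0 < \<epsilon> \<and> v \<in> K \<and> prox_normal A \<rho> x v"
    using z by (auto simp: foot_def)
qed

text \<open>At the foot \<open>q\<close> of \<open>t *\<^sub>R y\<close>, the proximal inequalities
  tested at \<open>y\<close> and at 0 are averaged with weights \<open>t\<close> and
  \<open>1 - t\<close>. The average of the test points is \<open>t *\<^sub>R y\<close> itself, so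
  the left side becomes \<open>2 * \<rho> * d\<close>.\<close>

lemma segment_near:
  assumes "y \<in> A" "0 \<le> t" "t \<le> 1" "norm (t *\<^sub>R y) < \<rho>"
  shows "\<exists>q\<in>A. norm (t *\<^sub>R y - q) \<le> t * (norm y)\<^sup>2 / \<rho>"
proof (cases "t *\<^sub>R y \<in> A")
  case True
  then show ?thesis using assms rho_pos by (intro bexI[of _ "t *\<^sub>R y"]) auto
next
  case False
  define p where "p = t *\<^sub>R y"
  obtain q v where f: "foot A \<rho> p q v" using foot_exists assms(4) False unfolding p_def by blast
  define d where "d = infdist p A"
  have d: "d > 0" "d < \<rho>" "p - q = d *\<^sub>R v" "q \<in> A" "norm v = 1"
    using f infdist_le_norm[OF zero_mem, of p] assms(4)
    by (auto simp: foot_def d_def prox_normal_def algebra_simps p_def)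
  have n1: "2 * \<rho> * ((y - q) \<bullet> v) \<le> (norm (y - q))\<^sup>2"
    and n0: "2 * \<rho> * ((0 - q) \<bullet> v) \<le> (norm (0 - q))\<^sup>2"
    using f assms(1) zero_mem unfolding foot_def prox_normal_def by blast+
  have vv: "v \<bullet> v = 1" using d(5) by (simp flip: power2_norm_eq_inner)
  have pq: "q = p - d *\<^sub>R v" using d(3) by (simp add: algebra_simps)
  have "t * (2 * \<rho> * ((y - q) \<bullet> v)) + (1 - t) * (2 * \<rho> * ((0 - q) \<bullet> v))
      \<le> t * (norm (y - q))\<^sup>2 + (1 - t) * (norm (0 - q))\<^sup>2"
    using n1 n0 assms by (intro add_mono mult_left_mono) auto
  also have "t * (2 * \<rho> * ((y - q) \<bullet> v)) + (1 - t) * (2 * \<rho> * ((0 - q) \<bullet> v)) = 2 * \<rho> * d"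
    by (simp add: pq p_def inner_diff vv algebra_simps)
  also have "t * (norm (y - q))\<^sup>2 + (1 - t) * (norm (0 - q))\<^sup>2 = d\<^sup>2 + t * (1 - t) * (norm y)\<^sup>2"
    unfolding power2_norm_eq_inner
    by (simp add: pq p_def inner_diff inner_commute vv power2_eq_square algebra_simps)
  finally have 1: "2 * \<rho> * d \<le> d\<^sup>2 + t * (1 - t) * (norm y)\<^sup>2" .
  \<comment> \<open>As \<open>d\<close> < \<rho>, the square is absorbed by half of the left
    side.\<close>
  have "d\<^sup>2 \<le> \<rho> * d" using d by (simp add: power2_eq_square)
  moreover have "t * (1 - t) * (norm y)\<^sup>2 \<le> t * (norm y)\<^sup>2"
    using assms by (intro mult_right_mono) (auto simp: mult_left_le)
  ultimately have "\<rho> * d \<le> t * (norm y)\<^sup>2" using 1 by linarith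
  then have "d \<le> t * (norm y)\<^sup>2 / \<rho>" using rho_pos by (simp add: field_simps)
  moreover have "norm (t *\<^sub>R y - q) = d" using d by (simp add: p_def)
  ultimately show ?thesis using d(4) by auto
qed

text \<open>\<open>segment_near\<close> at times \<open>T n\<close> tending to 0, rescaled by
  \<open>1 / T n\<close>, gives points \<open>w n\<close> within the claimed distance of
  \<open>y\<close>. Their directions are those of points \<open>q n\<close> of \<open>A\<close>
  tending to 0, hence accumulate at a tangent direction.\<close>

lemma tangent_near:
  assumes "y \<in> A" "y \<noteq> 0" "norm y < \<rho>"
  obtains u c where "u \<in> tangent_dirs A" "c \<ge> 0" "norm (y - c *\<^sub>R u) \<le> (norm y)\<^sup>2 / \<rho>"
proof -
  define T where "T n = inverse (real (Suc n))" for n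
  have T: "T n > 0" "T n \<le> 1" for n by (auto simp: T_def inverse_le_1_iff simp del: of_nat_Suc)
  have "\<exists>q\<in>A. norm (T n *\<^sub>R y - q) \<le> T n * (norm y)\<^sup>2 / \<rho>" for n
  proof (rule segment_near[OF assms(1)])
    have "T n * norm y \<le> 1 * norm y" using T[of n] by (intro mult_right_mono) auto
    then show "norm (T n *\<^sub>R y) < \<rho>" using T(1)[of n] assms(3) by simp
  qed (use T[of n] in auto)
  then obtain q where q: "\<And>n. q n \<in> A" "\<And>n. norm (T n *\<^sub>R y - q n) \<le> T n * (norm y)\<^sup>2 / \<rho>"
    by metis
  define w where "w n = q n /\<^sub>R T n" for n
  have w: "norm (y - w n) \<le> (norm y)\<^sup>2 / \<rho>" for n
  proof -
    have "T n *\<^sub>R y - q n = T n *\<^sub>R (y - w n)"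
      using T(1)[of n] by (simp add: w_def scaleR_diff_right)
    then have "T n * norm (y - w n) \<le> T n * ((norm y)\<^sup>2 / \<rho>)" using q(2)[of n] T(1)[of n] by simp
    then show ?thesis using T(1)[of n] by (rule mult_left_le_imp_le)
  qed
  \<comment> \<open>Strictness keeps \<open>w n\<close>, and with it \<open>q n\<close>, away from
    0, so that the directions are defined.\<close>
  have lt: "(norm y)\<^sup>2 / \<rho> < norm y"
    using assms rho_pos by (simp add: divide_less_eq power2_eq_square)
  have qw: "q n = T n *\<^sub>R w n" for n using T(1)[of n] by (simp add: w_def)
  have wn: "norm (w n) \<in> {0..2 * norm y}" for n
    using w[of n] lt norm_triangle_ineq2[of "w n" y] by (simp add: norm_minus_commute)
  have q0: "q n \<noteq> 0" for n
    using w[of n] lt T(1)[of n] by (auto simp: qw)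
  have T0: "T \<longlonglongrightarrow> 0" unfolding T_def by (rule LIMSEQ_inverse_real_of_nat)
  have "q \<longlonglongrightarrow> 0"
  proof (rule Lim_null_comparison)
    show "(\<lambda>n. T n * (2 * norm y)) \<longlonglongrightarrow> 0" using tendsto_mult_left_zero[OF T0] by blast
    have "norm (q n) \<le> T n * (2 * norm y)" for n
    proof -
      have "norm (q n) = T n * norm (w n)" using T(1)[of n] by (simp add: qw)
      then show ?thesis using wn[of n] T(1)[of n] by simp
    qed
    then show "\<forall>\<^sub>F n in sequentially. norm (q n) \<le> T n * (2 * norm y)" by simp
  qed
  then obtain u r where ur: "u \<in> tangent_dirs A" "strict_mono (r::nat\<Rightarrow>nat)"
      "(\<lambda>n. q (r n) /\<^sub>R norm (q (r n))) \<longlonglongrightarrow> u"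
    using tangent_dirs_accumulate[of q A] q(1) q0 by blast
  \<comment> \<open>The lengths need a second subsequence: direction and length together make
    \<open>w n\<close> converge.\<close>
  obtain c r' where c: "c \<in> {0..2 * norm y}" "strict_mono (r'::nat\<Rightarrow>nat)"
      "((\<lambda>n. norm (w (r n))) \<circ> r') \<longlonglongrightarrow> c"
    using seq_compactE[OF compact_imp_seq_compact[OF compact_Icc[of 0 "2 * norm y"]], of "\<lambda>n. norm (w (r n))"]
      wn by metis
  have "(\<lambda>n. norm (w (r (r' n)))) \<longlonglongrightarrow> c" using c(3) by (simp add: o_def)
  moreover have "(\<lambda>n. q (r (r' n)) /\<^sub>R norm (q (r (r' n)))) \<longlonglongrightarrow> u"
    using LIMSEQ_subseq_LIMSEQ[OF ur(3) c(2)] by (simp add: o_def)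
  ultimately have "(\<lambda>n. norm (w (r (r' n))) *\<^sub>R (q (r (r' n)) /\<^sub>R norm (q (r (r' n))))) \<longlonglongrightarrow> c *\<^sub>R u"
    by (rule tendsto_scaleR)
  moreover have "norm (w n) *\<^sub>R (q n /\<^sub>R norm (q n)) = w n" for n
  proof -
    have "w n \<noteq> 0" using q0[of n] by (auto simp: qw)
    then have "norm (w n) * (inverse (T n) * inverse (norm (w n)) * T n) = 1"
      using T(1)[of n] by (simp add: field_simps)
    then show ?thesis using T(1)[of n] by (simp add: qw)
  qed
  ultimately have "(\<lambda>n. w (r (r' n))) \<longlonglongrightarrow> c *\<^sub>R u" by simp
  then have "(\<lambda>n. norm (y - w (r (r' n)))) \<longlonglongrightarrow> norm (y - c *\<^sub>R u)" by (intro tendsto_intros)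
  then have "norm (y - c *\<^sub>R u) \<le> (norm y)\<^sup>2 / \<rho>"
    by (rule LIMSEQ_le_const2) (use w in auto)
  then show thesis using that ur(1) c(1) by auto
qed

section \<open>A maximum principle for the distance to \<open>A\<close>\<close>

text \<open>The centre \<open>x + \<rho> *\<^sub>R v\<close> of the touching ball is at distance at
  least \<rho> from \<open>A\<close>, and \<open>z\<close> lies \<open>\<rho> - d\<close> away from
  it. A short move along \<open>e\<close> brings \<open>z\<close> closer to the centre, and the
  triangle inequality turns this into a larger distance to \<open>A\<close>.\<close>

lemma infdist_increase:
  assumes "foot A \<rho> z x v" "norm z < \<rho>" "v \<bullet> e > 0"
  obtains h0 where "h0 > 0" "\<And>h. 0 < h \<Longrightarrow> h < h0 \<Longrightarrow> infdist (z + h *\<^sub>R e) A > infdist z A"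
proof -
  define d where "d = infdist z A"
  have d: "d > 0" "d < \<rho>" "z = x + d *\<^sub>R v" "x \<in> A" "norm v = 1"
    using assms(1,2) infdist_le_norm[OF zero_mem, of z]
    by (auto simp: foot_def d_def prox_normal_def)
  have vv: "v \<bullet> v = 1" using d(5) by (simp flip: power2_norm_eq_inner)
  have "e \<noteq> 0" using assms(3) by auto
  then have ee: "e \<bullet> e > 0" by simp
  \<comment> \<open>Expanding the squared distance to the centre, the linear gain beats the
    quadratic term even up to \<open>2 * h0\<close>.\<close>
  define h0 where "h0 = (\<rho> - d) * (v \<bullet> e) / (e \<bullet> e)"
  have h0: "h0 > 0" using d assms(3) ee by (simp add: h0_def)
  show thesis
  proof (rule that[OF h0])
    fix h assume h: "0 < h" "h < h0"
    have hh: "h * (e \<bullet> e) < (\<rho> - d) * (v \<bullet> e)" using h(2) ee by (simp add: h0_def field_simps)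
    let ?c = "x + \<rho> *\<^sub>R v"
    have "(dist ?c (z + h *\<^sub>R e))\<^sup>2 = (\<rho> - d)\<^sup>2 - h * (2 * ((\<rho> - d) * (v \<bullet> e)) - h * (e \<bullet> e))"
      unfolding dist_norm power2_norm_eq_inner d(3)
      by (simp add: inner_diff inner_add inner_commute vv power2_eq_square algebra_simps)
    also have "\<dots> < (\<rho> - d)\<^sup>2"
    proof -
      have "(\<rho> - d) * (v \<bullet> e) > 0" using d assms(3) by simp
      then have "2 * ((\<rho> - d) * (v \<bullet> e)) - h * (e \<bullet> e) > 0" using hh by linarith
      then show ?thesis using h by simp
    qed
    finally have lt: "dist ?c (z + h *\<^sub>R e) < \<rho> - d"
      using d power_less_imp_less_base by (metis diff_ge_0_iff_ge less_imp_le)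
    have "\<rho> \<le> infdist ?c A"
    proof (rule infdist_geI)
      fix y assume "y \<in> A"
      then show "\<rho> \<le> dist ?c y"
        using prox_normal_iff_dist[OF d(5), of \<rho> y x] assms(1) rho_pos
        by (auto simp: foot_def prox_normal_def)
    qed (use zero_mem in auto)
    then show "infdist z A < infdist (z + h *\<^sub>R e) A"
      using lt infdist_triangle[of ?c A "z + h *\<^sub>R e"] by (simp add: d_def)
  qed
qed

text \<open>At a maximum with positive distance, \<open>infdist_increase\<close> along
  \<open>e\<close> or \<open>- e\<close> would raise the distance further; the two end conditions
  exclude that this move leaves the segment. So the maximum is 0.\<close>

lemma infdist_max_on_segment:
  assumes ball: "\<And>t. t \<in> {\<alpha>..\<beta>} \<Longrightarrow> norm (p + t *\<^sub>R e) < \<rho>" and "\<alpha> \<le> \<beta>"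
    and ne: "\<And>t x v. t \<in> {\<alpha>..\<beta>} \<Longrightarrow> foot A \<rho> (p + t *\<^sub>R e) x v \<Longrightarrow> v \<bullet> e \<noteq> 0"
    and A: "\<And>x v. foot A \<rho> (p + \<alpha> *\<^sub>R e) x v \<Longrightarrow> v \<bullet> e > 0"
    and B: "\<And>x v. foot A \<rho> (p + \<beta> *\<^sub>R e) x v \<Longrightarrow> v \<bullet> e < 0"
    and t: "t \<in> {\<alpha>..\<beta>}"
  shows "p + t *\<^sub>R e \<in> A"
proof -
  have "continuous_on {\<alpha>..\<beta>} (\<lambda>t. infdist (p + t *\<^sub>R e) A)" by (intro continuous_intros)
  from this t obtain m where m: "m \<in> {\<alpha>..\<beta>}"
      "\<And>t. t \<in> {\<alpha>..\<beta>} \<Longrightarrow> infdist (p + t *\<^sub>R e) A \<le> infdist (p + m *\<^sub>R e) A"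
    using continuous_attains_sup[OF compact_Icc] by blast
  have "p + m *\<^sub>R e \<in> A"
  proof (rule ccontr)
    assume "p + m *\<^sub>R e \<notin> A"
    then obtain x v where f: "foot A \<rho> (p + m *\<^sub>R e) x v" using foot_exists ball m(1) by blast
    consider "v \<bullet> e > 0" | "v \<bullet> e < 0" using ne[OF m(1) f] by linarith
    then show False
    proof cases
      case 1
      obtain h0 where h0: "h0 > 0" "\<And>h. 0 < h \<Longrightarrow> h < h0 \<Longrightarrow>
          infdist (p + m *\<^sub>R e + h *\<^sub>R e) A > infdist (p + m *\<^sub>R e) A"
        using infdist_increase[OF f ball[OF m(1)] 1] by blast
      have "m < \<beta>" using B[of x v] f 1 m(1) by (cases "m = \<beta>") auto
      define h where "h = min (h0/2) (\<beta> - m)"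
      have h: "0 < h" "h < h0" "m + h \<in> {\<alpha>..\<beta>}" using h0(1) \<open>m < \<beta>\<close> m(1) by (auto simp: h_def min_def)
      then show False using h0(2)[OF h(1,2)] m(2)[OF h(3)] by (simp add: scaleR_add_left add.assoc)
    next
      case 2
      then have 2: "v \<bullet> (- e) > 0" by simp
      obtain h0 where h0: "h0 > 0" "\<And>h. 0 < h \<Longrightarrow> h < h0 \<Longrightarrow>
          infdist (p + m *\<^sub>R e + h *\<^sub>R (- e)) A > infdist (p + m *\<^sub>R e) A"
        using infdist_increase[OF f ball[OF m(1)] 2] by blast
      have "\<alpha> < m" using A[of x v] f 2 m(1) by (cases "m = \<alpha>") auto
      define h where "h = min (h0/2) (m - \<alpha>)"
      have h: "0 < h" "h < h0" "m - h \<in> {\<alpha>..\<beta>}" using h0(1) \<open>\<alpha> < m\<close> m(1) by (auto simp: h_def min_def)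
      have "p + m *\<^sub>R e + h *\<^sub>R (- e) = p + (m - h) *\<^sub>R e" by (simp add: scaleR_diff_left)
      then show False using h0(2)[OF h(1,2)] m(2)[OF h(3)] by (metis not_less)
    qed
  qed
  then have "infdist (p + t *\<^sub>R e) A = 0"
    using m(2)[OF t] infdist_nonneg[of "p + t *\<^sub>R e" A] by simp
  then show ?thesis using mem_iff_infdist_zero ball[OF t] by blast
qed

end

section \<open>Graphs with proximal normals of uniform radius; the type 1 case\<close>

text \<open>An affine majorant touching at each point is exactly what a proximal normal provides
  once a parabola has been subtracted.\<close>

lemma concave_on_support:
  fixes u :: "real \<Rightarrow> real"
  assumes "convex I" "\<And>s. s \<in> I \<Longrightarrow> \<exists>m. \<forall>s'\<in>I. u s' \<le> u s + m * (s' - s)"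
  shows "concave_on I u"
  unfolding concave_on_iff
proof (intro conjI ballI allI impI assms(1))
  fix x y a b :: real assume xy: "x \<in> I" "y \<in> I" "0 \<le> a" "0 \<le> b" "a + b = 1"
  let ?s = "a *\<^sub>R x + b *\<^sub>R y"
  have "?s \<in> I" using xy assms(1) by (auto simp: convex_def)
  then obtain m where m: "\<forall>s'\<in>I. u s' \<le> u ?s + m * (s' - ?s)" using assms(2) by blast
  have "a * u x + b * u y \<le> a * (u ?s + m * (x - ?s)) + b * (u ?s + m * (y - ?s))"
    using m xy by (intro add_mono mult_left_mono) auto
  also have "\<dots> = (a + b) * u ?s + m * ((a * x + b * y) - (a + b) * ?s)"
    by (simp only: algebra_simps)
  also have "\<dots> = u ?s" using xy(5) by simp
  finally show "u ?s \<ge> a * u x + b * u y" .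
qed

lemma norm_Pair_bounds:
  fixes a b :: real
  shows "\<bar>a\<bar> \<le> norm (a, b)" "\<bar>b\<bar> \<le> norm (a, b)" "norm (a, b) \<le> \<bar>a\<bar> + \<bar>b\<bar>"
  using norm_fst_le[of a b] norm_snd_le[of b a] norm_Pair_le[of a b] by auto

locale prox_regular_plane = prox_regular A \<rho> for A :: "(real \<times> real) set" and \<rho>
begin

text \<open>The proximal inequality at one point of the graph is tested at another. The vertical
  component of the normal, at least \<delta>, controls the increment of \<open>g\<close>; the size
  bounds absorb the squares on the right, which gives a Lipschitz constant, and that constant in
  turn makes the right side quadratic in \<open>s' - s\<close>. The sign \<sigma> lets lower
  boundaries be treated through their negatives.\<close>

lemma graph_regular:
  assumes \<sigma>: "\<sigma> = 1 \<or> \<sigma> = -1" and "\<delta> > 0" "convex I"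
    and I: "\<And>s. s \<in> I \<Longrightarrow> (s, \<sigma> * g s) \<in> A" "\<And>s. s \<in> I \<Longrightarrow> \<bar>s\<bar> \<le> \<rho> / 2"
      "\<And>s. s \<in> I \<Longrightarrow> \<bar>g s\<bar> \<le> \<rho> * \<delta> / 2"
    and nrm: "\<And>s. s \<in> I \<Longrightarrow> \<exists>v. prox_normal A \<rho> (s, \<sigma> * g s) v \<and> \<sigma> * snd v \<ge> \<delta>"
  shows "\<exists>L. L-lipschitz_on I g" "semiconcave_on I g"
proof -
  have key: "\<exists>a w. \<bar>a\<bar> \<le> 1 \<and> w \<ge> \<delta> \<and>
      (\<forall>s'\<in>I. 2 * \<rho> * (a * (s' - s) + w * (g s' - g s)) \<le> (s' - s)\<^sup>2 + (g s' - g s)\<^sup>2)"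
    if s: "s \<in> I" for s
  proof -
    obtain v where v: "prox_normal A \<rho> (s, \<sigma> * g s) v" "\<sigma> * snd v \<ge> \<delta>" using nrm[OF s] by blast
    have "\<bar>fst v\<bar> \<le> norm v" using norm_Pair_bounds(1)[of "fst v" "snd v"] by simp
    then have "\<bar>fst v\<bar> \<le> 1" using v(1) by (simp add: prox_normal_def)
    moreover have "2 * \<rho> * (fst v * (s' - s) + \<sigma> * snd v * (g s' - g s)) \<le> (s' - s)\<^sup>2 + (g s' - g s)\<^sup>2"
      if "s' \<in> I" for s'
    proof -
      have "2 * \<rho> * (((s', \<sigma> * g s') - (s, \<sigma> * g s)) \<bullet> v) \<le> (norm ((s', \<sigma> * g s') - (s, \<sigma> * g s)))\<^sup>2"
        using v(1) I(1)[OF that] unfolding prox_normal_def by blast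
      moreover have "((s', \<sigma> * g s') - (s, \<sigma> * g s)) \<bullet> v = fst v * (s' - s) + \<sigma> * snd v * (g s' - g s)"
        by (cases v) (simp add: algebra_simps)
      moreover have "(norm ((s', \<sigma> * g s') - (s, \<sigma> * g s)))\<^sup>2 = (s' - s)\<^sup>2 + (g s' - g s)\<^sup>2"
      proof -
        have "\<sigma>\<^sup>2 = 1" using \<sigma> by auto
        then show ?thesis
          by (simp add: norm_Pair power_mult_distrib flip: right_diff_distrib)
      qed
      ultimately show ?thesis by simp
    qed
    ultimately show ?thesis using v(2) by blast
  qed
  \<comment> \<open>From \<open>2 * \<rho> * (\<delta> * k - h) \<le> \<rho> * h + \<rho> * \<delta>
    * k\<close>, where \<open>h\<close> and \<open>k\<close> are the horizontal and vertical
    increments.\<close>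
  define L where "L = 3 / \<delta>"
  have up: "g s' - g s \<le> L * \<bar>s' - s\<bar>" if ss: "s \<in> I" "s' \<in> I" for s s'
  proof (cases "g s' - g s > 0")
    case False
    then show ?thesis using \<open>\<delta> > 0\<close> by (smt (verit) L_def divide_nonneg_nonneg mult_nonneg_nonneg)
  next
    case True
    define h where "h = \<bar>s' - s\<bar>"
    define k where "k = g s' - g s"
    obtain a w where aw: "\<bar>a\<bar> \<le> 1" "w \<ge> \<delta>" "2 * \<rho> * (a * (s' - s) + w * k) \<le> h\<^sup>2 + k\<^sup>2"
      using key[OF ss(1)] ss(2) unfolding h_def k_def by fastforce
    have k: "0 < k" "k \<le> \<rho> * \<delta>" using True I(3)[OF ss(1)] I(3)[OF ss(2)] by (auto simp: k_def)
    have h: "0 \<le> h" "h \<le> \<rho>" using I(2)[OF ss(1)] I(2)[OF ss(2)] by (auto simp: h_def)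
    have "\<bar>a * (s' - s)\<bar> \<le> 1 * h" unfolding abs_mult h_def using aw(1) by (intro mult_right_mono) auto
    then have "- h \<le> a * (s' - s)" by linarith
    moreover have "\<delta> * k \<le> w * k" using aw(2) k(1) by (intro mult_right_mono) auto
    ultimately have "2 * \<rho> * (\<delta> * k - h) \<le> 2 * \<rho> * (a * (s' - s) + w * k)"
      using rho_pos by (intro mult_left_mono) auto
    then have "2 * \<rho> * (\<delta> * k - h) \<le> h\<^sup>2 + k\<^sup>2" using aw(3) by linarith
    moreover have "h\<^sup>2 \<le> \<rho> * h" "k\<^sup>2 \<le> \<rho> * \<delta> * k"
      unfolding power2_eq_square using h k by (auto intro: mult_right_mono)
    ultimately have "\<rho> * (\<delta> * k) \<le> \<rho> * (3 * h)" by (simp add: algebra_simps)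
    then have "\<delta> * k \<le> 3 * h" using rho_pos by simp
    then show ?thesis using \<open>\<delta> > 0\<close> by (simp add: L_def k_def h_def field_simps)
  qed
  have L0: "L \<ge> 0" using \<open>\<delta> > 0\<close> by (simp add: L_def)
  have lip: "\<bar>g s' - g s\<bar> \<le> L * \<bar>s' - s\<bar>" if "s \<in> I" "s' \<in> I" for s s'
    using up[OF that] up[OF that(2,1)] by (simp add: abs_minus_commute abs_le_iff)
  have lipschitz: "L-lipschitz_on I g"
    using lip L0 by (auto simp: lipschitz_on_def dist_real_def)
  then show "\<exists>L. L-lipschitz_on I g" by blast
  define C where "C = (1 + L\<^sup>2) / (2 * \<rho> * \<delta>)"
  have C0: "C \<ge> 0" using rho_pos \<open>\<delta> > 0\<close> by (simp add: C_def)
  have "concave_on I (\<lambda>x. g x - (2 * C) / 2 * \<bar>x\<bar>\<^sup>2)"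
  proof (rule concave_on_support[OF \<open>convex I\<close>])
    fix s assume s: "s \<in> I"
    obtain a w where aw: "w \<ge> \<delta>"
      "\<And>s'. s' \<in> I \<Longrightarrow> 2 * \<rho> * (a * (s' - s) + w * (g s' - g s)) \<le> (s' - s)\<^sup>2 + (g s' - g s)\<^sup>2"
      using key[OF s] by blast
    have w: "w > 0" using aw(1) \<open>\<delta> > 0\<close> by simp
    have "g s' - g s \<le> - a / w * (s' - s) + C * (s' - s)\<^sup>2" if s': "s' \<in> I" for s'
    proof -
      have "\<bar>g s' - g s\<bar>\<^sup>2 \<le> (L * \<bar>s' - s\<bar>)\<^sup>2" using lip[OF s s'] by (intro power_mono) auto
      then have "(s' - s)\<^sup>2 + (g s' - g s)\<^sup>2 \<le> (1 + L\<^sup>2) * (s' - s)\<^sup>2"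
        by (simp add: power_mult_distrib algebra_simps)
      then have "2 * \<rho> * (a * (s' - s) + w * (g s' - g s)) \<le> (1 + L\<^sup>2) * (s' - s)\<^sup>2"
        using aw(2)[OF s'] by linarith
      then have "a * (s' - s) + w * (g s' - g s) \<le> (1 + L\<^sup>2) * (s' - s)\<^sup>2 / (2 * \<rho>)"
        using rho_pos by (simp add: pos_le_divide_eq mult.commute)
      then have "w * (g s' - g s) \<le> - a * (s' - s) + (1 + L\<^sup>2) * (s' - s)\<^sup>2 / (2 * \<rho>)"
        by simp
      then have "g s' - g s \<le> (- a * (s' - s) + (1 + L\<^sup>2) * (s' - s)\<^sup>2 / (2 * \<rho>)) / w"
        using w by (simp add: pos_le_divide_eq mult.commute)
      also have "\<dots> = - a / w * (s' - s) + (1 + L\<^sup>2) / (2 * \<rho> * w) * (s' - s)\<^sup>2"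
        using w rho_pos by (simp add: field_simps)
      also have "(1 + L\<^sup>2) / (2 * \<rho> * w) \<le> C"
        unfolding C_def using aw(1) rho_pos \<open>\<delta> > 0\<close> w by (intro divide_left_mono) (auto intro: add_nonneg_nonneg)
      then have "(1 + L\<^sup>2) / (2 * \<rho> * w) * (s' - s)\<^sup>2 \<le> C * (s' - s)\<^sup>2"
        by (intro mult_right_mono) auto
      finally show ?thesis by simp
    qed
    then show "\<exists>m. \<forall>s'\<in>I. g s' - (2 * C) / 2 * \<bar>s'\<bar>\<^sup>2 \<le> g s - (2 * C) / 2 * \<bar>s\<bar>\<^sup>2 + m * (s' - s)"
      \<comment> \<open>Subtracting the parabola \<open>C * s\<^sup>2\<close> shifts the supporting
        slope by its derivative \<open>2 * C * s\<close>.\<close>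
      by (intro exI[of _ "- a / w - 2 * C * s"]) (force simp: power2_eq_square algebra_simps)
  qed
  then show "semiconcave_on I g"
    unfolding semiconcave_on_def using C0 lipschitz_on_continuous_on[OF lipschitz]
    by (intro conjI exI[of _ "2 * C"]) auto
qed

lemma mem_limit_Pair:
  assumes "norm (x, t) < \<rho>" "t \<in> closure S" "\<And>y. y \<in> S \<Longrightarrow> (x, y) \<in> A"
  shows "(x, t) \<in> A"
proof -
  obtain f where f: "\<And>n::nat. f n \<in> S" "f \<longlonglongrightarrow> t" using assms(2) closure_sequential by blast
  have "(\<lambda>n. (x, f n)) \<longlonglongrightarrow> (x, t)" by (intro tendsto_intros f(2))
  then show ?thesis using mem_limit[OF assms(1), of "\<lambda>n. (x, f n)"] f(1) assms(3) by blast
qed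

text \<open>All foot directions near 0 point upwards, so by the maximum principle \<open>A\<close>
  contains, locally, a downward cone below each of its points. Hence its vertical fibres are lower
  half-lines, and their suprema form the graph.\<close>

lemma T1_case:
  assumes "\<delta> > 0" "s > 0" and nrm: "\<And>x v. norm x < s \<Longrightarrow> prox_normal A \<rho> x v \<Longrightarrow> snd v \<ge> \<delta>"
    and "0 \<notin> interior A"
  shows "\<exists>r>0. T1_set r (A \<inter> ball 0 r)"
proof -
  \<comment> \<open>Half of \<open>s\<close> because feet are at most twice as far from 0; \<rho>
    for feet to exist; \<open>2 * \<rho> * \<delta>\<close> for the contradiction on the axis in
    \<open>above\<close>.\<close>
  define b where "b = min (s/2) (min \<rho> (2 * \<rho> * \<delta>))"
  have b: "b > 0" "b \<le> s/2" "b \<le> \<rho>" "b \<le> 2 * \<rho> * \<delta>"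
    using assms(1,2) rho_pos by (auto simp: b_def)
  have ft: "snd v \<ge> \<delta>" if "foot A \<rho> z x v" "norm z < b" for z x v
  proof -
    have "norm x < s" using foot_norm[OF that(1)] that(2) b(2) by linarith
    then show ?thesis using nrm that(1) by (auto simp: foot_def)
  qed
  \<comment> \<open>As 0 is not interior, outside points accumulate at 0, and their feet yield a
    normal at 0 itself.\<close>
  obtain v0 where v0: "prox_normal A \<rho> 0 v0" "snd v0 \<ge> \<delta>"
  proof -
    have "\<exists>v\<in>UNIV. prox_normal A \<rho> 0 v"
    proof (rule prox_normal_limit_feet)
      fix \<epsilon> :: real assume "\<epsilon> > 0"
      then have "\<not> ball 0 (min \<epsilon> \<rho>) \<subseteq> A"
        using assms(4) rho_pos unfolding mem_interior by (metis min_less_iff_conj)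
      then obtain z where "z \<in> ball 0 (min \<epsilon> \<rho>)" "z \<notin> A" by blast
      then have "norm z < \<epsilon>" "norm z < \<rho>" "z \<notin> A" by auto
      then show "\<exists>z x v. dist z 0 < \<epsilon> \<and> foot A \<rho> z x v \<and> v \<in> UNIV"
        using foot_exists[of z] by (metis UNIV_I dist_norm diff_zero)
    qed (use zero_mem in auto)
    then show thesis using nrm[of 0] assms(2) that by auto
  qed
  \<comment> \<open>With slope at most \<open>\<delta>/2\<close>, the direction
    \<open>(c, 1)\<close> has positive product with every foot direction. The upper end
    \<open>p\<close> is in \<open>A\<close>, so its end condition is vacuous.\<close>
  have down: "p - \<tau> *\<^sub>R (c, 1) \<in> A"
    if p: "p \<in> A" "norm p < b" "\<bar>c\<bar> \<le> \<delta>/2" "\<tau> \<ge> 0" "norm (p - \<tau> *\<^sub>R (c, 1)) < b" for p c \<tau>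
  proof (cases "\<tau> = 0")
    case True
    then show ?thesis using p(1) by (cases p) simp
  next
    case False
    define q where "q = p - \<tau> *\<^sub>R (c, 1)"
    have pq: "p = q + \<tau> *\<^sub>R (c, 1)" by (simp add: q_def)
    have seg: "norm (q + t *\<^sub>R (c, 1)) < b" if "t \<in> {0..\<tau>}" for t
    proof -
      have "(1 - t/\<tau>) *\<^sub>R q + (t/\<tau>) *\<^sub>R p \<in> ball 0 b"
        using p False that convex_ball[of 0 b] unfolding q_def[symmetric]
        by (intro convexD) (auto simp: divide_le_eq)
      moreover have "(1 - t/\<tau>) *\<^sub>R q + (t/\<tau>) *\<^sub>R p = q + t *\<^sub>R (c, 1)"
        using False unfolding pq scaleR_add_right scaleR_diff_left by simp
      ultimately show ?thesis by simp
    qed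
    have pos: "v \<bullet> (c, 1) > 0" if "t \<in> {0..\<tau>}" "foot A \<rho> (q + t *\<^sub>R (c, 1)) x v" for t x v
    proof -
      have v: "snd v \<ge> \<delta>" using ft[OF that(2)] seg[OF that(1)] by simp
      have "norm v = 1" using that(2) by (simp add: foot_def prox_normal_def)
      then have "\<bar>fst v\<bar> \<le> 1" using norm_Pair_bounds(1)[of "fst v" "snd v"] by simp
      then have "\<bar>fst v * c\<bar> \<le> 1 * (\<delta>/2)" unfolding abs_mult using p(3) by (intro mult_mono) auto
      moreover have "v \<bullet> (c, 1) = fst v * c + snd v" by (cases v) simp
      ultimately show ?thesis using v assms(1) by linarith
    qed
    have "q + 0 *\<^sub>R (c, 1) \<in> A"
    proof (rule infdist_max_on_segment)
      fix x v assume "foot A \<rho> (q + \<tau> *\<^sub>R (c, 1)) x v"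
      then show "v \<bullet> (c, 1) < 0" using p(1) pq by (simp add: foot_def)
    next
      fix t assume "t \<in> {0..\<tau>}"
      then show "norm (q + t *\<^sub>R (c, 1)) < \<rho>" using seg b(3) by fastforce
    qed (use p(4) pos in fastforce)+
    then show ?thesis by (simp add: q_def del: scaleR_Pair)
  qed
  define L where "L = 2 / \<delta>"
  have L: "L > 0" "L * (\<delta>/2) = 1" using assms(1) by (auto simp: L_def)
  have sg: "L * \<bar>x\<bar> * (sgn x * (\<delta>/2)) = x" for x :: real
    using assms(1) by (simp add: L_def abs_mult_sgn)
  have sg1: "\<bar>sgn x * (\<delta>/2)\<bar> \<le> \<delta>/2" for x :: real
    using assms(1) by (simp add: abs_mult abs_sgn_eq)
  \<comment> \<open>A point higher than \<open>L * \<bar>x\<bar>\<close> could be slid down the cone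
    to a point of the positive axis, which lies in the touching ball at 0.\<close>
  have above: "t \<le> L * \<bar>x\<bar>" if "(x, t) \<in> A" "norm (x, t) < b" for x t
  proof (rule ccontr)
    assume c: "\<not> t \<le> L * \<bar>x\<bar>"
    define t' where "t' = t - L * \<bar>x\<bar>"
    have eq: "(x, t) - (L * \<bar>x\<bar>) *\<^sub>R (sgn x * (\<delta>/2), 1) = (0, t')"
      using sg[of x] by (simp add: t'_def)
    have "L * \<bar>x\<bar> \<ge> 0" using L(1) by simp
    then have t': "t' > 0" "t' < b"
      using c that(2) norm_Pair_bounds(2)[where a=x and b=t] unfolding t'_def by linarith+
    have "(0, t') \<in> A"
      using down[OF that sg1[of x], of "L * \<bar>x\<bar>"] t' L unfolding eq by (simp add: norm_Pair)
    then have "2 * \<rho> * (((0, t') - 0) \<bullet> v0) \<le> (norm ((0, t') - (0::real\<times>real)))\<^sup>2"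
      using v0(1) unfolding prox_normal_def by blast
    then have "2 * \<rho> * (t' * snd v0) \<le> t'\<^sup>2" by (cases v0) (simp add: norm_Pair)
    then have "2 * \<rho> * snd v0 \<le> t'" using t' by (simp add: power2_eq_square algebra_simps)
    moreover have "2 * \<rho> * \<delta> \<le> 2 * \<rho> * snd v0" using v0(2) rho_pos by simp
    ultimately show False using t' b(4) by linarith
  qed
  \<comment> \<open>The first bound keeps the cone over \<open>(-r, r)\<close> inside the ball of
    radius \<open>b\<close>; the other two supply the size bounds of
    \<open>graph_regular\<close>.\<close>
  define r where "r = min (b / (2 * (1 + L))) (min (\<rho> * \<delta> / (2 * L)) (\<rho> / 2))"
  have r: "r > 0" using b L rho_pos assms(1) by (simp add: r_def)
  have r2: "r \<le> \<rho> / 2" unfolding r_def by (simp only: min.coboundedI2 min.cobounded2)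
  have rL: "r * (1 + L) \<le> b / 2"
  proof -
    have "r \<le> b / (2 * (1 + L))" by (simp add: r_def)
    then show ?thesis using L by (simp add: field_simps)
  qed
  have rL2: "r * L \<le> \<rho> * \<delta> / 2"
  proof -
    have "r \<le> \<rho> * \<delta> / (2 * L)" by (simp add: r_def)
    then show ?thesis using L by (simp add: field_simps)
  qed
  have rb: "r \<le> b"
  proof -
    have "r * L > 0" using r L by simp
    then show ?thesis using rL b(1) by (simp add: distrib_left)
  qed
  have nb: "norm (x, t) < b" if "\<bar>x\<bar> < r" "\<bar>t\<bar> \<le> L * \<bar>x\<bar>" for x t
  proof -
    have "norm (x, t) \<le> \<bar>x\<bar> * (1 + L)" using norm_Pair_bounds(3)[of x t] that by (simp add: algebra_simps)
    also have "\<dots> \<le> r * (1 + L)" using that L by (intro mult_right_mono) auto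
    finally show ?thesis using rL b by linarith
  qed
  have below: "(x, - (L * \<bar>x\<bar>)) \<in> A" if "\<bar>x\<bar> < r" for x
  proof -
    have eq: "0 - (L * \<bar>x\<bar>) *\<^sub>R (- (sgn x * (\<delta>/2)), 1) = (x, - (L * \<bar>x\<bar>))"
      using sg[of x] by (simp add: zero_prod_def)
    have n: "norm (x, - (L * \<bar>x\<bar>)) < b" using nb[OF that, of "- (L * \<bar>x\<bar>)"] L by (simp add: abs_mult)
    have "\<bar>- (sgn x * (\<delta>/2))\<bar> \<le> \<delta>/2" using sg1[of x] unfolding abs_minus_cancel .
    then show ?thesis
      using down[OF zero_mem, of "- (sgn x * (\<delta>/2))" "L * \<bar>x\<bar>"] n L b(1) unfolding eq by simp
  qed
  define S where "S x = {t. (x, t) \<in> A \<and> norm (x, t) < b}" for x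
  define \<phi> where "\<phi> x = Sup (S x)" for x
  have S1: "- (L * \<bar>x\<bar>) \<in> S x" if "\<bar>x\<bar> < r" for x
    using below[OF that] nb[OF that, of "- (L * \<bar>x\<bar>)"] L by (simp add: S_def abs_mult)
  have bdd: "bdd_above (S x)" for x using above unfolding S_def by (intro bdd_aboveI[of _ "L * \<bar>x\<bar>"]) auto
  have \<phi>: "\<bar>\<phi> x\<bar> \<le> L * \<bar>x\<bar>" if "\<bar>x\<bar> < r" for x
  proof -
    have "\<phi> x \<le> L * \<bar>x\<bar>" unfolding \<phi>_def using S1[OF that] above by (intro cSup_least) (auto simp: S_def)
    moreover have "- (L * \<bar>x\<bar>) \<le> \<phi> x" unfolding \<phi>_def using S1[OF that] bdd by (intro cSup_upper) auto
    ultimately show ?thesis by simp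
  qed
  have \<phi>A: "(x, \<phi> x) \<in> A" if "\<bar>x\<bar> < r" for x
  proof (rule mem_limit_Pair)
    show "norm (x, \<phi> x) < \<rho>" using nb[OF that \<phi>[OF that]] b by simp
    show "\<phi> x \<in> closure (S x)"
      unfolding \<phi>_def using S1[OF that] bdd by (intro closure_contains_Sup) auto
  qed (simp add: S_def)
  have iff: "(x, t) \<in> A \<longleftrightarrow> t \<le> \<phi> x" if "norm (x, t) < r" for x t
  proof
    assume "(x, t) \<in> A"
    then show "t \<le> \<phi> x" unfolding \<phi>_def using that rb bdd by (intro cSup_upper) (auto simp: S_def)
  next
    assume t: "t \<le> \<phi> x"
    have x: "\<bar>x\<bar> < r" using that norm_Pair_bounds(1)[where a=x and b=t] by simp
    show "(x, t) \<in> A"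
      using down[OF \<phi>A[OF x] nb[OF x \<phi>[OF x]], of 0 "\<phi> x - t"] t that rb assms(1) by simp
  qed
  let ?I = "{-r<..<r}"
  \<comment> \<open>Points straight above the graph lie outside \<open>A\<close>; their foot
    directions satisfy the closed condition and converge to a normal on the graph.\<close>
  have nrm\<phi>: "\<exists>v. prox_normal A \<rho> (x, 1 * \<phi> x) v \<and> 1 * snd v \<ge> \<delta>" if "x \<in> ?I" for x
  proof -
    have x: "\<bar>x\<bar> < r" using that by auto
    have "\<exists>v\<in>{v. snd v \<ge> \<delta>}. prox_normal A \<rho> (x, \<phi> x) v"
    proof (rule prox_normal_limit_feet)
      show "closed {v::real\<times>real. snd v \<ge> \<delta>}" by (intro closed_Collect_le continuous_intros)
      show "(x, \<phi> x) \<in> A" by (rule \<phi>A[OF x])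
      fix \<epsilon> :: real assume "\<epsilon> > 0"
      define \<eta> where "\<eta> = min \<epsilon> (b - norm (x, \<phi> x)) / 2"
      have n: "norm (x, \<phi> x) < b" by (rule nb[OF x \<phi>[OF x]])
      have \<eta>: "\<eta> > 0" "\<eta> < \<epsilon>" "\<eta> < b - norm (x, \<phi> x)" using \<open>\<epsilon> > 0\<close> n by (auto simp: \<eta>_def)
      define z where "z = (x, \<phi> x + \<eta>)"
      have dz: "dist z (x, \<phi> x) = \<eta>" using \<eta> by (simp add: z_def dist_Pair_Pair dist_real_def)
      have nz: "norm z < b"
        using norm_triangle_ineq2[of z "(x, \<phi> x)"] dz \<eta>(3) by (simp add: dist_norm)
      have "z \<notin> A"
      proof
        assume "z \<in> A"
        then have "\<phi> x + \<eta> \<in> S x" using nz by (simp add: z_def S_def)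
        then have "\<phi> x + \<eta> \<le> \<phi> x" unfolding \<phi>_def[of x] using bdd by (intro cSup_upper) auto
        then show False using \<eta> by simp
      qed
      then obtain y v where f: "foot A \<rho> z y v" using foot_exists[of z] nz b by fastforce
      then show "\<exists>z y v. dist z (x, \<phi> x) < \<epsilon> \<and> foot A \<rho> z y v \<and> v \<in> {v. \<delta> \<le> snd v}"
        using ft[OF f nz] dz \<eta> by (intro exI[of _ z] exI[of _ y] exI[of _ v]) auto
    qed
    then show ?thesis by auto
  qed
  have bd\<phi>: "\<bar>\<phi> x\<bar> \<le> \<rho> * \<delta> / 2" if "x \<in> ?I" for x
  proof -
    have x: "\<bar>x\<bar> < r" using that by auto
    have "L * \<bar>x\<bar> \<le> L * r" using x L by simp
    then show ?thesis using \<phi>[OF x] rL2 by (simp add: mult.commute)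
  qed
  have reg: "\<exists>L. L-lipschitz_on ?I \<phi>" "semiconcave_on ?I \<phi>"
    by (rule graph_regular[of 1 \<delta> ?I \<phi>]; use assms(1) \<phi>A nrm\<phi> bd\<phi> r r2 in fastforce)+
  have "T1_set r (A \<inter> ball 0 r)"
    unfolding T1_set_def
  proof (intro exI[of _ \<phi>] conjI reg)
    show "\<phi> 0 = 0" using \<phi>[of 0] r by simp
    have "(x, t) \<in> A \<inter> ball 0 r \<longleftrightarrow> (x, t) \<in> ball 0 r \<inter> hypo ?I \<phi>" for x t
    proof (cases "norm (x, t) < r")
      case True
      then have "\<bar>x\<bar> < r" using norm_Pair_bounds(1)[where a=x and b=t] by simp
      then show ?thesis using iff[OF True] True by (auto simp: hypo_def abs_less_iff)
    qed simp
    then show "A \<inter> ball 0 r = ball 0 r \<inter> hypo ?I \<phi>"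
      unfolding set_eq_iff split_paired_All by blast
  qed
  then show ?thesis using r by blast
qed

end

section \<open>Thin sets along one half-axis\<close>

context prox_regular_plane
begin

text \<open>\<open>\<sigma> = \<plusminus>1\<close> selects the half-axis over which the strip lies.\<close>

definition side_strip :: "real \<Rightarrow> real \<Rightarrow> real \<Rightarrow> (real \<Rightarrow> real) \<Rightarrow> (real \<Rightarrow> real) \<Rightarrow> bool" where
  "side_strip \<sigma> C r \<psi> \<phi> \<longleftrightarrow> r > 0 \<and> (\<forall>x\<in>{0..<r}.
     \<psi> x \<le> \<phi> x \<and> (\<sigma> * x, \<phi> x) \<in> A \<and> (\<sigma> * x, \<psi> x) \<in> A \<and> \<bar>\<phi> x\<bar> \<le> C * x\<^sup>2 \<and> \<bar>\<psi> x\<bar> \<le> C * x\<^sup>2 \<and>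
     (\<forall>t. norm (\<sigma> * x, t) < r \<longrightarrow> ((\<sigma> * x, t) \<in> A \<longleftrightarrow> \<psi> x \<le> t \<and> t \<le> \<phi> x)) \<and>
     (\<exists>v. prox_normal A \<rho> (\<sigma> * x, \<phi> x) v \<and> snd v \<ge> 1/2) \<and>
     (\<exists>v. prox_normal A \<rho> (\<sigma> * x, \<psi> x) v \<and> - snd v \<ge> 1/2))"

text \<open>Near 0, and over the open half-axis, all normals are nearly vertical. So the maximum
  principle on vertical segments makes the fibres intervals, while an empty fibre would force a
  horizontal normal at the outermost point before it. Points just beyond the ends of a fibre then
  give upward and downward normals.\<close>

lemma side_strip_exists:
  assumes \<sigma>: "\<sigma> = 1 \<or> \<sigma> = -1" and "C > 0"
    and quad: "\<And>y. y \<in> A \<Longrightarrow> norm y < \<rho> \<Longrightarrow> \<bar>snd y\<bar> \<le> C * (norm y)\<^sup>2"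
    and tan: "(\<sigma>, 0) \<in> tangent_dirs A"
  shows "\<exists>r \<psi> \<phi>. side_strip \<sigma> (2 * C) r \<psi> \<phi>"
proof -
  have ss: "\<sigma> * (\<sigma> * x) = x" "\<bar>\<sigma> * x\<bar> = \<bar>x\<bar>" "\<sigma> * x = y \<longleftrightarrow> x = \<sigma> * y" for x y :: real
    using \<sigma> by auto
  obtain s1 where s1: "s1 > 0" "\<And>x v. norm x < s1 \<Longrightarrow> prox_normal A \<rho> x v \<Longrightarrow> v \<bullet> (\<sigma>, 0) \<le> 1/2"
    using tangent_normal_bound[OF tan rho_pos, of "1/2"] by auto
  \<comment> \<open>\<open>s1\<close> controls normals along the tangent, \<open>\<rho>/4\<close>
    absorbs the quadratic term at 0, and \<open>C * b \<le> 1/32\<close> makes \<open>A\<close> flat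
    enough for slope \<open>1/16\<close>.\<close>
  define b where "b = min s1 (min (\<rho>/4) (1 / (32 * C)))"
  have b: "b > 0" "b \<le> s1" "b \<le> \<rho>/4" "C * b \<le> 1/32"
  proof -
    show "b > 0" using s1 rho_pos \<open>C > 0\<close> by (simp add: b_def)
    have "b \<le> 1 / (32 * C)" unfolding b_def by (simp only: min.coboundedI2 min.cobounded2)
    then show "C * b \<le> 1/32" using \<open>C > 0\<close> by (simp add: field_simps)
    show "b \<le> \<rho>/4" unfolding b_def by (simp only: min.coboundedI2 min.cobounded1)
  qed (simp add: b_def)
  have flat: "\<bar>y2\<bar> \<le> \<bar>y1\<bar> / 16" "\<bar>y2\<bar> \<le> 2 * C * y1\<^sup>2" "(norm (y1, y2))\<^sup>2 \<le> 2 * y1\<^sup>2"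
    if y: "(y1, y2) \<in> A" "norm (y1, y2) < b" for y1 y2
  proof -
    let ?n = "norm (y1, y2)"
    have q: "\<bar>y2\<bar> \<le> C * ?n\<^sup>2" using quad[OF y(1)] y(2) b rho_pos by simp
    have "C * ?n\<^sup>2 = C * ?n * ?n" by (simp add: power2_eq_square)
    also have "\<dots> \<le> (1/32) * ?n"
    proof (rule mult_right_mono)
      have "C * ?n \<le> C * b" using y(2) \<open>C > 0\<close> by simp
      then show "C * ?n \<le> 1/32" using b(4) by linarith
    qed simp
    finally have "\<bar>y2\<bar> \<le> ?n / 32" using q by linarith
    then show 1: "\<bar>y2\<bar> \<le> \<bar>y1\<bar> / 16" using norm_Pair_bounds(3)[of y1 y2] by linarith
    have "\<bar>y2\<bar>\<^sup>2 \<le> \<bar>y1\<bar>\<^sup>2" using 1 by (intro power_mono) auto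
    then show 2: "?n\<^sup>2 \<le> 2 * y1\<^sup>2" by (simp add: norm_Pair)
    have "C * ?n\<^sup>2 \<le> C * (2 * y1\<^sup>2)" using 2 \<open>C > 0\<close> by (intro mult_left_mono) auto
    then show "\<bar>y2\<bar> \<le> 2 * C * y1\<^sup>2" using q by simp
  qed
  have nrm: "\<bar>fst v\<bar> \<le> 1/2" "\<bar>snd v\<bar> \<ge> 1/2"
    if x: "(x1, x2) \<in> A" "norm (x1, x2) < b" "\<sigma> * x1 > 0" and v: "prox_normal A \<rho> (x1, x2) v" for x1 x2 v
  proof -
    obtain v1 v2 where vv: "v = (v1, v2)" by (cases v)
    have nv: "norm (v1, v2) = 1" using v by (simp add: prox_normal_def vv)
    have up: "\<sigma> * v1 \<le> 1/2" using s1(2)[OF _ v] x(2) b(2) by (simp add: vv mult.commute)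
    \<comment> \<open>The tangent direction bounds \<open>\<sigma> * v1\<close> from above only. The
      lower bound comes from testing at 0, seen from \<open>(x1, x2)\<close> in an almost horizontal
      direction.\<close>
    have "2 * \<rho> * ((0 - (x1, x2)) \<bullet> v) \<le> (norm (0 - (x1, x2)))\<^sup>2"
      using v zero_mem unfolding prox_normal_def by blast
    then have "- (2 * \<rho> * (x1 * v1 + x2 * v2)) \<le> (norm (x1, x2))\<^sup>2"
      by (simp add: vv norm_Pair right_diff_distrib distrib_left)
    then have i: "- (2 * \<rho> * (x1 * v1 + x2 * v2)) \<le> 2 * x1\<^sup>2" using flat(3)[OF x(1,2)] by linarith
    define h where "h = \<sigma> * x1"
    have h: "h > 0" "x1 = \<sigma> * h" "h = \<bar>x1\<bar>" using x(3) \<sigma> by (auto simp: h_def)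
    have hb: "h \<le> \<rho>/4" using h(3) norm_Pair_bounds(1)[of x1 x2] x(2) b(3) by linarith
    have "\<bar>v2\<bar> \<le> 1" using norm_Pair_bounds(2)[of v2 v1] nv by simp
    moreover have "\<bar>x2\<bar> \<le> h/16" using flat(1)[OF x(1,2)] h(3) by linarith
    ultimately have "\<bar>x2 * v2\<bar> \<le> h/16 * 1" unfolding abs_mult using h(1) by (intro mult_mono) auto
    then have j: "x2 * v2 \<le> h/16" by linarith
    have e1: "x1\<^sup>2 = h * h" unfolding h(3) by (simp add: power2_eq_square)
    have e2: "h * h \<le> h * (\<rho>/4)" using hb h(1) by (intro mult_left_mono) auto
    define W where "W = x1 * v1 + x2 * v2"
    have "- (2 * \<rho> * W) \<le> 2 * x1\<^sup>2" unfolding W_def by (rule i)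
    moreover have "\<rho> * (- W) = - (2 * \<rho> * W) / 2" "\<rho> * (h/4) = h * (\<rho>/4)" by simp_all
    ultimately have "\<rho> * (- W) \<le> \<rho> * (h/4)" using e1 e2 by linarith
    then have "- W \<le> h/4" using rho_pos by (simp only: mult_le_cancel_left_pos)
    moreover have "x1 * v1 = h * (\<sigma> * v1)" by (subst h(2)) (simp add: algebra_simps)
    ultimately have "h * (- (\<sigma> * v1)) \<le> h * (1/2)" using j h(1) by (simp add: W_def)
    then have "- (\<sigma> * v1) \<le> 1/2" using h(1) by (simp only: mult_le_cancel_left_pos)
    then have v1: "\<bar>v1\<bar> \<le> 1/2" using up ss(2)[of v1] by linarith
    then show "\<bar>fst v\<bar> \<le> 1/2" by (simp add: vv)
    show "\<bar>snd v\<bar> \<ge> 1/2" using norm_Pair_bounds(3)[of v1 v2] nv v1 by (simp add: vv)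
  qed
  \<comment> \<open>Distance less than \<open>x\<close> keeps the foot strictly on the chosen side
    of the vertical axis, where \<open>nrm\<close> applies.\<close>
  have ft: "\<bar>snd v\<bar> \<ge> 1/2" if f: "foot A \<rho> (\<sigma> * x, t) y v" and x: "norm (\<sigma> * x, t) < b/2"
      "infdist (\<sigma> * x, t) A < x" for x t y v
  proof -
    obtain y1 y2 where y: "y = (y1, y2)" by (cases y)
    have "norm y < b" using foot_norm[OF f] x(1) by simp
    moreover have "\<sigma> * y1 > 0"
    proof -
      have "\<bar>\<sigma> * x - y1\<bar> \<le> dist (\<sigma> * x, t) y"
        using norm_Pair_bounds(1)[of "\<sigma> * x - y1" "t - y2"] by (simp add: y dist_norm)
      then have "\<bar>\<sigma> * x - y1\<bar> < x" using foot_dist[OF f] x(2) by simp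
      then show ?thesis using \<sigma> by auto
    qed
    ultimately show ?thesis using nrm(2)[of y1 y2 v] f y by (simp add: foot_def)
  qed
  have nb: "norm (\<sigma> * x, t) < b/4" if "0 \<le> x" "x < b/8" "\<bar>t\<bar> \<le> x/8" for x t
    using norm_Pair_bounds(3)[of "\<sigma> * x" t] ss(2)[of x] that by linarith
  have fib: "\<bar>t\<bar> \<le> x/16" if "0 \<le> x" "(\<sigma> * x, t) \<in> A" "norm (\<sigma> * x, t) < b" for x t
    using flat(1)[OF that(2,3)] ss(2)[of x] that(1) by simp
  have itv: "(\<sigma> * x, t) \<in> A"
    if x: "0 < x" "x < b/8" and t12: "(\<sigma> * x, t1) \<in> A" "(\<sigma> * x, t2) \<in> A"
      "\<bar>t1\<bar> \<le> x/16" "\<bar>t2\<bar> \<le> x/16" and t: "t \<in> {t1..t2}" for x t t1 t2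
  proof -
    have p: "(\<sigma> * x, 0) + u *\<^sub>R (0, 1) = (\<sigma> * x, u)" for u by simp
    have n: "norm (\<sigma> * x, u) < b/4" if "u \<in> {t1..t2}" for u
    proof -
      have "t1 \<le> u" "u \<le> t2" using that by auto
      then have "\<bar>u\<bar> \<le> x/8" using t12(3,4) x(1) by linarith
      then show ?thesis using nb[of x u] x by simp
    qed
    show "(\<sigma> * x, t) \<in> A"
    proof (rule infdist_max_on_segment[OF _ _ _ _ _ t, where e = "(0, 1)" and p = "(\<sigma> * x, 0)", unfolded p])
      fix u assume "u \<in> {t1..t2}"
      then show "norm (\<sigma> * x, u) < \<rho>" using n[of u] b rho_pos by simp
    next
      fix u y v assume u: "u \<in> {t1..t2}" and f: "foot A \<rho> (\<sigma> * x, u) y v"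
      have "infdist (\<sigma> * x, u) A \<le> \<bar>u - t1\<bar>"
        using infdist_le[OF t12(1), of "(\<sigma> * x, u)"] by (simp add: dist_Pair_Pair dist_real_def)
      also have "\<dots> < x"
      proof -
        have "t1 \<le> u" "u \<le> t2" using u by auto
        then show ?thesis using t12(3,4) x(1) by linarith
      qed
      finally have "\<bar>snd v\<bar> \<ge> 1/2" using ft[OF f] n[OF u] b by simp
      then show "v \<bullet> (0, 1) \<noteq> 0" by (cases v) auto
    qed (use t t12 in \<open>auto simp: foot_def\<close>)
  qed
  have tanpt: "\<exists>h t. 0 < h \<and> h < \<epsilon> \<and> (\<sigma> * h, t) \<in> A \<and> norm (\<sigma> * h, t) < \<epsilon>" if "\<epsilon> > 0" for \<epsilon>
  proof -
    have "min \<epsilon> (1/2) > 0" using that by simp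
    then obtain y where y: "y \<in> A" "y \<noteq> 0" "norm y < min \<epsilon> (1/2)"
        "norm (y - norm y *\<^sub>R (\<sigma>, 0)) \<le> min \<epsilon> (1/2) * norm y"
      using tan unfolding tangent_dirs_def by blast
    obtain y1 y2 where yy: "y = (y1, y2)" by (cases y)
    have "min \<epsilon> (1/2) * norm y \<le> (1/2) * norm y" by (intro mult_right_mono) auto
    then have "norm (y1 - norm y * \<sigma>, y2) \<le> norm y / 2" using y(4) by (simp add: yy)
    then have "\<bar>y1 - norm y * \<sigma>\<bar> \<le> norm y / 2" using norm_Pair_bounds(1) order_trans by blast
    moreover have "norm y > 0" using y(2) by simp
    moreover have "\<sigma> * y1 > 0" if "\<bar>y1 - n * \<sigma>\<bar> \<le> n / 2" "n > 0" for n
      using that \<sigma> unfolding abs_le_iff by (elim disjE conjE) simp_all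
    ultimately have "\<sigma> * y1 > 0" by blast
    moreover have "norm (y1, y2) < \<epsilon>" using y(3) by (simp add: yy)
    then have "\<sigma> * y1 < \<epsilon>" using norm_Pair_bounds(1)[of y1 y2] ss(2)[of y1] by linarith
    ultimately show ?thesis using y by (intro exI[of _ "\<sigma> * y1"] exI[of _ y2]) (simp add: ss yy)
  qed
  obtain r t0 where r: "0 < r" "r < b/8" "(\<sigma> * r, t0) \<in> A" "norm (\<sigma> * r, t0) < b/8"
    using tanpt[of "b/8"] b by auto
  \<comment> \<open>If the fibre over \<open>x\<close> were empty, take the point \<open>p\<close>
    of \<open>A\<close> farthest along the half-axis before \<open>x\<close> and a point
    \<open>z\<close> slightly beyond it. The foot of \<open>z\<close> can be neither farther than
    \<open>p\<close> nor far behind \<open>z\<close>, so its normal is horizontal.\<close>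
  have ne: "\<exists>t. (\<sigma> * x, t) \<in> A \<and> norm (\<sigma> * x, t) < b/2" if x: "0 < x" "x < r" for x
  proof (rule ccontr)
    assume empty: "\<not> ?thesis"
    define Q where "Q = {p \<in> A. norm p \<le> b/4 \<and> \<sigma> * fst p \<le> x}"
    have "closed Q"
      unfolding closed_sequential_limits
    proof (intro allI impI, elim conjE)
      fix X l assume X: "\<forall>n. X n \<in> Q" "X \<longlonglongrightarrow> l"
      have n: "norm l \<le> b/4"
        by (rule LIMSEQ_le_const2[OF tendsto_norm[OF X(2)]]) (use X(1) in \<open>auto simp: Q_def\<close>)
      then have "norm l < \<rho>" using b rho_pos by linarith
      then have "l \<in> A" using mem_limit[OF _ _ X(2)] X(1) by (auto simp: Q_def)
      moreover have "(\<lambda>n. \<sigma> * fst (X n)) \<longlonglongrightarrow> \<sigma> * fst l" by (intro tendsto_intros X(2))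
      then have "\<sigma> * fst l \<le> x" by (rule LIMSEQ_le_const2) (use X(1) in \<open>auto simp: Q_def\<close>)
      ultimately show "l \<in> Q" using n by (simp add: Q_def)
    qed
    moreover have "bounded Q" unfolding bounded_iff Q_def by blast
    ultimately have "compact Q" by (simp add: compact_eq_bounded_closed)
    moreover have "0 \<in> Q" using zero_mem b x by (simp add: Q_def)
    moreover have "continuous_on Q (\<lambda>p. \<sigma> * fst p)" by (intro continuous_intros)
    ultimately obtain p where p: "p \<in> Q" "\<And>q. q \<in> Q \<Longrightarrow> \<sigma> * fst q \<le> \<sigma> * fst p"
      using continuous_attains_sup[of Q "\<lambda>p. \<sigma> * fst p"] by blast
    define m where "m = \<sigma> * fst p"
    define t where "t = snd p"
    have pe: "p = (\<sigma> * m, t)" by (simp add: m_def t_def ss)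
    have pA: "(\<sigma> * m, t) \<in> A" "norm (\<sigma> * m, t) \<le> b/4" "m \<le> x"
      using p(1) unfolding pe by (auto simp: Q_def ss)
    have m0: "0 < m"
    proof -
      obtain h u where hu: "0 < h" "h < min x (b/8)" "(\<sigma> * h, u) \<in> A" "norm (\<sigma> * h, u) < min x (b/8)"
        using tanpt[of "min x (b/8)"] b x by auto
      then have "(\<sigma> * h, u) \<in> Q" using b by (simp add: Q_def ss)
      then show ?thesis using p(2)[of "(\<sigma> * h, u)"] hu(1) by (simp add: m_def ss)
    qed
    have mx: "m < x" using empty pA b by (cases "m = x") auto
    have tm: "\<bar>t\<bar> \<le> m/16" using fib[OF _ pA(1)] m0 pA(2) b by simp
    \<comment> \<open>A quarter of the gap keeps the foot of \<open>z\<close> short of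
      \<open>x\<close>, hence in \<open>Q\<close>; \<open>b/64\<close> keeps it within norm
      \<open>b/4\<close>.\<close>
    define \<eta> where "\<eta> = min ((x - m)/4) (b/64)"
    have \<eta>: "\<eta> > 0" "\<eta> \<le> (x - m)/4" "\<eta> \<le> b/64" using mx b by (auto simp: \<eta>_def min_def)
    define z where "z = (\<sigma> * (m + \<eta>), t)"
    have nz: "norm z \<le> m + \<eta> + m/16"
      using norm_Pair_bounds(3)[of "\<sigma> * (m + \<eta>)" t] ss(2)[of "m + \<eta>"] tm m0 \<eta>(1)
      unfolding z_def by linarith
    then have nz': "norm z + \<eta> \<le> b/4" using mx x(2) r(2) \<eta>(3) b(1) by linarith
    have "z \<notin> A"
    proof
      assume "z \<in> A"
      then have "z \<in> Q" using nz' \<eta> by (simp add: Q_def z_def ss)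
      then show False using p(2)[of z] \<eta>(1) by (simp add: z_def ss flip: m_def)
    qed
    then obtain y v where f: "foot A \<rho> z y v" using foot_exists[of z] nz' \<eta>(1) b rho_pos by fastforce
    define d where "d = infdist z A"
    have d: "d > 0" "z = y + d *\<^sub>R v" "y \<in> A" "prox_normal A \<rho> y v" "norm v = 1"
      using f by (auto simp: foot_def d_def prox_normal_def)
    have "dist z (\<sigma> * m, t) = \<eta>"
      using \<eta> ss(2)[of \<eta>] by (simp add: z_def dist_Pair_Pair dist_real_def flip: right_diff_distrib)
    then have d\<eta>: "d \<le> \<eta>" using infdist_le[OF pA(1), of z] by (simp add: d_def)
    obtain y1 y2 v1 v2 where yv: "y = (y1, y2)" "v = (v1, v2)" by (cases y, cases v)
    have y1: "\<sigma> * y1 = m + \<eta> - d * (\<sigma> * v1)"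
      using d(2) ss(1)[of "m + \<eta>"] unfolding z_def yv by (simp add: algebra_simps)
    have "\<bar>\<sigma> * v1\<bar> \<le> 1" using norm_Pair_bounds(1)[of v1 v2] d(5) ss(2)[of v1] by (simp add: yv)
    then have "\<bar>d * (\<sigma> * v1)\<bar> \<le> d * 1" unfolding abs_mult using d(1) by (intro mult_mono) auto
    then have y1b: "m \<le> \<sigma> * y1" "\<sigma> * y1 \<le> m + 2 * \<eta>" using y1 d\<eta> by linarith+
    have "norm y \<le> norm z + dist z y" by (metis dist_0_norm dist_triangle)
    then have ny: "norm y \<le> b/4" using foot_dist[OF f] d\<eta> nz' by (simp add: d_def)
    have "y \<in> Q" using ny y1b \<eta>(2) mx d(3) by (simp add: Q_def yv)
    then have "\<sigma> * y1 \<le> m" using p(2)[of y] by (simp add: yv m_def)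
    then have "d * 1 \<le> d * (\<sigma> * v1)" using y1 d\<eta> by linarith
    then have "\<sigma> * v1 \<ge> 1" using d(1) by (simp only: mult_le_cancel_left_pos)
    moreover have "\<bar>v1\<bar> \<le> 1/2" using nrm(1)[of y1 y2 v] d(3,4) ny b y1b m0 by (simp add: yv)
    ultimately show False using ss(2)[of v1] by linarith
  qed
  define S where "S x = {t. (\<sigma> * x, t) \<in> A \<and> norm (\<sigma> * x, t) < b/2}" for x
  have Sb: "\<bar>t\<bar> \<le> x/16" if "t \<in> S x" "0 \<le> x" for x t
    using fib[of x t] that b by (simp add: S_def)
  have Sne: "S x \<noteq> {}" if "x \<in> {0..<r}" for x
    using ne[of x] that zero_mem b by (cases "x = 0") (auto simp: S_def zero_prod_def)
  have bdd: "bdd_above (S x)" "bdd_below (S x)" if "x \<in> {0..<r}" for x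
  proof -
    have "\<bar>t\<bar> \<le> x/16" if "t \<in> S x" for t using Sb[OF that] \<open>x \<in> {0..<r}\<close> by simp
    then have "t \<le> x/16 \<and> - (x/16) \<le> t" if "t \<in> S x" for t using that by (metis abs_le_iff minus_le_iff)
    then show "bdd_above (S x)" "bdd_below (S x)"
      by (meson bdd_aboveI bdd_belowI)+
  qed
  define \<phi> where "\<phi> x = Sup (S x)" for x
  define \<psi> where "\<psi> x = Inf (S x)" for x
  have up: "\<bar>\<phi> x\<bar> \<le> x/16" "\<bar>\<psi> x\<bar> \<le> x/16" if x: "x \<in> {0..<r}" for x
  proof -
    have "\<bar>t\<bar> \<le> x/16" if "t \<in> S x" for t using Sb[OF that] x by simp
    then have "t \<le> x/16" "- (x/16) \<le> t" if "t \<in> S x" for t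
      using that by (metis abs_le_iff minus_le_iff)+
    note bds = this
    obtain u where u: "u \<in> S x" using Sne[OF x] by blast
    have "\<phi> x \<le> x/16" unfolding \<phi>_def using Sne[OF x] bds by (intro cSup_least)
    moreover have "u \<le> \<phi> x" unfolding \<phi>_def using u bdd[OF x] by (intro cSup_upper)
    ultimately show "\<bar>\<phi> x\<bar> \<le> x/16" using bds(2)[OF u] by linarith
    have "- (x/16) \<le> \<psi> x" unfolding \<psi>_def using Sne[OF x] bds by (intro cInf_greatest)
    moreover have "\<psi> x \<le> u" unfolding \<psi>_def using u bdd[OF x] by (intro cInf_lower)
    ultimately show "\<bar>\<psi> x\<bar> \<le> x/16" using bds(1)[OF u] by linarith
  qed
  have nn: "norm (\<sigma> * x, \<phi> x) < b/4" "norm (\<sigma> * x, \<psi> x) < b/4" if x: "x \<in> {0..<r}" for x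
    using nb[of x "\<phi> x"] nb[of x "\<psi> x"] up[OF x] x r by auto
  have \<phi>A: "(\<sigma> * x, \<phi> x) \<in> A" if x: "x \<in> {0..<r}" for x
  proof (rule mem_limit_Pair[of _ _ "S x"])
    show "norm (\<sigma> * x, \<phi> x) < \<rho>" using nn[OF x] b rho_pos by simp
    show "\<phi> x \<in> closure (S x)" unfolding \<phi>_def using Sne[OF x] bdd[OF x] by (intro closure_contains_Sup)
  qed (simp add: S_def)
  have \<psi>A: "(\<sigma> * x, \<psi> x) \<in> A" if x: "x \<in> {0..<r}" for x
  proof (rule mem_limit_Pair[of _ _ "S x"])
    show "norm (\<sigma> * x, \<psi> x) < \<rho>" using nn[OF x] b rho_pos by simp
    show "\<psi> x \<in> closure (S x)" unfolding \<psi>_def using Sne[OF x] bdd[OF x] by (intro closure_contains_Inf)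
  qed (simp add: S_def)
  have btw: "\<psi> x \<le> t" "t \<le> \<phi> x" if "x \<in> {0..<r}" "t \<in> S x" for x t
    unfolding \<phi>_def \<psi>_def using bdd[OF that(1)] that(2) by (auto intro: cSup_upper cInf_lower)
  have zero: "\<phi> 0 = 0" "\<psi> 0 = 0" using up[of 0] r by auto
  \<comment> \<open>If every foot direction just beyond the end of the fibre pointed back, the
    maximum principle would put that outside point into \<open>A\<close>. So some foot direction
    points outwards, and a limit gives a normal at the end; \<tau> selects top or bottom.\<close>
  have extreme: "\<exists>v. prox_normal A \<rho> (\<sigma> * x, u) v \<and> \<tau> * snd v \<ge> 1/2"
    if \<tau>: "\<tau> = 1 \<or> \<tau> = -1" and x: "0 < x" "x < r" and u: "(\<sigma> * x, u) \<in> A" "\<bar>u\<bar> \<le> x/16"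
      and out: "\<And>h. h > 0 \<Longrightarrow> u + \<tau> * h \<notin> S x" for x u \<tau>
  proof -
    have "\<exists>v\<in>{v. \<tau> * snd v \<ge> 1/2}. prox_normal A \<rho> (\<sigma> * x, u) v"
    proof (rule prox_normal_limit_feet)
      show "closed {v::real\<times>real. \<tau> * snd v \<ge> 1/2}" by (intro closed_Collect_le continuous_intros)
      fix \<epsilon> :: real assume e: "\<epsilon> > 0"
      define \<eta> where "\<eta> = min (\<epsilon>/2) (x/16)"
      have \<eta>: "\<eta> > 0" "\<eta> < \<epsilon>" "\<eta> \<le> x/16" using e x by (auto simp: \<eta>_def min_def)
      have pe: "(\<sigma> * x, u) + h *\<^sub>R (0, \<tau>) = (\<sigma> * x, u + \<tau> * h)" for h by simp
      have n: "norm (\<sigma> * x, u + \<tau> * h) < b/4" if "h \<in> {0..\<eta>}" for h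
      proof -
        have "\<bar>\<tau> * h\<bar> \<le> x/16" using \<tau> that \<eta>(3) by auto
        then have "\<bar>u + \<tau> * h\<bar> \<le> x/8" using u(2) by linarith
        then show ?thesis using nb[of x "u + \<tau> * h"] x r(2) by simp
      qed
      have dz: "dist (\<sigma> * x, u + \<tau> * h) (\<sigma> * x, u) = h" if "h \<ge> 0" for h
        using \<tau> that by (auto simp: dist_Pair_Pair dist_real_def)
      have sv: "\<bar>snd v\<bar> \<ge> 1/2" if "h \<in> {0..\<eta>}" "foot A \<rho> (\<sigma> * x, u + \<tau> * h) y v" for h y v
        using ft[OF that(2)] n[OF that(1)] b infdist_le[OF u(1), of "(\<sigma> * x, u + \<tau> * h)"] dz[of h] that(1) \<eta>(3) x
        by simp
      have "\<exists>y v. foot A \<rho> (\<sigma> * x, u + \<tau> * \<eta>) y v \<and> v \<bullet> (0, \<tau>) \<ge> 0"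
      proof (rule ccontr)
        assume c: "\<not> ?thesis"
        have "(\<sigma> * x, u + \<tau> * \<eta>) \<in> A"
        proof (rule infdist_max_on_segment[where \<alpha> = 0 and \<beta> = \<eta> and p = "(\<sigma> * x, u)" and e = "(0, \<tau>)", unfolded pe])
          fix h assume "h \<in> {0..\<eta>}"
          then show "norm (\<sigma> * x, u + \<tau> * h) < \<rho>" using n[of h] b rho_pos by simp
        next
          fix h y v assume "h \<in> {0..\<eta>}" "foot A \<rho> (\<sigma> * x, u + \<tau> * h) y v"
          then have "\<bar>snd v\<bar> \<ge> 1/2" by (rule sv)
          then show "v \<bullet> (0, \<tau>) \<noteq> 0" using \<tau> by (cases v) auto
        next
          fix y v assume "foot A \<rho> (\<sigma> * x, u + \<tau> * 0) y v"
          then show "v \<bullet> (0, \<tau>) > 0" using u(1) by (simp add: foot_def)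
        next
          fix y v assume "foot A \<rho> (\<sigma> * x, u + \<tau> * \<eta>) y v"
          then show "v \<bullet> (0, \<tau>) < 0" using c by (meson not_le)
        qed (use \<eta> in auto)
        then have "u + \<tau> * \<eta> \<in> S x" using n[of \<eta>] \<eta> b by (simp add: S_def)
        then show False using out \<eta> by blast
      qed
      then obtain y v where f: "foot A \<rho> (\<sigma> * x, u + \<tau> * \<eta>) y v" "v \<bullet> (0, \<tau>) \<ge> 0" by blast
      have "\<bar>snd v\<bar> \<ge> 1/2" using sv[OF _ f(1)] \<eta> by simp
      then have "\<tau> * snd v \<ge> 1/2" using f(2) \<tau> by (cases v) auto
      then show "\<exists>z y v. dist z (\<sigma> * x, u) < \<epsilon> \<and> foot A \<rho> z y v \<and> v \<in> {v. \<tau> * snd v \<ge> 1/2}"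
        using f(1) dz[of \<eta>] \<eta>
        by (intro exI[of _ "(\<sigma> * x, u + \<tau> * \<eta>)"] exI[of _ y] exI[of _ v]) simp
    qed (rule u(1))
    then show ?thesis by blast
  qed
  \<comment> \<open>Over 0 the side of the axis is no longer controlled, so the normal there is a
    limit of those over small positive abscissae.\<close>
  have extreme0: "\<exists>v. prox_normal A \<rho> (\<sigma> * x, f x) v \<and> \<tau> * snd v \<ge> 1/2"
    if x: "x \<in> {0..<r}" and f0: "f 0 = 0" "\<And>x. x \<in> {0..<r} \<Longrightarrow> \<bar>f x\<bar> \<le> x/16"
      and pos: "\<And>x. 0 < x \<Longrightarrow> x < r \<Longrightarrow> \<exists>v. prox_normal A \<rho> (\<sigma> * x, f x) v \<and> \<tau> * snd v \<ge> 1/2" for f x \<tau>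
  proof (cases "x = 0")
    case False
    then show ?thesis using pos x by simp
  next
    case True
    have "\<exists>v\<in>{v. \<tau> * snd v \<ge> 1/2}. prox_normal A \<rho> (0, 0) v"
    proof (rule prox_normal_limit)
      show "closed {v::real\<times>real. \<tau> * snd v \<ge> 1/2}" by (intro closed_Collect_le continuous_intros)
      fix \<epsilon> :: real assume e: "\<epsilon> > 0"
      define h where "h = min (\<epsilon>/4) (r/2)"
      have h: "0 < h" "h < r" "h \<le> \<epsilon>/4" using e r by (auto simp: h_def min_def)
      have "dist (\<sigma> * h, f h) (0, 0) \<le> \<bar>\<sigma> * h\<bar> + \<bar>f h\<bar>"
        using norm_Pair_bounds(3)[of "\<sigma> * h" "f h"] by (simp add: dist_norm)
      also have "\<dots> < \<epsilon>" using ss(2)[of h] h f0(2)[of h] by simp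
      finally show "\<exists>x v. dist x (0, 0) < \<epsilon> \<and> v \<in> {v. \<tau> * snd v \<ge> 1/2} \<and> prox_normal A \<rho> x v"
        using pos[OF h(1,2)] by blast
    qed
    then show ?thesis using True f0(1) by auto
  qed
  have "side_strip \<sigma> (2 * C) r \<psi> \<phi>"
    unfolding side_strip_def
  proof (intro conjI r(1) ballI allI impI)
    fix x assume x: "x \<in> {0..<r}"
    show "\<psi> x \<le> \<phi> x" using btw[OF x] Sne[OF x] by fastforce
    show "(\<sigma> * x, \<phi> x) \<in> A" "(\<sigma> * x, \<psi> x) \<in> A" using \<phi>A \<psi>A x by auto
    have "(\<sigma> * x)\<^sup>2 = x\<^sup>2" using \<sigma> by auto
    then show "\<bar>\<phi> x\<bar> \<le> 2 * C * x\<^sup>2" "\<bar>\<psi> x\<bar> \<le> 2 * C * x\<^sup>2"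
      using flat(2)[OF \<phi>A[OF x]] flat(2)[OF \<psi>A[OF x]] nn[OF x] b by auto
    show "(\<sigma> * x, t) \<in> A \<longleftrightarrow> \<psi> x \<le> t \<and> t \<le> \<phi> x" if n: "norm (\<sigma> * x, t) < r" for t
    proof
      assume "(\<sigma> * x, t) \<in> A"
      then have "t \<in> S x" using n r by (simp add: S_def)
      then show "\<psi> x \<le> t \<and> t \<le> \<phi> x" using btw[OF x] by blast
    next
      assume t: "\<psi> x \<le> t \<and> t \<le> \<phi> x"
      show "(\<sigma> * x, t) \<in> A"
      proof (cases "x = 0")
        case True
        then have "t = 0" using t zero by auto
        then show ?thesis using True zero_mem by (simp add: zero_prod_def)
      next
        case False
        then show ?thesis
          using itv[of x "\<psi> x" "\<phi> x" t] \<phi>A[OF x] \<psi>A[OF x] up[OF x] t x r by simp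
      qed
    qed
    have top: "\<exists>v. prox_normal A \<rho> (\<sigma> * x, \<phi> x) v \<and> 1 * snd v \<ge> 1/2" if "0 < x" "x < r" for x
      using that by (intro extreme) (use \<phi>A[of x] up[of x] btw(2)[of x] in force)+
    have bot: "\<exists>v. prox_normal A \<rho> (\<sigma> * x, \<psi> x) v \<and> -1 * snd v \<ge> 1/2" if "0 < x" "x < r" for x
      using that by (intro extreme) (use \<psi>A[of x] up[of x] btw(1)[of x] in force)+
    show "\<exists>v. prox_normal A \<rho> (\<sigma> * x, \<phi> x) v \<and> snd v \<ge> 1/2"
      using extreme0[OF x zero(1) _ top] up(1) by simp
    show "\<exists>v. prox_normal A \<rho> (\<sigma> * x, \<psi> x) v \<and> - snd v \<ge> 1/2"
      using extreme0[OF x zero(2) _ bot] up(2) by simp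
  qed
  then show ?thesis by blast
qed

end

section \<open>The cases of type 2 and 3\<close>

lemma has_real_derivative_zero_quadratic:
  fixes f :: "real \<Rightarrow> real"
  assumes "r > 0" "f 0 = 0" "\<And>x. x \<in> S \<Longrightarrow> \<bar>x\<bar> < r \<Longrightarrow> \<bar>f x\<bar> \<le> K * x\<^sup>2"
  shows "(f has_real_derivative 0) (at 0 within S)"
  unfolding has_field_derivative_iff
proof (rule Lim_null_comparison)
  show "\<forall>\<^sub>F y in at 0 within S. norm ((f y - f 0) / (y - 0)) \<le> K * \<bar>y\<bar>"
    unfolding eventually_at
  proof (intro exI[of _ r] conjI assms(1) ballI impI)
    fix y assume y: "y \<in> S" "y \<noteq> 0 \<and> dist y 0 < r"
    then have "\<bar>f y\<bar> \<le> K * (\<bar>y\<bar> * \<bar>y\<bar>)" using assms(3)[of y] by (simp add: power2_eq_square)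
    then show "norm ((f y - f 0) / (y - 0)) \<le> K * \<bar>y\<bar>"
      using y by (simp add: assms(2) divide_le_eq mult.assoc)
  qed
  have "((\<lambda>y. K * \<bar>y\<bar>) \<longlongrightarrow> K * \<bar>0\<bar>) (at 0 within S)" by (intro tendsto_intros)
  then show "((\<lambda>y. K * \<bar>y\<bar>) \<longlongrightarrow> 0) (at 0 within S)" by simp
qed

lemma semiconcave_on_subset:
  assumes "semiconcave_on S f" "T \<subseteq> S" "convex T"
  shows "semiconcave_on T f"
  using assms unfolding semiconcave_on_def concave_on_def
  by (meson continuous_on_subset convex_on_subset)

context prox_regular_plane
begin

text \<open>\<open>tangent_near\<close> with a horizontal approximant: the error bounds the whole
  second coordinate.\<close>

lemma tangent_quadratic:
  assumes "tangent_dirs A \<subseteq> {(1, 0), (-1, 0)}" "y \<in> A" "norm y < \<rho>"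
  shows "\<bar>snd y\<bar> \<le> 1 / \<rho> * (norm y)\<^sup>2"
proof (cases "y = 0")
  case False
  then obtain u c where u: "u \<in> tangent_dirs A" "norm (y - c *\<^sub>R u) \<le> (norm y)\<^sup>2 / \<rho>"
    using tangent_near assms(2,3) by metis
  have "snd u = 0" using u(1) assms(1) by auto
  then have "\<bar>snd y\<bar> \<le> norm (y - c *\<^sub>R u)"
    using norm_Pair_bounds(2)[where b = "snd (y - c *\<^sub>R u)" and a = "fst (y - c *\<^sub>R u)"]
    unfolding prod.collapse by simp
  then show ?thesis using u(2) by simp
qed simp

lemma strip_bounds:
  assumes "x \<in> {0..<\<rho>/4}" "\<bar>f\<bar> \<le> 2 * (1/\<rho>) * x\<^sup>2"
  shows "\<bar>f\<bar> \<le> \<rho> * (1/2) / 2"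
proof -
  have "x\<^sup>2 \<le> (\<rho>/4)\<^sup>2" using assms(1) by (intro power_mono) auto
  then have "2 * (1/\<rho>) * x\<^sup>2 \<le> 2 * (1/\<rho>) * (\<rho>/4)\<^sup>2" using rho_pos by (intro mult_left_mono) auto
  also have "\<dots> = \<rho>/8" using rho_pos by (simp add: power2_eq_square)
  finally show ?thesis using assms(2) rho_pos by linarith
qed

text \<open>\<open>graph_regular\<close> with \<delta> = 1/2, for \<phi> with sign 1 and for the
  negative of \<psi> with sign -1. Over abscissae below \<open>\<rho>/4\<close> the quadratic bound
  is at most \<open>\<rho>/8\<close>, within the size allowed there.\<close>

lemma strip_regular:
  assumes I: "convex I" "I \<subseteq> {-(\<rho>/4)<..<\<rho>/4}"
    and A: "\<And>x. x \<in> I \<Longrightarrow> (x, \<phi> x) \<in> A" "\<And>x. x \<in> I \<Longrightarrow> (x, \<psi> x) \<in> A"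
    and bd: "\<And>x. x \<in> I \<Longrightarrow> \<bar>\<phi> x\<bar> \<le> 2 * (1/\<rho>) * x\<^sup>2" "\<And>x. x \<in> I \<Longrightarrow> \<bar>\<psi> x\<bar> \<le> 2 * (1/\<rho>) * x\<^sup>2"
    and nrm: "\<And>x. x \<in> I \<Longrightarrow> \<exists>v. prox_normal A \<rho> (x, \<phi> x) v \<and> snd v \<ge> 1/2"
      "\<And>x. x \<in> I \<Longrightarrow> \<exists>v. prox_normal A \<rho> (x, \<psi> x) v \<and> - snd v \<ge> 1/2"
  shows "\<exists>L. L-lipschitz_on I \<phi>" "semiconcave_on I \<phi>" "\<exists>L. L-lipschitz_on I \<psi>" "semiconvex_on I \<psi>"
proof -
  have x: "\<bar>x\<bar> \<le> \<rho>/2" "\<bar>\<phi> x\<bar> \<le> \<rho> * (1/2) / 2" "\<bar>\<psi> x\<bar> \<le> \<rho> * (1/2) / 2" if "x \<in> I" for x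
  proof -
    have "x \<in> {-(\<rho>/4)<..<\<rho>/4}" using that I(2) by blast
    then have "\<bar>x\<bar> < \<rho>/4" unfolding abs_less_iff by auto
    then show "\<bar>x\<bar> \<le> \<rho>/2" "\<bar>\<phi> x\<bar> \<le> \<rho> * (1/2) / 2" "\<bar>\<psi> x\<bar> \<le> \<rho> * (1/2) / 2"
      using strip_bounds[of "\<bar>x\<bar>"] bd[OF that] rho_pos by simp_all
  qed
  show "\<exists>L. L-lipschitz_on I \<phi>" "semiconcave_on I \<phi>"
    by (rule graph_regular[of 1 "1/2" I \<phi>]; use I(1) x A nrm in force)+
  have "\<exists>L. L-lipschitz_on I (\<lambda>x. - \<psi> x)" "semiconcave_on I (\<lambda>x. - \<psi> x)"
    by (rule graph_regular[of "-1" "1/2" I "\<lambda>x. - \<psi> x"]; use I(1) x A nrm in force)+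
  then show "\<exists>L. L-lipschitz_on I \<psi>" "semiconvex_on I \<psi>"
    by (simp_all add: semiconvex_on_def)
qed

lemma T3_case:
  assumes "tangent_dirs A = {(1, 0)}"
  shows "\<exists>r>0. T3_set r (A \<inter> ball 0 r)"
proof -
  have quad: "\<bar>snd y\<bar> \<le> 1 / \<rho> * (norm y)\<^sup>2" if "y \<in> A" "norm y < \<rho>" for y
    using tangent_quadratic[OF _ that] assms by simp
  \<comment> \<open>A point behind the vertical axis is at least \<open>norm y\<close> away from the
    ray along \<open>(1, 0)\<close>, contrary to the smaller bound of
    \<open>tangent_near\<close>.\<close>
  have pos: "fst y \<ge> 0" if y: "y \<in> A" "norm y < \<rho>" for y
  proof (rule ccontr)
    assume neg: "\<not> fst y \<ge> 0"
    then have "y \<noteq> 0" by auto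
    then obtain u c where u: "u \<in> tangent_dirs A" "c \<ge> 0" "norm (y - c *\<^sub>R u) \<le> (norm y)\<^sup>2 / \<rho>"
      using tangent_near y by metis
    have "u = (1, 0)" using u(1) assms by simp
    obtain y1 y2 where yy: "y = (y1, y2)" by (cases y)
    have "\<bar>y1\<bar> \<le> \<bar>y1 - c\<bar>" using neg u(2) by (simp add: yy)
    then have "y1\<^sup>2 \<le> (y1 - c)\<^sup>2" by (simp add: abs_le_square_iff)
    then have "norm y \<le> norm (y - c *\<^sub>R u)" by (simp add: yy \<open>u = (1, 0)\<close> norm_Pair)
    then have "norm y \<le> (norm y)\<^sup>2 / \<rho>" using u(3) by linarith
    then have "norm y * \<rho> \<le> norm y * norm y" using rho_pos by (simp add: le_divide_eq power2_eq_square)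
    then show False using y(2) \<open>y \<noteq> 0\<close> by simp
  qed
  have C: "1 / \<rho> > 0" and tan: "(1, 0) \<in> tangent_dirs A" using rho_pos assms by auto
  obtain r0 \<psi> \<phi> where H: "side_strip 1 (2 * (1/\<rho>)) r0 \<psi> \<phi>"
    using side_strip_exists[OF _ C quad tan] by blast
  then have r0: "r0 > 0" by (simp add: side_strip_def)
  define r where "r = min r0 (\<rho>/4)"
  have r: "r > 0" "r \<le> r0" "r \<le> \<rho>/4" using r0 rho_pos by (auto simp: r_def min_def)
  have side: "\<psi> x \<le> \<phi> x \<and> (x, \<phi> x) \<in> A \<and> (x, \<psi> x) \<in> A \<and> \<bar>\<phi> x\<bar> \<le> 2 * (1/\<rho>) * x\<^sup>2 \<and>
      \<bar>\<psi> x\<bar> \<le> 2 * (1/\<rho>) * x\<^sup>2 \<and> (\<forall>t. norm (x, t) < r \<longrightarrow> ((x, t) \<in> A \<longleftrightarrow> \<psi> x \<le> t \<and> t \<le> \<phi> x)) \<and>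
      (\<exists>v. prox_normal A \<rho> (x, \<phi> x) v \<and> snd v \<ge> 1/2) \<and>
      (\<exists>v. prox_normal A \<rho> (x, \<psi> x) v \<and> - snd v \<ge> 1/2)" if x: "x \<in> {0..<r}" for x
  proof -
    have "x \<in> {0..<r0}" using x r by auto
    then show ?thesis using H r(2) unfolding side_strip_def mult_1 by (meson less_le_trans)
  qed
  have sub: "{0..<r} \<subseteq> {-(\<rho>/4)<..<\<rho>/4}" using r rho_pos by auto
  have reg: "\<exists>L. L-lipschitz_on {0..<r} \<phi>" "semiconcave_on {0..<r} \<phi>"
      "\<exists>L. L-lipschitz_on {0..<r} \<psi>" "semiconvex_on {0..<r} \<psi>"
    by (rule strip_regular[OF convex_real_interval(7) sub, where \<phi> = \<phi> and \<psi> = \<psi>];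
        drule side; elim conjE; assumption)+
  have "T3_set r (A \<inter> ball 0 r)"
    unfolding T3_set_def
  proof (rule exI[of _ \<phi>], rule exI[of _ \<psi>], intro conjI reg)
    show "\<forall>x\<in>{0..<r}. \<psi> x \<le> \<phi> x" using side by blast
    show "semiconcave_on {0<..<r} \<phi>" "semiconvex_on {0<..<r} \<psi>"
      using reg(2,4) unfolding semiconvex_on_def by (auto intro: semiconcave_on_subset)
    show z: "\<phi> 0 = 0" "\<psi> 0 = 0" using side[of 0] r(1) by auto
    show "(\<phi> has_real_derivative 0) (at_right 0)" "(\<psi> has_real_derivative 0) (at_right 0)"
      by (rule has_real_derivative_zero_quadratic[OF r(1), where K = "2 * (1/\<rho>)"]; use z side in force)+
    have "(x, t) \<in> A \<inter> ball 0 r \<longleftrightarrow> (x, t) \<in> ball 0 r \<inter> hypo {0..<r} \<phi> \<inter> epi {0..<r} \<psi>" for x t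
    proof (cases "norm (x, t) < r")
      case True
      then have x: "\<bar>x\<bar> < r" using norm_Pair_bounds(1)[where a=x and b=t] by simp
      show ?thesis
      proof (cases "x \<ge> 0")
        case True
        then show ?thesis using side[of x] x \<open>norm (x, t) < r\<close> by (auto simp: hypo_def epi_def)
      next
        case False
        then have "(x, t) \<notin> A" using pos[of "(x, t)"] True r rho_pos by auto
        then show ?thesis using False by (simp add: hypo_def)
      qed
    qed simp
    then show "A \<inter> ball 0 r = ball 0 r \<inter> hypo {0..<r} \<phi> \<inter> epi {0..<r} \<psi>"
      unfolding set_eq_iff split_paired_All by blast
  qed
  then show ?thesis using r(1) by blast
qed

text \<open>The two half-strips are glued before regularity is derived: \<open>graph_regular\<close>
  asks for one normal at each point, 0 included, so no one-sided estimates have to be matched at the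
  junction.\<close>

lemma T2_case:
  assumes "tangent_dirs A = {(1, 0), (-1, 0)}"
  shows "\<exists>r>0. T2_set r (A \<inter> ball 0 r)"
proof -
  have quad: "\<bar>snd y\<bar> \<le> 1 / \<rho> * (norm y)\<^sup>2" if "y \<in> A" "norm y < \<rho>" for y
    using tangent_quadratic[OF _ that] assms by simp
  have C: "1 / \<rho> > 0" and tan: "(1, 0) \<in> tangent_dirs A" and tan': "(-1, 0) \<in> tangent_dirs A"
    using rho_pos assms by auto
  obtain r1 \<psi>1 \<phi>1 where H: "side_strip 1 (2 * (1/\<rho>)) r1 \<psi>1 \<phi>1"
    using side_strip_exists[OF _ C quad tan] by blast
  obtain r2 \<psi>2 \<phi>2 where K: "side_strip (-1) (2 * (1/\<rho>)) r2 \<psi>2 \<phi>2"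
    using side_strip_exists[OF _ C quad tan'] by blast
  have pos: "r1 > 0" "r2 > 0" using H K by (auto simp: side_strip_def)
  define r where "r = min (min r1 r2) (\<rho>/4)"
  have r: "r > 0" "r \<le> r1" "r \<le> r2" "r \<le> \<rho>/4" using pos rho_pos by (auto simp: r_def min_def)
  define \<phi> where "\<phi> x = (if x \<ge> 0 then \<phi>1 x else \<phi>2 (- x))" for x
  define \<psi> where "\<psi> x = (if x \<ge> 0 then \<psi>1 x else \<psi>2 (- x))" for x
  have side: "\<psi> x \<le> \<phi> x \<and> (x, \<phi> x) \<in> A \<and> (x, \<psi> x) \<in> A \<and> \<bar>\<phi> x\<bar> \<le> 2 * (1/\<rho>) * x\<^sup>2 \<and>
      \<bar>\<psi> x\<bar> \<le> 2 * (1/\<rho>) * x\<^sup>2 \<and> (\<forall>t. norm (x, t) < r \<longrightarrow> ((x, t) \<in> A \<longleftrightarrow> \<psi> x \<le> t \<and> t \<le> \<phi> x)) \<and>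
      (\<exists>v. prox_normal A \<rho> (x, \<phi> x) v \<and> snd v \<ge> 1/2) \<and>
      (\<exists>v. prox_normal A \<rho> (x, \<psi> x) v \<and> - snd v \<ge> 1/2)" if x: "x \<in> {-r<..<r}" for x
  proof (cases "x \<ge> 0")
    case True
    then have x1: "x \<in> {0..<r1}" using x r by auto
    have eq: "\<phi> x = \<phi>1 x" "\<psi> x = \<psi>1 x" using True by (auto simp: \<phi>_def \<psi>_def)
    show ?thesis unfolding eq using H x1 r(2) unfolding side_strip_def mult_1 by (meson less_le_trans)
  next
    case False
    then have x2: "- x \<in> {0..<r2}" using x r by auto
    have eq: "\<phi> x = \<phi>2 (- x)" "\<psi> x = \<psi>2 (- x)" using False by (auto simp: \<phi>_def \<psi>_def)
    show ?thesis
      unfolding eq using bspec[OF conjunct2[OF K[unfolded side_strip_def]] x2] r(3)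
      unfolding mult_minus1 minus_minus power2_minus by (meson less_le_trans)
  qed
  have sub: "{-r<..<r} \<subseteq> {-(\<rho>/4)<..<\<rho>/4}" using r by auto
  have reg: "\<exists>L. L-lipschitz_on {-r<..<r} \<phi>" "semiconcave_on {-r<..<r} \<phi>"
      "\<exists>L. L-lipschitz_on {-r<..<r} \<psi>" "semiconvex_on {-r<..<r} \<psi>"
    by (rule strip_regular[OF convex_real_interval(8) sub, where \<phi> = \<phi> and \<psi> = \<psi>];
        drule side; elim conjE; assumption)+
  have "T2_set r (A \<inter> ball 0 r)"
    unfolding T2_set_def
  proof (rule exI[of _ \<phi>], rule exI[of _ \<psi>], intro conjI reg)
    show "\<forall>x\<in>{-r<..<r}. \<psi> x \<le> \<phi> x" using side by blast
    show z: "\<phi> 0 = 0" "\<psi> 0 = 0" using side[of 0] r(1) by auto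
    have "x \<in> {-r<..<r}" if "\<bar>x\<bar> < r" for x using that by (auto simp: abs_less_iff)
    then show "(\<phi> has_real_derivative 0) (at 0)" "(\<psi> has_real_derivative 0) (at 0)"
      using side z by (auto intro!: has_real_derivative_zero_quadratic[OF r(1), where K = "2 * (1/\<rho>)"]
          simp del: greaterThanLessThan_iff)
    have "(x, t) \<in> A \<inter> ball 0 r \<longleftrightarrow> (x, t) \<in> ball 0 r \<inter> hypo {-r<..<r} \<phi> \<inter> epi {-r<..<r} \<psi>" for x t
    proof (cases "norm (x, t) < r")
      case True
      then have "\<bar>x\<bar> < r" using norm_Pair_bounds(1)[where a=x and b=t] by simp
      then have x: "x \<in> {-r<..<r}" by (auto simp: abs_less_iff)
      then show ?thesis using side[OF x] True by (auto simp: hypo_def epi_def)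
    qed simp
    then show "A \<inter> ball 0 r = ball 0 r \<inter> hypo {-r<..<r} \<phi> \<inter> epi {-r<..<r} \<psi>"
      unfolding set_eq_iff split_paired_All by blast
  qed
  then show ?thesis using r(1) by blast
qed

end

section \<open>From positive reach to the types\<close>

lemma prox_regular_Unp:
  assumes "0 \<in> A" "R > 0" "ball 0 R \<subseteq> Unp A"
  shows "prox_regular A (R/8)"
  using assms foot_exists_Unp[OF assms(1,3)] by unfold_locales auto

section \<open>Invariance under rigid motions\<close>

lemma isometry_Unp:
  assumes "isometry G" "z \<in> Unp A"
  shows "G z \<in> Unp (G ` A)"
proof -
  have iso: "dist (G x) (G y) = dist x y" for x y using assms(1) by (simp add: isometry_def)
  have inf: "infdist (G z) (G ` A) = infdist z A"
    by (simp add: infdist_def image_image iso)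
  obtain x where x: "x \<in> A" "dist z x = infdist z A"
      "\<And>y. y \<in> A \<Longrightarrow> dist z y = infdist z A \<Longrightarrow> y = x"
    using assms(2) unfolding Unp_def by blast
  show ?thesis
    unfolding Unp_def mem_Collect_eq
  proof (intro ex1I[of _ "G x"])
    fix b assume "b \<in> G ` A \<and> dist (G z) b = infdist (G z) (G ` A)"
    then obtain y where "b = G y" "y \<in> A" "dist z y = infdist z A"
      using inf by (auto simp: iso)
    then show "b = G x" using x(3) by simp
  qed (use inf x(1,2) iso in simp)
qed

context
  fixes f :: "'a::euclidean_space \<Rightarrow> 'a"
  assumes f: "orthogonal_transformation f"
begin

lemma orthogonal_centred_isometry: "isometry (\<lambda>x. f (x - a))"
  using f by (simp add: isometry_def orthogonal_transformation_isometry dist_norm)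

lemma orthogonal_centred_ball:
  "(\<lambda>x. f (x - a)) ` (A \<inter> ball a r) = f ` (\<lambda>x. x - a) ` A \<inter> ball 0 r"
  by (auto simp: orthogonal_transformation_norm[OF f] dist_norm norm_minus_commute)

lemma prox_regular_centred:
  assumes "a \<in> A" "R > 0" "ball a R \<subseteq> Unp A"
  shows "prox_regular (f ` (\<lambda>x. x - a) ` A) (R/8)"
proof (rule prox_regular_Unp[OF _ assms(2)])
  have f0: "f 0 = 0" using f by (simp add: orthogonal_transformation_isometry)
  have im: "f ` (\<lambda>x. x - a) ` A = (\<lambda>x. f (x - a)) ` A" by (simp add: image_image)
  show "0 \<in> f ` (\<lambda>x. x - a) ` A" unfolding im using assms(1) f0 by (auto intro: image_eqI[of _ _ a])
  show "ball 0 R \<subseteq> Unp (f ` (\<lambda>x. x - a) ` A)"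
  proof
    fix w :: 'a assume w: "w \<in> ball 0 R"
    obtain u where u: "w = f u" using orthogonal_transformation_surj[OF f] by blast
    have "norm u < R" using w by (simp add: u orthogonal_transformation_norm[OF f])
    then have "a + u \<in> Unp A" using assms(3) by (auto simp: dist_norm)
    from isometry_Unp[OF orthogonal_centred_isometry this, of a]
    show "w \<in> Unp (f ` (\<lambda>x. x - a) ` A)" by (simp add: im u)
  qed
qed

lemma not_interior_centred:
  assumes "a \<notin> interior A"
  shows "0 \<notin> interior (f ` (\<lambda>x. x - a) ` A)"
proof
  assume "0 \<in> interior (f ` (\<lambda>x. x - a) ` A)"
  then obtain e where e: "e > 0" "ball 0 e \<subseteq> f ` (\<lambda>x. x - a) ` A" by (auto simp: mem_interior)
  have "ball a e \<subseteq> A"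
  proof
    fix x assume "x \<in> ball a e"
    then have "f (x - a) \<in> ball 0 e"
      by (simp add: orthogonal_transformation_norm[OF f] dist_norm norm_minus_commute)
    then obtain y where y: "y \<in> A" "f (x - a) = f (y - a)" using e(2) by blast
    have "x - a = y - a" by (rule injD[OF orthogonal_transformation_inj[OF f] y(2)])
    then show "x \<in> A" using y(1) by simp
  qed
  then show False using assms e(1) by (auto simp: mem_interior)
qed

lemma tangent_dirs_orthogonal_subset: "f ` tangent_dirs A \<subseteq> tangent_dirs (f ` A)"
proof (safe)
  fix u assume u: "u \<in> tangent_dirs A"
  have lin: "linear f" using f by (rule orthogonal_transformation_linear)
  note n = orthogonal_transformation_norm[OF f]
  have "\<exists>y\<in>f ` A. y \<noteq> 0 \<and> norm y < \<epsilon> \<and> norm (y - norm y *\<^sub>R f u) \<le> \<epsilon> * norm y" if e: "\<epsilon> > 0" for \<epsilon>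
  proof -
    obtain y where y: "y \<in> A" "y \<noteq> 0" "norm y < \<epsilon>" "norm (y - norm y *\<^sub>R u) \<le> \<epsilon> * norm y"
      using u e unfolding tangent_dirs_def by blast
    have "f y - norm (f y) *\<^sub>R f u = f (y - norm y *\<^sub>R u)"
      by (simp add: n linear_diff[OF lin] linear_scale[OF lin])
    then have "norm (f y - norm (f y) *\<^sub>R f u) \<le> \<epsilon> * norm (f y)" using y(4) by (simp add: n)
    moreover have "norm (f y) < \<epsilon>" "f y \<noteq> 0" using y n[of y] by auto
    ultimately show ?thesis using y(1) by blast
  qed
  moreover have "norm (f u) = 1" using u by (simp add: n tangent_dirs_def)
  ultimately show "f u \<in> tangent_dirs (f ` A)" by (simp add: tangent_dirs_def)
qed

end

lemma tangent_dirs_orthogonal: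
  fixes f :: "'a::euclidean_space \<Rightarrow> 'a"
  assumes f: "orthogonal_transformation f"
  shows "tangent_dirs (f ` A) = f ` tangent_dirs A"
proof
  have g: "orthogonal_transformation (inv f)" using f by (rule orthogonal_transformation_inv)
  have "inj f" "surj f"
    using orthogonal_transformation_inj[OF f] orthogonal_transformation_surj[OF f] by auto
  then have "inv f ` f ` A = A" "f ` inv f ` tangent_dirs (f ` A) = tangent_dirs (f ` A)"
    by (simp_all add: image_image surj_f_inv_f)
  then show "tangent_dirs (f ` A) \<subseteq> f ` tangent_dirs A"
    using tangent_dirs_orthogonal_subset[OF g, of "f ` A"] by (metis image_mono)
qed (rule tangent_dirs_orthogonal_subset[OF f])

lemma of_type_TI:
  assumes "orthogonal_transformation f" "a \<in> A" "\<exists>r>0. T_set i r (f ` (\<lambda>x. x - a) ` A \<inter> ball 0 r)"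
  shows "of_type_T i A a"
proof -
  have "f (a - a) = 0" using assms(1) by (simp add: orthogonal_transformation_isometry)
  then show ?thesis
    using assms(2,3) orthogonal_centred_isometry[OF assms(1), of a]
    unfolding of_type_T_def orthogonal_centred_ball[OF assms(1), symmetric] by blast
qed

lemma rotation_orthogonal:
  fixes c s :: real
  assumes "c\<^sup>2 + s\<^sup>2 = 1"
  shows "orthogonal_transformation (\<lambda>(x, y). (c * x - s * y, s * x + c * y))"
  unfolding orthogonal_transformation
proof (intro conjI allI)
  show "linear (\<lambda>(x, y). (c * x - s * y, s * x + c * y))"
    by (rule linearI) (auto simp: algebra_simps)
  fix v :: "real \<times> real"
  obtain x y where v: "v = (x, y)" by (cases v)
  have "(c * x - s * y)\<^sup>2 + (s * x + c * y)\<^sup>2 = (c\<^sup>2 + s\<^sup>2) * (x\<^sup>2 + y\<^sup>2)" by algebra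
  then show "norm ((\<lambda>(x, y). (c * x - s * y, s * x + c * y)) v) = norm v"
    using assms by (simp add: v norm_Pair)
qed

lemma rotation_exists_plane:
  fixes u w :: "real \<times> real"
  assumes "norm u = 1" "norm w = 1"
  shows "\<exists>f. orthogonal_transformation f \<and> f u = w"
proof -
  obtain u1 u2 w1 w2 where uw: "u = (u1, u2)" "w = (w1, w2)" by (cases u, cases w)
  have 1: "u1\<^sup>2 + u2\<^sup>2 = 1" "w1\<^sup>2 + w2\<^sup>2 = 1" using assms by (auto simp: uw norm_Pair)
  \<comment> \<open>Cosine and sine of the angle from \<open>u\<close> to \<open>w\<close>;
    Lagrange's identity gives \<open>c\<^sup>2 + s\<^sup>2 = 1\<close>.\<close>
  define c where "c = u1 * w1 + u2 * w2"
  define s where "s = u1 * w2 - u2 * w1"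
  have "c\<^sup>2 + s\<^sup>2 = (u1\<^sup>2 + u2\<^sup>2) * (w1\<^sup>2 + w2\<^sup>2)" unfolding c_def s_def by algebra
  then have cs: "c\<^sup>2 + s\<^sup>2 = 1" using 1 by simp
  have "c * u1 - s * u2 = (u1\<^sup>2 + u2\<^sup>2) * w1" "s * u1 + c * u2 = (u1\<^sup>2 + u2\<^sup>2) * w2"
    unfolding c_def s_def by algebra+
  then show ?thesis using rotation_orthogonal[OF cs] 1 by (intro exI[of _ "\<lambda>(x, y). (c * x - s * y, s * x + c * y)"]) (simp add: uw)
qed

context prox_regular_plane
begin

text \<open>The sum condition makes \<open>u\<close> and \<open>w\<close> mirror images in the
  vertical axis. A normal almost nonpositive against both has \<open>\<bar>v1\<bar>\<close> bounded
  by a multiple of \<open>v2\<close> up to a small error, so being a unit vector it must point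
  upwards.\<close>

lemma T1_case_tangents:
  assumes "u \<in> tangent_dirs A" "w \<in> tangent_dirs A" "u \<noteq> w"
    and k: "k > 0" "u + w = (0, - k)" and "0 \<notin> interior A"
  shows "\<exists>r>0. T1_set r (A \<inter> ball 0 r)"
proof -
  obtain u1 u2 w1 w2 where uw: "u = (u1, u2)" "w = (w1, w2)" by (cases u, cases w)
  have n: "u1\<^sup>2 + u2\<^sup>2 = 1" "w1\<^sup>2 + w2\<^sup>2 = 1"
    using assms(1,2) by (auto simp: uw norm_Pair tangent_dirs_def)
  have w1: "w1 = - u1" and sm: "u2 + w2 = - k" using k(2) by (auto simp: uw)
  have "u2\<^sup>2 = w2\<^sup>2" using n w1 by simp
  then have w2: "w2 = u2" using sm k(1) by (auto simp: power2_eq_iff)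
  then have u2: "u2 = - (k/2)" using sm by simp
  have "u1 \<noteq> 0" using assms(3) w1 w2 by (auto simp: uw)
  define l where "l = 2 * \<bar>u1\<bar>"
  have l: "l > 0" using \<open>u1 \<noteq> 0\<close> by (simp add: l_def)
  \<comment> \<open>\<open>k/4\<close> excludes \<open>v2\<close> below -1/2; if also
    \<open>v2\<close> < 1/2, then \<open>\<bar>v1\<bar>\<close> is at least 1/2, and
    \<open>l/8\<close> leaves \<open>l/4 \<le> k * v2\<close>, whence the value of \<delta>.\<close>
  define \<epsilon> where "\<epsilon> = min (k/4) (l/8)"
  have \<epsilon>: "\<epsilon> > 0" "\<epsilon> \<le> k/4" "\<epsilon> \<le> l/8" using k(1) l by (auto simp: \<epsilon>_def min_def)
  define \<delta> where "\<delta> = min (1/2) (l / (4 * k))"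
  have \<delta>: "\<delta> > 0" "\<delta> \<le> 1/2" "\<delta> \<le> l / (4 * k)" using k(1) l by (auto simp: \<delta>_def)
  obtain s1 where s1: "s1 > 0" "\<And>x v. norm x < s1 \<Longrightarrow> prox_normal A \<rho> x v \<Longrightarrow> v \<bullet> u \<le> \<epsilon>"
    using tangent_normal_bound[OF assms(1) rho_pos \<epsilon>(1)] by blast
  obtain s2 where s2: "s2 > 0" "\<And>x v. norm x < s2 \<Longrightarrow> prox_normal A \<rho> x v \<Longrightarrow> v \<bullet> w \<le> \<epsilon>"
    using tangent_normal_bound[OF assms(2) rho_pos \<epsilon>(1)] by blast
  show ?thesis
  proof (rule T1_case[OF \<delta>(1) _ _ assms(6)])
    show "min s1 s2 > 0" using s1 s2 by simp
    fix x v assume x: "norm x < min s1 s2" and v: "prox_normal A \<rho> x v"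
    obtain v1 v2 where vv: "v = (v1, v2)" by (cases v)
    have "v1 * u1 + v2 * u2 \<le> \<epsilon>" "v1 * w1 + v2 * w2 \<le> \<epsilon>"
      using s1(2)[OF _ v] s2(2)[OF _ v] x by (auto simp: vv uw)
    then have i: "v1 * u1 - k * v2 / 2 \<le> \<epsilon>" "- (v1 * u1) - k * v2 / 2 \<le> \<epsilon>"
    proof -
      have "v2 * u2 = - (k * v2 / 2)" "v1 * w1 = - (v1 * u1)" "v2 * w2 = v2 * u2"
        unfolding u2 w1 w2 by simp_all
      then show "v1 * u1 - k * v2 / 2 \<le> \<epsilon>" "- (v1 * u1) - k * v2 / 2 \<le> \<epsilon>"
        using \<open>v1 * u1 + v2 * u2 \<le> \<epsilon>\<close> \<open>v1 * w1 + v2 * w2 \<le> \<epsilon>\<close> by linarith+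
    qed
    have abs: "l * \<bar>v1\<bar> / 2 = \<bar>v1 * u1\<bar>" by (simp add: l_def abs_mult)
    have lo: "- (k * v2) \<le> 2 * \<epsilon>" and hi: "l * \<bar>v1\<bar> \<le> 2 * \<epsilon> + k * v2" using i abs by linarith+
    show "snd v \<ge> \<delta>"
    proof (cases "v2 \<ge> 1/2")
      case True
      then show ?thesis using \<delta> by (simp add: vv)
    next
      case False
      have "k * (- v2) \<le> k * (1/2)" using lo \<epsilon>(2) by simp
      then have "- v2 \<le> 1/2" using k(1) by (simp only: mult_le_cancel_left_pos)
      then have "\<bar>v2\<bar> \<le> 1/2" using False by simp
      moreover have "norm (v1, v2) = 1" using v by (simp add: prox_normal_def vv)
      ultimately have "\<bar>v1\<bar> \<ge> 1/2" using norm_Pair_bounds(3)[of v1 v2] by linarith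
      then have "l * (1/2) \<le> l * \<bar>v1\<bar>" using l by (intro mult_left_mono) auto
      then have "l/4 \<le> k * v2" using hi \<epsilon>(3) by linarith
      then have "l / (4 * k) \<le> v2" using k(1) by (simp add: field_simps)
      then show ?thesis using \<delta>(3) by (simp add: vv)
    qed
  qed
qed

end

lemma positive_reach_types:
  fixes A :: "(real \<times> real) set"
  assumes "a \<in> A" "R > 0" "ball a R \<subseteq> Unp A" "a \<notin> interior A" "\<not> a isolated_in A"
  shows "\<exists>i\<in>{1, 2, 3}. of_type_T i A a"
proof -
  define B where "B = (\<lambda>x. x - a) ` A"
  have reg: "prox_regular_plane (f ` B) (R/8)" if "orthogonal_transformation f" for f
    unfolding B_def prox_regular_plane_def by (rule prox_regular_centred[OF that assms(1-3)])
  have "0 \<in> B" using assms(1) by (auto simp: B_def)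
  moreover have "\<not> 0 isolated_in B"
  proof
    assume "0 isolated_in B"
    then obtain e where "e > 0" "\<forall>y\<in>B. dist 0 y < e \<longrightarrow> y = 0"
      by (auto simp: isolated_in_dist_Ex_iff)
    then have "a isolated_in A"
      using assms(1) unfolding isolated_in_dist_Ex_iff B_def
      by (auto simp: dist_norm norm_minus_commute intro!: exI[of _ e])
    then show False using assms(5) by blast
  qed
  ultimately obtain u where u: "u \<in> tangent_dirs B" using tangent_dirs_nonempty by blast
  then have nu: "norm u = 1" by (simp add: tangent_dirs_def)
  show ?thesis
  proof (cases "\<exists>w\<in>tangent_dirs B. w \<noteq> u \<and> w \<noteq> - u")
    case True
    then obtain w where w: "w \<in> tangent_dirs B" "w \<noteq> u" "w \<noteq> - u" by blast
    define k where "k = norm (u + w)"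
    have "u + w \<noteq> 0" using w(3) by (metis add_eq_0_iff)
    then have k: "k > 0" by (simp add: k_def)
    \<comment> \<open>The reversed bisector of \<open>u\<close> and \<open>w\<close> is to be
      rotated to the upward direction.\<close>
    have ne: "norm ((- 1 / k) *\<^sub>R (u + w)) = 1" using k unfolding norm_scaleR k_def[symmetric] by simp
    have n1: "norm (0::real, 1::real) = 1" by (simp add: norm_Pair)
    obtain f :: "real \<times> real \<Rightarrow> real \<times> real"
      where f: "orthogonal_transformation f" "f ((- 1 / k) *\<^sub>R (u + w)) = (0, 1)"
      using rotation_exists_plane[OF ne n1] by blast
    interpret prox_regular_plane "f ` B" "R/8" by (rule reg[OF f(1)])
    have lin: "linear f" using f(1) by (rule orthogonal_transformation_linear)
    have e: "(- 1 / k) *\<^sub>R (f u + f w) = (0, 1)"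
      using f(2) unfolding linear_scale[OF lin] linear_add[OF lin] .
    have "f u + f w = (- k) *\<^sub>R ((- 1 / k) *\<^sub>R (f u + f w))" using k by simp
    also have "\<dots> = (0, - k)" unfolding e by simp
    finally have s: "f u + f w = (0, - k)" .
    have "f u \<noteq> f w" using w(2) injD[OF orthogonal_transformation_inj[OF f(1)]] by metis
    moreover have "f u \<in> tangent_dirs (f ` B)" "f w \<in> tangent_dirs (f ` B)"
      using u w tangent_dirs_orthogonal[OF f(1)] by auto
    moreover have "0 \<notin> interior (f ` B)"
      unfolding B_def by (rule not_interior_centred[OF f(1) assms(4)])
    ultimately have "\<exists>r>0. T1_set r (f ` B \<inter> ball 0 r)"
      using T1_case_tangents[OF _ _ _ k s] by blast
    then have "of_type_T 1 A a"
      by (intro of_type_TI[OF f(1) assms(1)]) (simp add: T_set_def B_def)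
    then show ?thesis by blast
  next
    case False
    have n1: "norm (1::real, 0::real) = 1" by (simp add: norm_Pair)
    obtain f :: "real \<times> real \<Rightarrow> real \<times> real" where f: "orthogonal_transformation f" "f u = (1, 0)"
      using rotation_exists_plane[OF nu n1] by blast
    interpret prox_regular_plane "f ` B" "R/8" by (rule reg[OF f(1)])
    have fm: "f (- u) = (- 1, 0)"
      using linear_neg[OF orthogonal_transformation_linear[OF f(1)], of u] f(2) by simp
    show ?thesis
    proof (cases "- u \<in> tangent_dirs B")
      case True
      then have "tangent_dirs B = {u, - u}" using False u by blast
      then have "tangent_dirs (f ` B) = {(1, 0), (- 1, 0)}"
        using f fm tangent_dirs_orthogonal[OF f(1)] by simp
      then have "of_type_T 2 A a"
        using T2_case by (intro of_type_TI[OF f(1) assms(1)]) (simp add: T_set_def B_def)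
      then show ?thesis by blast
    next
      case 2: False
      then have "tangent_dirs B = {u}" using False u by blast
      then have "tangent_dirs (f ` B) = {(1, 0)}"
        using f fm tangent_dirs_orthogonal[OF f(1)] by simp
      then have "of_type_T 3 A a"
        using T3_case by (intro of_type_TI[OF f(1) assms(1)]) (simp add: T_set_def B_def)
      then show ?thesis by blast
    qed
  qed
qed

section \<open>From the types to positive reach\<close>

text \<open>Convexity up to a defect that is linear in \<open>t\<close>, since only the limit at 0
  is taken, and quadratic in the length of the chord. The closure clause provides existence of
  nearest points.\<close>

definition almost_convex_at :: "'a::euclidean_space set \<Rightarrow> 'a \<Rightarrow> bool" where
  "almost_convex_at A a \<longleftrightarrow> (\<exists>r>0. \<exists>K\<ge>0.
     (\<forall>x\<in>A \<inter> ball a r. \<forall>y\<in>A \<inter> ball a r. \<forall>t\<in>{0<..<1}.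
        \<exists>q\<in>A. norm (q - (x + t *\<^sub>R (y - x))) \<le> K * t * (norm (y - x))\<^sup>2) \<and>
     closure A \<inter> ball a r \<subseteq> A)"

text \<open>First variation of the distance to \<open>z\<close> at \<open>x\<close> towards
  \<open>y\<close>. Equal distances turn \<open>(norm n)\<^sup>2\<close> into
  \<open>2 * (m \<bullet> n)\<close>, which is the linear coefficient; minimality bounds it by the
  contribution of the defect.\<close>

lemma two_nearest_bound:
  fixes x y z :: "'a::real_inner"
  assumes K: "K \<ge> 0" and eq: "dist z x = d" "dist z y = d"
    and q: "\<And>t. t \<in> {0<..<1} \<Longrightarrow> \<exists>q. d \<le> dist z q \<and>
      norm (q - (x + t *\<^sub>R (y - x))) \<le> K * t * (norm (y - x))\<^sup>2"
  shows "(norm (y - x))\<^sup>2 \<le> 2 * d * K * (norm (y - x))\<^sup>2"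
proof -
  define m where "m = z - x"
  define n where "n = y - x"
  have d0: "d \<ge> 0" using eq(1) by auto
  have md: "(norm m)\<^sup>2 = d\<^sup>2" using eq(1) by (simp add: m_def dist_norm)
  have "(norm (m - n))\<^sup>2 = d\<^sup>2" using eq(2) by (simp add: m_def n_def dist_norm)
  moreover have "(norm (m - n))\<^sup>2 = (norm m)\<^sup>2 - 2 * (m \<bullet> n) + (norm n)\<^sup>2"
    unfolding power2_norm_eq_inner by (simp add: inner_diff inner_commute)
  ultimately have n2: "(norm n)\<^sup>2 = 2 * (m \<bullet> n)" using md by simp
  \<comment> \<open>Controls all terms of second order in \<open>t\<close>; they vanish after
    division by \<open>t\<close> in the limit.\<close>
  define L where "L = (norm n + K * (norm n)\<^sup>2)\<^sup>2"
  have bd: "2 * (m \<bullet> n) \<le> 2 * d * K * (norm n)\<^sup>2 + t * L" if t: "t \<in> {0<..<1}" for t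
  proof -
    obtain q where q: "d \<le> dist z q" "norm (q - (x + t *\<^sub>R n)) \<le> K * t * (norm n)\<^sup>2"
      using q[OF t] by (auto simp: n_def)
    define e where "e = q - (x + t *\<^sub>R n)"
    have t': "0 < t" using t by simp
    have zq: "z - q = m - (t *\<^sub>R n + e)" by (simp add: m_def e_def)
    have "norm (t *\<^sub>R n + e) \<le> t * norm n + K * t * (norm n)\<^sup>2"
      using norm_triangle_ineq[of "t *\<^sub>R n" e] q(2) t' by (simp add: e_def)
    also have "\<dots> = t * (norm n + K * (norm n)\<^sup>2)" by (simp add: algebra_simps)
    finally have "(norm (t *\<^sub>R n + e))\<^sup>2 \<le> t\<^sup>2 * L"
      unfolding L_def power_mult_distrib[symmetric] by (intro power_mono) auto
    moreover have "d\<^sup>2 \<le> (norm (z - q))\<^sup>2" using q(1) d0 by (intro power_mono) (auto simp: dist_norm)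
    moreover have "(norm (z - q))\<^sup>2 = d\<^sup>2 - 2 * (m \<bullet> (t *\<^sub>R n + e)) + (norm (t *\<^sub>R n + e))\<^sup>2"
      unfolding zq md[symmetric] power2_norm_eq_inner by (simp add: inner_diff inner_commute)
    ultimately have 1: "2 * (m \<bullet> (t *\<^sub>R n + e)) \<le> t\<^sup>2 * L" by linarith
    have "\<bar>m \<bullet> e\<bar> \<le> norm m * norm e" by (rule Cauchy_Schwarz_ineq2)
    also have "norm m = d" using eq(1) by (simp add: m_def dist_norm)
    also have "d * norm e \<le> d * (K * t * (norm n)\<^sup>2)" using q(2) d0 by (intro mult_left_mono) (auto simp: e_def)
    finally have "- (m \<bullet> e) \<le> d * (K * t * (norm n)\<^sup>2)" by linarith
    then have "2 * (t * (m \<bullet> n)) \<le> 2 * (d * (K * t * (norm n)\<^sup>2)) + t\<^sup>2 * L"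
      using 1 by (simp add: inner_add_right)
    then have "t * (2 * (m \<bullet> n)) \<le> t * (2 * d * K * (norm n)\<^sup>2 + t * L)"
      by (simp add: algebra_simps power2_eq_square)
    then show ?thesis using t' by simp
  qed
  have "2 * (m \<bullet> n) \<le> 2 * d * K * (norm n)\<^sup>2"
  proof (rule tendsto_le[OF trivial_limit_at_right_real[of 0]])
    have "((\<lambda>t. 2 * d * K * (norm n)\<^sup>2 + t * L) \<longlongrightarrow> 2 * d * K * (norm n)\<^sup>2 + 0 * L) (at_right 0)"
      by (intro tendsto_intros)
    then show "((\<lambda>t. 2 * d * K * (norm n)\<^sup>2 + t * L) \<longlongrightarrow> 2 * d * K * (norm n)\<^sup>2) (at_right 0)" by simp
    have "\<forall>\<^sub>F t in at_right (0::real). t \<in> {0<..<1}" by (rule eventually_at_right_real) simp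
    then show "\<forall>\<^sub>F t in at_right 0. 2 * (m \<bullet> n) \<le> 2 * d * K * (norm n)\<^sup>2 + t * L"
      by (rule eventually_mono) (rule bd)
  qed (rule tendsto_const)
  then show ?thesis using n2 unfolding n_def[symmetric] by linarith
qed

lemma reach_almost_convex:
  fixes A :: "'a::euclidean_space set"
  assumes "a \<in> A" "almost_convex_at A a"
  shows "\<exists>r>0. ball a r \<subseteq> Unp A"
proof -
  obtain r K where r: "r > 0" "K \<ge> 0"
    and qc: "\<And>x y t. x \<in> A \<inter> ball a r \<Longrightarrow> y \<in> A \<inter> ball a r \<Longrightarrow> t \<in> {0<..<1} \<Longrightarrow>
        \<exists>q\<in>A. norm (q - (x + t *\<^sub>R (y - x))) \<le> K * t * (norm (y - x))\<^sup>2"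
    and cl: "closure A \<inter> ball a r \<subseteq> A"
    using assms(2) unfolding almost_convex_at_def by metis
  \<comment> \<open>\<open>r/4\<close> keeps competing points within \<open>r/2\<close> of
    \<open>a\<close>, and the second bound gives \<open>2 * r' * K\<close> < 1, so that
    \<open>two_nearest_bound\<close> forces equality.\<close>
  define r' where "r' = min (r/4) (1 / (2 * K + 1))"
  have r': "r' > 0" "r' \<le> r/4" "2 * r' * K < 1"
  proof -
    show "r' > 0" using r by (simp add: r'_def add_nonneg_pos)
    have "r' \<le> 1 / (2 * K + 1)" by (simp add: r'_def)
    then have "r' * (2 * K + 1) \<le> 1" using r by (simp add: pos_le_divide_eq add_nonneg_pos)
    then show "2 * r' * K < 1" using \<open>r' > 0\<close> by (simp add: algebra_simps)
  qed (simp add: r'_def)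
  \<comment> \<open>A closed piece of \<open>A\<close> on which the distance is attained; points of
    \<open>A\<close> outside it are too far from \<open>z\<close> to compete with
    \<open>a\<close>.\<close>
  define B where "B = A \<inter> cball a (r/2)"
  have "closed B"
    unfolding closed_sequential_limits
  proof (intro allI impI, elim conjE)
    fix X l assume X: "\<forall>n. X n \<in> B" "X \<longlonglongrightarrow> l"
    have "\<forall>n. X n \<in> cball a (r/2)" using X(1) by (auto simp: B_def)
    then have "l \<in> cball a (r/2)" using closed_sequentially[OF closed_cball _ X(2)] by blast
    moreover have "l \<in> closure A" using X closure_sequential by (fastforce simp: B_def)
    ultimately show "l \<in> B" using cl r(1) by (auto simp: B_def)
  qed
  have aB: "a \<in> B" using assms(1) r by (simp add: B_def)
  have "ball a r' \<subseteq> Unp A"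
  proof
    fix z assume z: "z \<in> ball a r'"
    define d where "d = infdist z A"
    have d: "d \<ge> 0" "d < r'"
      using infdist_le[OF assms(1), of z] z by (auto simp: d_def infdist_nonneg dist_commute)
    have near: "dist a y < r/2" if "dist z y < r'" for y
      using dist_triangle[of a y z] that z r' by simp
    obtain x where x: "x \<in> B" "infdist z B = dist z x"
      using infdist_attains_inf[OF \<open>closed B\<close>, of z] aB by blast
    have "dist z x \<le> d"
      unfolding d_def
    proof (rule infdist_geI)
      fix y assume "y \<in> A"
      show "dist z x \<le> dist z y"
      proof (cases "y \<in> B")
        case True
        then show ?thesis using x(2) infdist_le[of y B z] by simp
      next
        case False
        then have "r' \<le> dist z y" using near[of y] \<open>y \<in> A\<close> by (force simp: B_def)
        moreover have "dist z x \<le> dist z a" using x(2) infdist_le[OF aB, of z] by simp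
        ultimately show ?thesis using z by (simp add: dist_commute)
      qed
    qed (use assms(1) in auto)
    then have xd: "x \<in> A" "dist z x = d"
      using x(1) infdist_le[of x A z] by (auto simp: B_def d_def)
    have "y = x" if y: "y \<in> A" "dist z y = d" for y
    proof -
      have b: "x \<in> A \<inter> ball a r" "y \<in> A \<inter> ball a r"
        using near[of x] near[of y] xd y d r by auto
      have "(norm (y - x))\<^sup>2 \<le> 2 * d * K * (norm (y - x))\<^sup>2"
      proof (rule two_nearest_bound[OF r(2) xd(2) y(2)])
        fix t :: real assume "t \<in> {0<..<1}"
        then show "\<exists>q. d \<le> dist z q \<and> norm (q - (x + t *\<^sub>R (y - x))) \<le> K * t * (norm (y - x))\<^sup>2"
          using qc[OF b] infdist_le d_def by metis
      qed
      moreover have "2 * d * K < 1"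
      proof -
        have "2 * d * K \<le> 2 * r' * K" using d r(2) by (intro mult_right_mono) auto
        then show ?thesis using r'(3) by linarith
      qed
      ultimately have "(norm (y - x))\<^sup>2 * (1 - 2 * d * K) \<le> 0" "1 - 2 * d * K > 0"
        by (simp_all add: algebra_simps)
      then have "(norm (y - x))\<^sup>2 \<le> 0" by (simp add: mult_le_0_iff)
      then show ?thesis by simp
    qed
    then show "z \<in> Unp A" using xd unfolding Unp_def d_def by auto
  qed
  then show ?thesis using r'(1) by blast
qed

text \<open>An isometry sending \<open>a\<close> to 0 is, after translation, an orthogonal map;
  linearity is what carries points of chords to points of chords.\<close>

lemma almost_convex_isometry:
  fixes A :: "'a::euclidean_space set" and G :: "'a \<Rightarrow> 'a"
  assumes G: "isometry G" "G a = 0" and "r > 0" and M: "almost_convex_at (G ` (A \<inter> ball a r)) 0"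
  shows "almost_convex_at A a"
proof -
  have iso: "dist (G x) (G y) = dist x y" for x y using G(1) by (simp add: isometry_def)
  define f where "f x = G (x + a)" for x
  have f: "orthogonal_transformation f"
    unfolding orthogonal_transformation_isometry by (simp add: f_def G(2) iso)
  have lin: "linear f" using f by (rule orthogonal_transformation_linear)
  have Gf: "G x = f (x - a)" for x by (simp add: f_def)
  have inj: "x = y" if "G x = G y" for x y using iso[of x y] that by simp
  have nG: "norm (G x) = dist a x" for x using iso[of a x] G(2) by simp
  obtain r' K where r': "r' > 0" "K \<ge> 0"
    and qc: "\<And>x y t. x \<in> G ` (A \<inter> ball a r) \<inter> ball 0 r' \<Longrightarrow> y \<in> G ` (A \<inter> ball a r) \<inter> ball 0 r' \<Longrightarrow>
        t \<in> {0<..<1} \<Longrightarrow> \<exists>q\<in>G ` (A \<inter> ball a r). norm (q - (x + t *\<^sub>R (y - x))) \<le> K * t * (norm (y - x))\<^sup>2"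
    and cl: "closure (G ` (A \<inter> ball a r)) \<inter> ball 0 r' \<subseteq> G ` (A \<inter> ball a r)"
    using M unfolding almost_convex_at_def by metis
  define s where "s = min r r'"
  have s: "s > 0" "s \<le> r" "s \<le> r'" using assms(3) r' by (auto simp: s_def)
  have "\<exists>q\<in>A. norm (q - (x + t *\<^sub>R (y - x))) \<le> K * t * (norm (y - x))\<^sup>2"
    if xy: "x \<in> A \<inter> ball a s" "y \<in> A \<inter> ball a s" and t: "t \<in> {0<..<1}" for x y t
  proof -
    have "G x \<in> G ` (A \<inter> ball a r) \<inter> ball 0 r'" "G y \<in> G ` (A \<inter> ball a r) \<inter> ball 0 r'"
      using xy s by (auto simp: nG)
    then obtain q where q: "q \<in> A" "norm (G q - (G x + t *\<^sub>R (G y - G x))) \<le> K * t * (norm (G y - G x))\<^sup>2"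
      using qc t by blast
    have "f (q - (x + t *\<^sub>R (y - x))) = G q - (G x + t *\<^sub>R (G y - G x))"
    proof -
      have "q - (x + t *\<^sub>R (y - x)) = (q - a) - ((x - a) + t *\<^sub>R ((y - a) - (x - a)))" by simp
      then show ?thesis unfolding Gf
        by (simp only: linear_diff[OF lin] linear_add[OF lin] linear_scale[OF lin])
    qed
    moreover have "norm (G y - G x) = norm (y - x)" using iso[of y x] by (simp add: dist_norm)
    ultimately show ?thesis using q orthogonal_transformation_norm[OF f] by metis
  qed
  moreover have "closure A \<inter> ball a s \<subseteq> A"
  proof
    fix z assume z: "z \<in> closure A \<inter> ball a s"
    have "G z \<in> closure (G ` (A \<inter> ball a r))"
      unfolding closure_approachable
    proof (intro allI impI)
      fix e :: real assume "e > 0"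
      then have "min e (s - dist a z) > 0" using z by simp
      then obtain y where y: "y \<in> A" "dist y z < min e (s - dist a z)"
        using z by (metis IntD1 closure_approachable)
      then have "dist a y < r" using dist_triangle[of a y z] s by (simp add: dist_commute)
      then show "\<exists>y\<in>G ` (A \<inter> ball a r). dist y (G z) < e" using y by (auto simp: iso)
    qed
    then have "G z \<in> G ` (A \<inter> ball a r)" using cl z s by (auto simp: nG)
    then show "z \<in> A" using inj by blast
  qed
  ultimately show ?thesis unfolding almost_convex_at_def using s(1) r'(2) by blast
qed

section \<open>Sets of the three types are almost convex\<close>

text \<open>The subtracted square contributes exactly \<open>t * (1 - t) * (y - x)\<^sup>2\<close>,
  its own convexity defect along the chord.\<close>

lemma concave_quadratic:
  fixes u :: "real \<Rightarrow> real"
  assumes "concave_on D (\<lambda>x. u x - c / 2 * \<bar>x\<bar>\<^sup>2)" "x \<in> D" "y \<in> D" "t \<in> {0<..<1}"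
  shows "(1 - t) * u x + t * u y - c / 2 * (t * (1 - t) * (y - x)\<^sup>2) \<le> u ((1 - t) * x + t * y)"
proof -
  have "(1 - t) * (u x - c / 2 * \<bar>x\<bar>\<^sup>2) + t * (u y - c / 2 * \<bar>y\<bar>\<^sup>2) \<le>
      u ((1 - t) * x + t * y) - c / 2 * \<bar>(1 - t) * x + t * y\<bar>\<^sup>2"
    using concave_onD[OF assms(1), of t x y] assms(2-4) by simp
  moreover have "(1 - t) * (u x - c / 2 * x\<^sup>2) + t * (u y - c / 2 * y\<^sup>2) + c / 2 * ((1 - t) * x + t * y)\<^sup>2 =
      (1 - t) * u x + t * u y - c / 2 * (t * (1 - t) * (y - x)\<^sup>2)"
    by (simp add: power2_eq_square field_simps)
  ultimately show ?thesis unfolding power2_abs by linarith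
qed

text \<open>Moving the point of a chord vertically into the strip costs at most the semiconcavity defects
  of the two bounding graphs.\<close>

lemma strip_almost_convex:
  assumes r: "r > 0" and D: "D = {-r<..<r} \<inter> E" "closed E" "convex D"
    and cont: "continuous_on D \<phi>" "continuous_on D \<psi>" and le: "\<And>x. x \<in> D \<Longrightarrow> \<psi> x \<le> \<phi> x"
    and c: "c \<ge> 0" "concave_on D (\<lambda>x. \<phi> x - c / 2 * \<bar>x\<bar>\<^sup>2)"
    and c': "c' \<ge> 0" "concave_on D (\<lambda>x. - \<psi> x - c' / 2 * \<bar>x\<bar>\<^sup>2)"
  shows "almost_convex_at (ball 0 r \<inter> hypo D \<phi> \<inter> epi D \<psi>) 0"
proof -
  define M where "M = ball 0 r \<inter> hypo D \<phi> \<inter> epi D \<psi>"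
  have M: "(x, t) \<in> M \<longleftrightarrow> norm (x, t) < r \<and> x \<in> D \<and> \<psi> x \<le> t \<and> t \<le> \<phi> x" for x t
    by (auto simp: M_def hypo_def epi_def)
  define K where "K = c/2 + c'/2"
  have K: "K \<ge> 0" using c c' by (simp add: K_def)
  \<comment> \<open>\<open>4 * s * K \<le> 1/2\<close> limits the vertical correction to
    \<open>s/2\<close>, so the corrected point stays in the ball of radius \<open>r\<close>.\<close>
  define s where "s = min (r/2) (1 / (8 * K + 1))"
  have s: "s > 0" "s \<le> r/2" "4 * s * K \<le> 1/2"
  proof -
    show "s > 0" using r K by (simp add: s_def add_nonneg_pos)
    have "s \<le> 1 / (8 * K + 1)" by (simp add: s_def)
    then have "s * (8 * K + 1) \<le> 1" using K by (simp add: pos_le_divide_eq add_nonneg_pos)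
    then show "4 * s * K \<le> 1/2" using \<open>s > 0\<close> by (simp add: algebra_simps)
  qed (simp add: s_def)
  have "\<exists>q\<in>M. norm (q - (p + t *\<^sub>R (p' - p))) \<le> K * t * (norm (p' - p))\<^sup>2"
    if p: "p \<in> M \<inter> ball 0 s" "p' \<in> M \<inter> ball 0 s" and t: "t \<in> {0<..<1}" for p p' t
  proof -
    obtain x1 x2 y1 y2 where xy: "p = (x1, x2)" "p' = (y1, y2)" by (cases p, cases p')
    have x: "x1 \<in> D" "\<psi> x1 \<le> x2" "x2 \<le> \<phi> x1" "y1 \<in> D" "\<psi> y1 \<le> y2" "y2 \<le> \<phi> y1"
      using p M by (auto simp: xy)
    have t': "0 < t" "t < 1" using t by auto
    define u where "u = (1 - t) * x1 + t * y1"
    define l where "l = (1 - t) * x2 + t * y2"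
    define h where "h = t * (1 - t) * (y1 - x1)\<^sup>2"
    have h0: "h \<ge> 0" using t' by (simp add: h_def)
    have uD: "u \<in> D" using D(3) x t' unfolding u_def convex_alt by auto
    have "(1 - t) * x2 + t * y2 \<le> (1 - t) * \<phi> x1 + t * \<phi> y1"
      using x t' by (intro add_mono mult_left_mono) auto
    then have up: "l - c/2 * h \<le> \<phi> u"
      using concave_quadratic[OF c(2) x(1,4) t] unfolding u_def l_def h_def by linarith
    have "(1 - t) * \<psi> x1 + t * \<psi> y1 \<le> (1 - t) * x2 + t * y2"
      using x t' by (intro add_mono mult_left_mono) auto
    then have lo: "\<psi> u \<le> l + c'/2 * h"
      using concave_quadratic[OF c'(2) x(1,4) t] unfolding u_def l_def h_def by simp
    \<comment> \<open>The height of the chord, clamped to the fibre over \<open>u\<close>.\<close>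
    define w where "w = max (\<psi> u) (min (\<phi> u) l)"
    have w: "\<psi> u \<le> w" "w \<le> \<phi> u" using le[OF uD] by (auto simp: w_def)
    have "c/2 * h \<ge> 0" "c'/2 * h \<ge> 0" using c c' h0 by auto
    then have wl: "\<bar>w - l\<bar> \<le> K * h"
      using up lo le[OF uD] unfolding w_def K_def by (auto simp: distrib_right max_def min_def)
    have "(y1 - x1)\<^sup>2 \<le> (norm (p' - p))\<^sup>2" by (simp add: xy norm_Pair)
    then have "t * (1 - t) * (y1 - x1)\<^sup>2 \<le> t * 1 * (norm (p' - p))\<^sup>2"
      using t' by (intro mult_mono) auto
    then have "K * h \<le> K * (t * (norm (p' - p))\<^sup>2)" unfolding h_def using K by (intro mult_left_mono) auto
    then have wK: "\<bar>w - l\<bar> \<le> K * t * (norm (p' - p))\<^sup>2" using wl by (simp add: mult.assoc)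
    have e: "(u, w) - (p + t *\<^sub>R (p' - p)) = (0, w - l)"
      by (simp add: xy u_def l_def algebra_simps)
    have nb: "norm (p + t *\<^sub>R (p' - p)) < s"
    proof -
      have "(1 - t) *\<^sub>R p + t *\<^sub>R p' \<in> ball 0 s" using p t' convex_ball[of 0 s] by (intro convexD) auto
      moreover have "(1 - t) *\<^sub>R p + t *\<^sub>R p' = p + t *\<^sub>R (p' - p)" by (simp add: algebra_simps)
      ultimately show ?thesis by simp
    qed
    have "norm (p' - p) \<le> 2 * s" using norm_triangle_ineq4[of p' p] p by simp
    then have "t * (norm (p' - p))\<^sup>2 \<le> 1 * (2 * s)\<^sup>2" using t' by (intro mult_mono power_mono) auto
    then have "K * (t * (norm (p' - p))\<^sup>2) \<le> K * (1 * (2 * s)\<^sup>2)" using K by (rule mult_left_mono)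
    also have "\<dots> = (4 * s * K) * s" by (simp add: power2_eq_square)
    also have "\<dots> \<le> 1/2 * s" using s by (intro mult_right_mono) auto
    finally have "\<bar>w - l\<bar> \<le> s/2" using wK by (simp add: mult.assoc)
    then have "norm ((u, w) - (p + t *\<^sub>R (p' - p))) \<le> s/2" unfolding e by (simp add: norm_Pair)
    then have "norm (u, w) < r"
      using nb norm_triangle_ineq2[of "(u, w)" "p + t *\<^sub>R (p' - p)"] s(1,2) by linarith
    then have "(u, w) \<in> M" using w uD M by simp
    moreover have "norm ((u, w) - (p + t *\<^sub>R (p' - p))) \<le> K * t * (norm (p' - p))\<^sup>2"
      unfolding e using wK by (simp add: norm_Pair)
    ultimately show ?thesis by blast
  qed
  moreover have "closure M \<inter> ball 0 s \<subseteq> M"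
  proof
    fix z assume z: "z \<in> closure M \<inter> ball 0 s"
    obtain x t where xt: "z = (x, t)" by (cases z)
    have n: "norm (x, t) < r" using z s r by (simp add: xt)
    have "\<bar>x\<bar> < r" using n norm_Pair_bounds(1)[of x t] by linarith
    obtain X where X: "\<And>n::nat. X n \<in> M" "X \<longlonglongrightarrow> z" using z closure_sequential by blast
    have f: "(\<lambda>n. fst (X n)) \<longlonglongrightarrow> x" "(\<lambda>n. snd (X n)) \<longlonglongrightarrow> t"
      using tendsto_fst[OF X(2)] tendsto_snd[OF X(2)] by (auto simp: xt)
    have XM: "fst (X n) \<in> D" "\<psi> (fst (X n)) \<le> snd (X n)" "snd (X n) \<le> \<phi> (fst (X n))" for n
      using X(1)[of n] M[of "fst (X n)" "snd (X n)"] by auto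
    \<comment> \<open>The abscissa \<open>x\<close> is strictly within \<open>r\<close>, so only the
      boundary described by \<open>E\<close> could be met in the limit, and \<open>E\<close> is
      closed.\<close>
    have "x \<in> E" using closed_sequentially[OF D(2) _ f(1)] XM(1) by (simp add: D(1))
    then have xD: "x \<in> D" using \<open>\<bar>x\<bar> < r\<close> by (auto simp: D(1) abs_less_iff)
    have "(\<lambda>n. \<phi> (fst (X n))) \<longlonglongrightarrow> \<phi> x" "(\<lambda>n. \<psi> (fst (X n))) \<longlonglongrightarrow> \<psi> x"
      using continuous_on_tendsto_compose[OF cont(1) f(1) xD] continuous_on_tendsto_compose[OF cont(2) f(1) xD]
        XM(1) by auto
    then have "t \<le> \<phi> x" "\<psi> x \<le> t" using XM f(2) by (auto intro: LIMSEQ_le)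
    then show "z \<in> M" using n xD M by (simp add: xt)
  qed
  ultimately show ?thesis
    unfolding almost_convex_at_def M_def[symmetric] using s(1) K by blast
qed

text \<open>A hypograph becomes a strip by adding a constant floor below both the ball and the
  graph.\<close>

lemma T1_almost_convex:
  assumes "r > 0" "T1_set r M"
  shows "almost_convex_at M 0"
proof -
  obtain \<phi> L where \<phi>: "L-lipschitz_on {-r<..<r} \<phi>" "semiconcave_on {-r<..<r} \<phi>" "\<phi> 0 = 0"
      "M = ball 0 r \<inter> hypo {-r<..<r} \<phi>"
    using assms(2) unfolding T1_set_def by blast
  obtain c where c: "c \<ge> 0" "concave_on {-r<..<r} (\<lambda>x. \<phi> x - c / 2 * \<bar>x\<bar>\<^sup>2)"
    using \<phi>(2) unfolding semiconcave_on_def by blast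
  have L: "L \<ge> 0" using \<phi>(1) by (rule lipschitz_on_nonneg)
  \<comment> \<open>\<open>L * r\<close> puts the floor below the graph, \<open>r\<close> puts it
    below the ball.\<close>
  define b where "b = r + L * r"
  have b: "- b \<le> \<phi> x" if x: "x \<in> {-r<..<r}" for x
  proof -
    have "dist (\<phi> x) (\<phi> 0) \<le> L * dist x 0" using assms(1) x by (intro lipschitz_onD[OF \<phi>(1)]) auto
    also have "\<dots> \<le> L * r" using x L by (intro mult_left_mono) auto
    finally show ?thesis using assms(1) by (simp add: \<phi>(3) b_def dist_real_def)
  qed
  have "(x, t) \<in> M \<longleftrightarrow> (x, t) \<in> M \<inter> epi {-r<..<r} (\<lambda>_. - b)" for x t
  proof -
    have "- b \<le> t" if "norm (x, t) < r"
      using that norm_Pair_bounds(2)[where a=x and b=t] L assms(1) mult_nonneg_nonneg[of L r]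
      unfolding b_def by linarith
    then show ?thesis by (auto simp: \<phi>(4) epi_def hypo_def)
  qed
  then have "M = ball 0 r \<inter> hypo {-r<..<r} \<phi> \<inter> epi {-r<..<r} (\<lambda>_. - b)"
    unfolding \<phi>(4) set_eq_iff split_paired_All by blast
  moreover have "almost_convex_at (ball 0 r \<inter> hypo {-r<..<r} \<phi> \<inter> epi {-r<..<r} (\<lambda>_. - b)) 0"
  proof (rule strip_almost_convex[OF assms(1) _ closed_UNIV _ _ _ b c, where c' = 0])
    show "continuous_on {-r<..<r} \<phi>" using \<phi>(1) by (rule lipschitz_on_continuous_on)
    show "concave_on {-r<..<r} (\<lambda>x. - (- b) - 0 / 2 * \<bar>x\<bar>\<^sup>2)"
      by (simp add: concave_on_iff flip: distrib_right)
  qed auto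
  ultimately show ?thesis by simp
qed

lemma T2_almost_convex:
  assumes "r > 0" "T2_set r M"
  shows "almost_convex_at M 0"
proof -
  obtain \<phi> \<psi> L L' where \<phi>: "L-lipschitz_on {-r<..<r} \<phi>" "L'-lipschitz_on {-r<..<r} \<psi>"
      "\<forall>x\<in>{-r<..<r}. \<psi> x \<le> \<phi> x" "semiconcave_on {-r<..<r} \<phi>" "semiconvex_on {-r<..<r} \<psi>"
      "M = ball 0 r \<inter> hypo {-r<..<r} \<phi> \<inter> epi {-r<..<r} \<psi>"
    using assms(2) unfolding T2_set_def by blast
  obtain c where c: "c \<ge> 0" "concave_on {-r<..<r} (\<lambda>x. \<phi> x - c / 2 * \<bar>x\<bar>\<^sup>2)"
    using \<phi>(4) unfolding semiconcave_on_def by blast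
  obtain c' where c': "c' \<ge> 0" "concave_on {-r<..<r} (\<lambda>x. - \<psi> x - c' / 2 * \<bar>x\<bar>\<^sup>2)"
    using \<phi>(5) unfolding semiconvex_on_def semiconcave_on_def by blast
  show ?thesis
    unfolding \<phi>(6)
    by (rule strip_almost_convex[OF assms(1) _ closed_UNIV _
          lipschitz_on_continuous_on[OF \<phi>(1)] lipschitz_on_continuous_on[OF \<phi>(2)] _ c c'])
      (use \<phi>(3) in auto)
qed

text \<open>Type 3 gives semiconcavity on the open interval only, while chords may start over 0.
  Continuity lets the inequality pass to the limit in the left end of the chord.\<close>

lemma concave_on_left_endpoint:
  fixes g :: "real \<Rightarrow> real"
  assumes "concave_on {0<..<r} g" "continuous_on {0..<r} g"
  shows "concave_on {0..<r} g"
proof (rule concave_on_linorderI)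
  fix t x y :: real assume t: "0 < t" "t < 1" and xy: "x \<in> {0..<r}" "y \<in> {0..<r}" "x < y"
  define h where "h n = x + (y - x) * inverse (real (Suc n))" for n
  have h: "x < h n" "h n \<le> y" for n
  proof -
    have "0 < inverse (real (Suc n))" "inverse (real (Suc n)) \<le> 1" by (simp_all add: inverse_le_1_iff)
    then have "0 < (y - x) * inverse (real (Suc n))" "(y - x) * inverse (real (Suc n)) \<le> y - x"
      using xy(3) by (auto intro: mult_left_le)
    then show "x < h n" "h n \<le> y" by (simp_all add: h_def)
  qed
  have hD: "h n \<in> {0<..<r}" for n using h[of n] xy by auto
  have "h \<longlonglongrightarrow> x + (y - x) * 0"
    unfolding h_def by (intro tendsto_intros LIMSEQ_inverse_real_of_nat)
  then have hx: "h \<longlonglongrightarrow> x" by simp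
  have yD: "y \<in> {0<..<r}" using xy by auto
  have ineq: "(1 - t) * g (h n) + t * g y \<le> g ((1 - t) * h n + t * y)" for n
    using concave_onD[OF assms(1) _ _ hD yD, of t n] t by simp
  have conv: "(1 - t) * x' + t * y \<in> {0..<r}" if "x' \<in> {0..<r}" for x'
    using convexD_alt[OF convex_real_interval(7)[of 0 r] that xy(2), of t] t by simp
  have "(\<lambda>n. g (h n)) \<longlonglongrightarrow> g x"
    using hD by (intro continuous_on_tendsto_compose[OF assms(2) hx xy(1)] always_eventually) (auto simp: less_imp_le)
  then have 1: "(\<lambda>n. (1 - t) * g (h n) + t * g y) \<longlonglongrightarrow> (1 - t) * g x + t * g y"
    by (intro tendsto_intros)
  have "(\<lambda>n. (1 - t) * h n + t * y) \<longlonglongrightarrow> (1 - t) * x + t * y" by (intro tendsto_intros hx)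
  moreover have "(1 - t) * h n + t * y \<in> {0..<r}" for n using conv[of "h n"] hD[of n] by auto
  ultimately have 2: "(\<lambda>n. g ((1 - t) * h n + t * y)) \<longlonglongrightarrow> g ((1 - t) * x + t * y)"
    using conv[OF xy(1)] by (intro continuous_on_tendsto_compose[OF assms(2)] always_eventually) auto
  show "(1 - t) * g x + t * g y \<le> g ((1 - t) *\<^sub>R x + t *\<^sub>R y)"
    using LIMSEQ_le[OF 1 2] ineq by auto
qed simp

lemma T3_almost_convex:
  assumes "r > 0" "T3_set r M"
  shows "almost_convex_at M 0"
proof -
  obtain \<phi> \<psi> L L' where \<phi>: "L-lipschitz_on {0..<r} \<phi>" "L'-lipschitz_on {0..<r} \<psi>"
      "\<forall>x\<in>{0..<r}. \<psi> x \<le> \<phi> x" "semiconcave_on {0<..<r} \<phi>" "semiconvex_on {0<..<r} \<psi>"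
      "M = ball 0 r \<inter> hypo {0..<r} \<phi> \<inter> epi {0..<r} \<psi>"
    using assms(2) unfolding T3_set_def by blast
  have cont: "continuous_on {0..<r} \<phi>" "continuous_on {0..<r} \<psi>"
    using lipschitz_on_continuous_on \<phi>(1,2) by auto
  obtain c where c: "c \<ge> 0" "concave_on {0<..<r} (\<lambda>x. \<phi> x - c / 2 * \<bar>x\<bar>\<^sup>2)"
    using \<phi>(4) unfolding semiconcave_on_def by blast
  obtain c' where c': "c' \<ge> 0" "concave_on {0<..<r} (\<lambda>x. - \<psi> x - c' / 2 * \<bar>x\<bar>\<^sup>2)"
    using \<phi>(5) unfolding semiconvex_on_def semiconcave_on_def by blast
  have cc: "concave_on {0..<r} (\<lambda>x. \<phi> x - c / 2 * \<bar>x\<bar>\<^sup>2)" "concave_on {0..<r} (\<lambda>x. - \<psi> x - c' / 2 * \<bar>x\<bar>\<^sup>2)"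
    by (intro concave_on_left_endpoint c c' continuous_intros cont)+
  show ?thesis
    unfolding \<phi>(6)
    by (rule strip_almost_convex[OF assms(1) _ closed_atLeast[of 0] _ cont _ c(1) cc(1) c'(1) cc(2)])
      (use \<phi>(3) assms(1) in auto)
qed

lemma type_T_reach:
  assumes "i \<in> {1, 2, 3}" "of_type_T i A a"
  shows "\<exists>r>0. ball a r \<subseteq> Unp A"
proof -
  obtain G r where G: "a \<in> A" "isometry G" "G a = 0" "r > 0" "T_set i r (G ` (A \<inter> ball a r))"
    using assms(2) unfolding of_type_T_def by blast
  then have "almost_convex_at (G ` (A \<inter> ball a r)) 0"
    using T1_almost_convex T2_almost_convex T3_almost_convex unfolding T_set_def by blast
  then have "almost_convex_at A a" by (rule almost_convex_isometry[OF G(2,3,4)])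
  then show ?thesis by (rule reach_almost_convex[OF G(1)])
qed

text \<open>Near \<open>a\<close> the only chord is the trivial one, so almost convexity holds with
  constant 0.\<close>

lemma isolated_reach:
  fixes A :: "'a::euclidean_space set"
  assumes "a isolated_in A"
  shows "\<exists>r>0. ball a r \<subseteq> Unp A"
proof -
  obtain e where e: "a \<in> A" "e > 0" "\<And>y. y \<in> A \<Longrightarrow> dist a y < e \<Longrightarrow> y = a"
    using assms by (auto simp: isolated_in_dist_Ex_iff)
  have "almost_convex_at A a"
    unfolding almost_convex_at_def
  proof (rule exI[of _ e], intro conjI e(2), rule exI[of _ 0], intro conjI ballI subsetI)
    fix x y t assume "x \<in> A \<inter> ball a e" "y \<in> A \<inter> ball a e"
    then have "x = a" "y = a" using e(3) by auto
    then show "\<exists>q\<in>A. norm (q - (x + t *\<^sub>R (y - x))) \<le> 0 * t * (norm (y - x))\<^sup>2"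
      using e(1) by (auto intro!: bexI[of _ a])
  next
    fix z assume z: "z \<in> closure A \<inter> ball a e"
    show "z \<in> A"
    proof (cases "z = a")
      case False
      then have "min (dist a z) (e - dist a z) > 0" using z by simp
      then obtain y where y: "y \<in> A" "dist y z < min (dist a z) (e - dist a z)"
        using z by (metis IntD1 closure_approachable)
      then have "dist a y < e" using dist_triangle[of a y z] by (simp add: dist_commute)
      then show ?thesis using e(3) y by force
    qed (simp add: e(1))
  qed simp
  then show ?thesis by (rule reach_almost_convex[OF e(1)])
qed

lemma interior_reach:
  fixes A :: "'a::euclidean_space set"
  assumes "a \<in> interior A"
  shows "\<exists>r>0. ball a r \<subseteq> Unp A"
proof -
  obtain e where "e > 0" "ball a e \<subseteq> A" using assms by (auto simp: mem_interior)
  moreover have "z \<in> Unp A" if "z \<in> A" for z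
    using that by (auto simp: Unp_def intro!: ex1I[of _ z])
  ultimately show ?thesis by blast
qed

theorem theorem6p4:
  fixes A :: "(real \<times> real) set" and a :: "real \<times> real"
  assumes "a \<in> A"
  shows "reach_at A a > 0 \<longleftrightarrow>
    a \<in> interior A \<or> a isolated_in A \<or> (\<exists>i\<in>{1, 2, 3}. of_type_T i A a)"
  unfolding reach_at_pos_iff
  using positive_reach_types[OF assms] interior_reach isolated_reach type_T_reach by blast

end
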